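(* Let $\mathbb F$ be a field and let $H=T\{x_n\mid n\ge1\}$ be the free unital (non-associative) $\mathbb F$-algebra on generators $x_n$, with the algebra homomorphisms $\Delta,\delta_r,\delta_l:H\to H\amalg H$, $\varepsilon:H\to\mathbb F$ given in the context (the coloop bialgebra of invertible series). Then $H$ is a coloop in the category $\mathbf{Alg}_{\mathbb F}$ of unital, not necessarily associative, $\mathbb F$-algebras, and it represents the loop of invertible series as a functor $\mathrm{Inv}:\mathbf{Alg}_{\mathbb F}\to\mathbf{Loop}$. As a consequence, given $A\in\mathbf{Alg}_{\mathbb F}$, a series $a=\sum_{n\ge0}a_n\lambda^n\in\mathrm{Inv}(A)$ can be seen as the algebra homomorphism $a:H\to A$ with $a(x_n)=a_n$, and the right and left divisions of $a,b\in\mathrm{Inv}(A)$ are given, for every $n\ge1$, by $$(a/b)_n=\mu_A(a\amalg b)\delta_r(x_n)=a_n-b_n+\sum_{\ell=1}^{n-1}(-1)^\ell\sum_{\mathbf n\in\mathcal C_n^{\ell+1}}\Big(\big(((a_{n_1}-b_{n_1})b_{n_2})b_{n_3}\big)\cdots\Big)b_{n_{\ell+1}},$$ $$(a\backslash b)_n=\mu_A(a\amalg b)\delta_l(x_n)=b_n-a_n+\sum_{\ell=1}^{n-1}(-1)^\ell\sum_{\mathbf n\in\mathcal C_n^{\ell+1}}a_{n_1}\Big(a_{n_2}\big(\cdots(a_{n_\ell}(b_{n_{\ell+1}}-a_{n_{\ell+1}}))\big)\Big).$$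
   Context: **Loops.** A loop is a set $Q$ with a multiplication, a two-sided unit, a left division $\backslash$ and a right division $/$ such that $a\cdot(a\backslash b)=b$, $a\backslash(a\cdot b)=b$, $(a/b)\cdot b=a$, $(a\cdot b)/b=a$; $\mathbf{Loop}$ is the category of loops and multiplicative maps. **Coloops.** In a category with coproduct $\amalg$ and initial object $I$, write $u_A:I\to A$ for the unique map, $i_1,i_2$ for the canonical maps into a coproduct, $\mu_A=\langle \mathrm{id}_A,\mathrm{id}_A\rangle:A\amalg A\to A$ for the folding map, and $\varphi_1=i_1:H\to H\amalg I$, $\varphi_2=i_2:H\to I\amalg H$ for the canonical isomorphisms. A coloop is an object $H$ with maps $\Delta,\delta_r,\delta_l:H\to H\amalg H$, $\varepsilon:H\to I$ such that $(\varepsilon\amalg \mathrm{id})\Delta=\varphi_2$, $(\mathrm{id}\amalg\varepsilon)\Delta=\varphi_1$; $(\mathrm{id}\amalg\mu)(\delta_r\amalg \mathrm{id})\Delta=i_1=(\mathrm{id}\amalg\mu)(\Delta\amalg \mathrm{id})\delta_r$; $(\mu\amalg \mathrm{id})(\mathrm{id}\amalg\delta_l)\Delta=i_2=(\mu\amalg \mathrm{id})(\mathrm{id}\amalg\Delta)\delta_l$. A coloop $H$ represents a functor $Q$ in loops if $Q(A)\cong\mathrm{Hom}(H,A)$ naturally in $A$, with $\alpha\cdot\beta=\mu_A(\alpha\amalg\beta)\Delta$, $\alpha/\beta=\mu_A(\alpha\amalg\beta)\delta_r$, $\alpha\backslash\beta=\mu_A(\alpha\amalg\beta)\delta_l$ and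 unit $u_A\varepsilon$. In $\mathbf{Alg}_{\mathbb F}$ the initial object is $\mathbb F$ and $H\amalg H$ is the free unital non-associative algebra on two copies of the generators. **Invertible series.** $\mathrm{Inv}(A)=\{a=\sum_{n\ge0}a_n\lambda^n\mid a_0=1,\ a_n\in A\}$ with $(a\cdot b)_n=\sum_{m=0}^na_mb_{n-m}$ and unit the constant series $1$. **Co-operations.** $\mathcal C_n^\ell$ is the set of compositions $\mathbf n=(n_1,\dots,n_\ell)$ of $n$ into $\ell$ positive integers. In $H\amalg H$, $x_n$ and $y_n$ denote the generator $x_n$ in the first and second copy of $H$, and $x_0=y_0=1$. For $n\ge1$: $\Delta(x_n)=\sum_{m=0}^nx_my_{n-m}$; $\varepsilon(x_n)=0$; $\delta_r(x_n)=x_n-y_n+\sum_{\ell=1}^{n-1}(-1)^\ell\sum_{\mathbf n\in\mathcal C_n^{\ell+1}}\big((((x_{n_1}-y_{n_1})y_{n_2})y_{n_3})\cdots\big)y_{n_{\ell+1}}$ (all parentheses to the left); $\delta_l(x_n)=y_n-x_n+\sum_{\ell=1}^{n-1}(-1)^\ell\sum_{\mathbf n\in\mathcal C_n^{\ell+1}}x_{n_1}\big(x_{n_2}(\cdots(x_{n_\ell}(y_{n_{\ell+1}}-x_{n_{\ell+1}})))\big)$ (all parentheses to the right). *)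

theory Defs
  imports "HOL-Algebra.Module" "HOL-Algebra.QuotRing"
begin

section \<open>Loops\<close>

record 'a loop = "'a monoid" +
  ldiv :: "'a \<Rightarrow> 'a \<Rightarrow> 'a"
  rdiv :: "'a \<Rightarrow> 'a \<Rightarrow> 'a"

text \<open>\<open>ldiv L a b\<close> is $a\backslash b$ and \<open>rdiv L a b\<close> is $a/b$.
  A morphism of loops is a multiplicative map, i.e. an element of \<^const>\<open>hom\<close>.\<close>

locale loop =
  fixes L :: "('a, 'm) loop_scheme" (structure)
  assumes mult_closed: "\<lbrakk>a \<in> carrier L; b \<in> carrier L\<rbrakk> \<Longrightarrow> a \<otimes> b \<in> carrier L"
    and one_closed: "\<one> \<in> carrier L"
    and ldiv_closed: "\<lbrakk>a \<in> carrier L; b \<in> carrier L\<rbrakk> \<Longrightarrow> ldiv L a b \<in> carrier L"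
    and rdiv_closed: "\<lbrakk>a \<in> carrier L; b \<in> carrier L\<rbrakk> \<Longrightarrow> rdiv L a b \<in> carrier L"
    and l_one: "a \<in> carrier L \<Longrightarrow> \<one> \<otimes> a = a"
    and r_one: "a \<in> carrier L \<Longrightarrow> a \<otimes> \<one> = a"
    and mult_ldiv: "\<lbrakk>a \<in> carrier L; b \<in> carrier L\<rbrakk> \<Longrightarrow> a \<otimes> ldiv L a b = b"
    and ldiv_mult: "\<lbrakk>a \<in> carrier L; b \<in> carrier L\<rbrakk> \<Longrightarrow> ldiv L a (a \<otimes> b) = b"
    and rdiv_mult: "\<lbrakk>a \<in> carrier L; b \<in> carrier L\<rbrakk> \<Longrightarrow> rdiv L a b \<otimes> b = a"
    and mult_rdiv: "\<lbrakk>a \<in> carrier L; b \<in> carrier L\<rbrakk> \<Longrightarrow> rdiv L (a \<otimes> b) b = a"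

definition loop_iso :: "('a, 'm) loop_scheme \<Rightarrow> ('b, 'n) loop_scheme \<Rightarrow> ('a \<Rightarrow> 'b) set" where
  "loop_iso L M = {h \<in> iso L M. h \<one>\<^bsub>L\<^esub> = \<one>\<^bsub>M\<^esub> \<and>
     (\<forall>a\<in>carrier L. \<forall>b\<in>carrier L.
        h (ldiv L a b) = ldiv M (h a) (h b) \<and> h (rdiv L a b) = rdiv M (h a) (h b))}"


section \<open>The category of unital non-associative algebras over a field\<close>

locale nonassoc_algebra = module F A + field F
  for F :: "('f, 'm) ring_scheme" (structure) and A :: "('f, 'a) module" (structure) +
  assumes mult_closed: "\<lbrakk>a \<in> carrier A; b \<in> carrier A\<rbrakk> \<Longrightarrow> a \<otimes>\<^bsub>A\<^esub> b \<in> carrier A"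
    and one_closed: "\<one>\<^bsub>A\<^esub> \<in> carrier A"
    and mult_l_one: "a \<in> carrier A \<Longrightarrow> \<one>\<^bsub>A\<^esub> \<otimes>\<^bsub>A\<^esub> a = a"
    and mult_r_one: "a \<in> carrier A \<Longrightarrow> a \<otimes>\<^bsub>A\<^esub> \<one>\<^bsub>A\<^esub> = a"
    and mult_l_distr: "\<lbrakk>a \<in> carrier A; b \<in> carrier A; c \<in> carrier A\<rbrakk>
      \<Longrightarrow> (a \<oplus>\<^bsub>A\<^esub> b) \<otimes>\<^bsub>A\<^esub> c = a \<otimes>\<^bsub>A\<^esub> c \<oplus>\<^bsub>A\<^esub> b \<otimes>\<^bsub>A\<^esub> c"
    and mult_r_distr: "\<lbrakk>a \<in> carrier A; b \<in> carrier A; c \<in> carrier A\<rbrakk>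
      \<Longrightarrow> a \<otimes>\<^bsub>A\<^esub> (b \<oplus>\<^bsub>A\<^esub> c) = a \<otimes>\<^bsub>A\<^esub> b \<oplus>\<^bsub>A\<^esub> a \<otimes>\<^bsub>A\<^esub> c"
    and smult_mult_l: "\<lbrakk>r \<in> carrier F; a \<in> carrier A; b \<in> carrier A\<rbrakk>
      \<Longrightarrow> (r \<odot>\<^bsub>A\<^esub> a) \<otimes>\<^bsub>A\<^esub> b = r \<odot>\<^bsub>A\<^esub> (a \<otimes>\<^bsub>A\<^esub> b)"
    and smult_mult_r: "\<lbrakk>r \<in> carrier F; a \<in> carrier A; b \<in> carrier A\<rbrakk>
      \<Longrightarrow> a \<otimes>\<^bsub>A\<^esub> (r \<odot>\<^bsub>A\<^esub> b) = r \<odot>\<^bsub>A\<^esub> (a \<otimes>\<^bsub>A\<^esub> b)"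

text \<open>Morphisms are extensional functions, so that equality of morphisms is equality of
  functions; they are composed with \<^const>\<open>compose\<close>.\<close>

definition alg_hom ::
  "('f, 'm) ring_scheme \<Rightarrow> ('f, 'a) module \<Rightarrow> ('f, 'b) module \<Rightarrow> ('a \<Rightarrow> 'b) set" where
  "alg_hom F A B = {h \<in> ring_hom A B \<inter> extensional (carrier A).
     \<forall>r\<in>carrier F. \<forall>a\<in>carrier A. h (r \<odot>\<^bsub>A\<^esub> a) = r \<odot>\<^bsub>B\<^esub> h a}"

definition alg_id :: "('f, 'a) module \<Rightarrow> 'a \<Rightarrow> 'a" where
  "alg_id A = (\<lambda>a\<in>carrier A. a)"

text \<open>The initial object: the field as an algebra over itself.\<close>

definition init_alg :: "('f, 'm) ring_scheme \<Rightarrow> ('f, 'f) module" where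
  "init_alg F = \<lparr>carrier = carrier F, mult = mult F, one = \<one>\<^bsub>F\<^esub>, zero = \<zero>\<^bsub>F\<^esub>, add = add F,
     smult = mult F\<rparr>"

definition init_map :: "('f, 'm) ring_scheme \<Rightarrow> ('f, 'a) module \<Rightarrow> 'f \<Rightarrow> 'a" where
  "init_map F A = (\<lambda>r\<in>carrier F. r \<odot>\<^bsub>A\<^esub> \<one>\<^bsub>A\<^esub>)"


subsection \<open>Free algebras\<close>

text \<open>The free unital magma: \<^const>\<open>None\<close> is the unit, \<open>Some t\<close> is the
  bracketed word \<open>t\<close>.\<close>

datatype 'x word = Gen 'x | Prod "'x word" "'x word"

type_synonym 'x monom = "'x word option"

fun monom_mult :: "'x monom \<Rightarrow> 'x monom \<Rightarrow> 'x monom" where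
  "monom_mult None v = v"
| "monom_mult (Some s) None = Some s"
| "monom_mult (Some s) (Some t) = Some (Prod s t)"

definition monoms :: "'x set \<Rightarrow> 'x monom set" where
  "monoms X = insert None (Some ` {t. set_word t \<subseteq> X})"

text \<open>Elements of the free algebra are finitely supported coefficient functions on
  monomials; a monomial has only finitely many factorisations into two monomials.\<close>

definition free_alg ::
  "('f, 'm) ring_scheme \<Rightarrow> 'x set \<Rightarrow> ('f, 'x monom \<Rightarrow> 'f) module" where
  "free_alg F X = \<lparr>
     carrier = {p. range p \<subseteq> carrier F \<and> finite {w. p w \<noteq> \<zero>\<^bsub>F\<^esub>} \<and> {w. p w \<noteq> \<zero>\<^bsub>F\<^esub>} \<subseteq> monoms X},
     mult = (\<lambda>p q w. finsum F (\<lambda>(u, v). p u \<otimes>\<^bsub>F\<^esub> q v) {(u, v). monom_mult u v = w}),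
     one = (\<lambda>w. if w = None then \<one>\<^bsub>F\<^esub> else \<zero>\<^bsub>F\<^esub>),
     zero = (\<lambda>w. \<zero>\<^bsub>F\<^esub>),
     add = (\<lambda>p q w. p w \<oplus>\<^bsub>F\<^esub> q w),
     smult = (\<lambda>r p w. r \<otimes>\<^bsub>F\<^esub> p w)\<rparr>"

definition free_gen :: "('f, 'm) ring_scheme \<Rightarrow> 'x \<Rightarrow> 'x monom \<Rightarrow> 'f" where
  "free_gen F x = (\<lambda>w. if w = Some (Gen x) then \<one>\<^bsub>F\<^esub> else \<zero>\<^bsub>F\<^esub>)"

primrec eval_word :: "('f, 'a) module \<Rightarrow> ('x \<Rightarrow> 'a) \<Rightarrow> 'x word \<Rightarrow> 'a" where
  "eval_word A f (Gen x) = f x"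
| "eval_word A f (Prod s t) = eval_word A f s \<otimes>\<^bsub>A\<^esub> eval_word A f t"

definition eval_monom :: "('f, 'a) module \<Rightarrow> ('x \<Rightarrow> 'a) \<Rightarrow> 'x monom \<Rightarrow> 'a" where
  "eval_monom A f w = (case w of None \<Rightarrow> \<one>\<^bsub>A\<^esub> | Some t \<Rightarrow> eval_word A f t)"

text \<open>The algebra homomorphism extending \<open>f : X \<rightarrow> A\<close>.\<close>

definition free_lift ::
  "('f, 'm) ring_scheme \<Rightarrow> 'x set \<Rightarrow> ('f, 'a) module \<Rightarrow> ('x \<Rightarrow> 'a) \<Rightarrow> ('x monom \<Rightarrow> 'f) \<Rightarrow> 'a" where
  "free_lift F X A f = (\<lambda>p\<in>carrier (free_alg F X).
     \<Oplus>\<^bsub>A\<^esub>w\<in>{w. p w \<noteq> \<zero>\<^bsub>F\<^esub>}. p w \<odot>\<^bsub>A\<^esub> eval_monom A f w)"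


subsection \<open>Quotient algebras\<close>

definition alg_ideal :: "('f, 'm) ring_scheme \<Rightarrow> ('f, 'a) module \<Rightarrow> 'a set \<Rightarrow> bool" where
  "alg_ideal F A J \<longleftrightarrow> submodule J F A \<and>
     (\<forall>a\<in>carrier A. \<forall>j\<in>J. a \<otimes>\<^bsub>A\<^esub> j \<in> J \<and> j \<otimes>\<^bsub>A\<^esub> a \<in> J)"

definition gen_ideal :: "('f, 'm) ring_scheme \<Rightarrow> ('f, 'a) module \<Rightarrow> 'a set \<Rightarrow> 'a set" where
  "gen_ideal F A S = \<Inter>{J. alg_ideal F A J \<and> S \<subseteq> J}"

definition quot_alg :: "('f, 'a) module \<Rightarrow> 'a set \<Rightarrow> ('f, 'a set) module" where
  "quot_alg A J = \<lparr>carrier = a_rcosets\<^bsub>A\<^esub> J, mult = rcoset_mult A J, one = J +>\<^bsub>A\<^esub> \<one>\<^bsub>A\<^esub>,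
     zero = J, add = set_add A, smult = (\<lambda>r X. \<Union>a\<in>X. J +>\<^bsub>A\<^esub> (r \<odot>\<^bsub>A\<^esub> a))\<rparr>"


subsection \<open>Coproducts\<close>

text \<open>The coproduct of \<open>A\<close> and \<open>B\<close> is the free algebra on the disjoint union of
  their carriers modulo the relations making the two inclusions algebra homomorphisms.\<close>

definition hom_rels ::
  "('f, 'm) ring_scheme \<Rightarrow> ('f, 'a) module \<Rightarrow> ('f, 'b) module \<Rightarrow> ('a \<Rightarrow> 'b) \<Rightarrow> 'b set" where
  "hom_rels F A B h =
     {h (a \<oplus>\<^bsub>A\<^esub> b) \<ominus>\<^bsub>B\<^esub> (h a \<oplus>\<^bsub>B\<^esub> h b) | a b. a \<in> carrier A \<and> b \<in> carrier A} \<union>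
     {h (a \<otimes>\<^bsub>A\<^esub> b) \<ominus>\<^bsub>B\<^esub> (h a \<otimes>\<^bsub>B\<^esub> h b) | a b. a \<in> carrier A \<and> b \<in> carrier A} \<union>
     {h (r \<odot>\<^bsub>A\<^esub> a) \<ominus>\<^bsub>B\<^esub> (r \<odot>\<^bsub>B\<^esub> h a) | r a. r \<in> carrier F \<and> a \<in> carrier A} \<union>
     {h \<one>\<^bsub>A\<^esub> \<ominus>\<^bsub>B\<^esub> \<one>\<^bsub>B\<^esub>}"

type_synonym ('f, 'a, 'b) coprod = "(('a + 'b) monom \<Rightarrow> 'f) set"

abbreviation free_sum ::
  "('f, 'm) ring_scheme \<Rightarrow> ('f, 'a) module \<Rightarrow> ('f, 'b) module
    \<Rightarrow> ('f, ('a + 'b) monom \<Rightarrow> 'f) module" where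
  "free_sum F A B \<equiv> free_alg F (Sum_Type.Plus (carrier A) (carrier B))"

definition coprod_ideal ::
  "('f, 'm) ring_scheme \<Rightarrow> ('f, 'a) module \<Rightarrow> ('f, 'b) module \<Rightarrow> ('f, 'a, 'b) coprod" where
  "coprod_ideal F A B = gen_ideal F (free_sum F A B)
     (hom_rels F A (free_sum F A B) (\<lambda>a. free_gen F (Inl a)) \<union>
      hom_rels F B (free_sum F A B) (\<lambda>b. free_gen F (Inr b)))"

definition coprod ::
  "('f, 'm) ring_scheme \<Rightarrow> ('f, 'a) module \<Rightarrow> ('f, 'b) module
    \<Rightarrow> ('f, ('f, 'a, 'b) coprod) module" where
  "coprod F A B = quot_alg (free_sum F A B) (coprod_ideal F A B)"

definition inj1 ::
  "('f, 'm) ring_scheme \<Rightarrow> ('f, 'a) module \<Rightarrow> ('f, 'b) module \<Rightarrow> 'a \<Rightarrow> ('f, 'a, 'b) coprod" where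
  "inj1 F A B = (\<lambda>a\<in>carrier A. coprod_ideal F A B +>\<^bsub>free_sum F A B\<^esub> free_gen F (Inl a))"

definition inj2 ::
  "('f, 'm) ring_scheme \<Rightarrow> ('f, 'a) module \<Rightarrow> ('f, 'b) module \<Rightarrow> 'b \<Rightarrow> ('f, 'a, 'b) coprod" where
  "inj2 F A B = (\<lambda>b\<in>carrier B. coprod_ideal F A B +>\<^bsub>free_sum F A B\<^esub> free_gen F (Inr b))"

text \<open>The homomorphism $\langle f, g\rangle$ from the coproduct of \<open>A\<close> and \<open>B\<close> to
  \<open>C\<close>; for homomorphisms \<open>f\<close>, \<open>g\<close> the lift is constant on each coset.\<close>

definition copair ::
  "('f, 'm) ring_scheme \<Rightarrow> ('f, 'a) module \<Rightarrow> ('f, 'b) module \<Rightarrow> ('f, 'c) module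
    \<Rightarrow> ('a \<Rightarrow> 'c) \<Rightarrow> ('b \<Rightarrow> 'c) \<Rightarrow> ('f, 'a, 'b) coprod \<Rightarrow> 'c" where
  "copair F A B C f g = (\<lambda>X\<in>carrier (coprod F A B).
     the_elem (free_lift F (Sum_Type.Plus (carrier A) (carrier B)) C (case_sum f g) ` X))"

definition coprod_map ::
  "('f, 'm) ring_scheme \<Rightarrow> ('f, 'a) module \<Rightarrow> ('f, 'b) module \<Rightarrow> ('f, 'c) module \<Rightarrow> ('f, 'd) module
    \<Rightarrow> ('a \<Rightarrow> 'c) \<Rightarrow> ('b \<Rightarrow> 'd) \<Rightarrow> ('f, 'a, 'b) coprod \<Rightarrow> ('f, 'c, 'd) coprod" where
  "coprod_map F A B C D f g = copair F A B (coprod F C D)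
     (compose (carrier A) (inj1 F C D) f) (compose (carrier B) (inj2 F C D) g)"

definition fold_map ::
  "('f, 'm) ring_scheme \<Rightarrow> ('f, 'a) module \<Rightarrow> ('f, 'a, 'a) coprod \<Rightarrow> 'a" where
  "fold_map F A = copair F A A A (alg_id A) (alg_id A)"

text \<open>The canonical isomorphisms between the two bracketings of a triple coproduct.\<close>

definition assoc_right ::
  "('f, 'm) ring_scheme \<Rightarrow> ('f, 'a) module \<Rightarrow> ('f, 'b) module \<Rightarrow> ('f, 'c) module
    \<Rightarrow> ('f, ('f, 'a, 'b) coprod, 'c) coprod \<Rightarrow> ('f, 'a, ('f, 'b, 'c) coprod) coprod" where
  "assoc_right F A B C =
     (let BC = coprod F B C in
      copair F (coprod F A B) C (coprod F A BC)
        (copair F A B (coprod F A BC)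
           (inj1 F A BC) (compose (carrier B) (inj2 F A BC) (inj1 F B C)))
        (compose (carrier C) (inj2 F A BC) (inj2 F B C)))"

definition assoc_left ::
  "('f, 'm) ring_scheme \<Rightarrow> ('f, 'a) module \<Rightarrow> ('f, 'b) module \<Rightarrow> ('f, 'c) module
    \<Rightarrow> ('f, 'a, ('f, 'b, 'c) coprod) coprod \<Rightarrow> ('f, ('f, 'a, 'b) coprod, 'c) coprod" where
  "assoc_left F A B C =
     (let AB = coprod F A B in
      copair F A (coprod F B C) (coprod F AB C)
        (compose (carrier A) (inj1 F AB C) (inj1 F A B))
        (copair F B C (coprod F AB C)
           (compose (carrier B) (inj1 F AB C) (inj2 F A B)) (inj2 F AB C)))"


section \<open>Coloops\<close>

text \<open>The identities pass through a triple coproduct, e.g. \<open>\<delta>r \<amalg> id\<close> lands in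
  $(H\amalg H)\amalg H$ while \<open>id \<amalg> \<mu>\<close> starts at $H\amalg(H\amalg H)$; the
  reassociation that is usually left implicit is inserted here.\<close>

locale coloop = nonassoc_algebra F H
  for F :: "('f, 'm) ring_scheme" (structure) and H :: "('f, 'h) module" (structure) +
  fixes \<Delta> \<delta>r \<delta>l :: "'h \<Rightarrow> ('f, 'h, 'h) coprod" and \<epsilon> :: "'h \<Rightarrow> 'f"
  assumes \<Delta>_hom: "\<Delta> \<in> alg_hom F H (coprod F H H)"
    and \<delta>r_hom: "\<delta>r \<in> alg_hom F H (coprod F H H)"
    and \<delta>l_hom: "\<delta>l \<in> alg_hom F H (coprod F H H)"
    and \<epsilon>_hom: "\<epsilon> \<in> alg_hom F H (init_alg F)"
    and counit_l: "compose (carrier H)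
        (coprod_map F H H (init_alg F) H \<epsilon> (alg_id H)) \<Delta> = inj2 F (init_alg F) H"
    and counit_r: "compose (carrier H)
        (coprod_map F H H H (init_alg F) (alg_id H) \<epsilon>) \<Delta> = inj1 F H (init_alg F)"
    and rdiv_1: "compose (carrier H) (coprod_map F H (coprod F H H) H H (alg_id H) (fold_map F H))
        (compose (carrier H) (assoc_right F H H H)
          (compose (carrier H) (coprod_map F H H (coprod F H H) H \<delta>r (alg_id H)) \<Delta>)) = inj1 F H H"
    and rdiv_2: "compose (carrier H) (coprod_map F H (coprod F H H) H H (alg_id H) (fold_map F H))
        (compose (carrier H) (assoc_right F H H H)
          (compose (carrier H) (coprod_map F H H (coprod F H H) H \<Delta> (alg_id H)) \<delta>r)) = inj1 F H H"
    and ldiv_1: "compose (carrier H) (coprod_map F (coprod F H H) H H H (fold_map F H) (alg_id H))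
        (compose (carrier H) (assoc_left F H H H)
          (compose (carrier H) (coprod_map F H H H (coprod F H H) (alg_id H) \<delta>l) \<Delta>)) = inj2 F H H"
    and ldiv_2: "compose (carrier H) (coprod_map F (coprod F H H) H H H (fold_map F H) (alg_id H))
        (compose (carrier H) (assoc_left F H H H)
          (compose (carrier H) (coprod_map F H H H (coprod F H H) (alg_id H) \<Delta>) \<delta>l)) = inj2 F H H"

text \<open>The operation $\mu_A(\alpha\amalg\beta)\,\delta$ on \<open>Hom(H, A)\<close> induced by a co-operation
  \<open>\<delta>\<close>.\<close>

definition convolution ::
  "('f, 'm) ring_scheme \<Rightarrow> ('f, 'h) module \<Rightarrow> ('f, 'a) module \<Rightarrow> ('h \<Rightarrow> ('f, 'h, 'h) coprod)
    \<Rightarrow> ('h \<Rightarrow> 'a) \<Rightarrow> ('h \<Rightarrow> 'a) \<Rightarrow> 'h \<Rightarrow> 'a" where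
  "convolution F H A \<delta> \<alpha> \<beta> =
     compose (carrier H) (fold_map F A) (compose (carrier H) (coprod_map F H H A A \<alpha> \<beta>) \<delta>)"

definition hom_loop ::
  "('f, 'm) ring_scheme \<Rightarrow> ('f, 'h) module
    \<Rightarrow> ('h \<Rightarrow> ('f, 'h, 'h) coprod) \<Rightarrow> ('h \<Rightarrow> ('f, 'h, 'h) coprod) \<Rightarrow> ('h \<Rightarrow> ('f, 'h, 'h) coprod)
    \<Rightarrow> ('h \<Rightarrow> 'f) \<Rightarrow> ('f, 'a) module \<Rightarrow> ('h \<Rightarrow> 'a) loop" where
  "hom_loop F H \<Delta> \<delta>r \<delta>l \<epsilon> A = \<lparr>carrier = alg_hom F H A,
     mult = convolution F H A \<Delta>,
     one = compose (carrier H) (init_map F A) \<epsilon>,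
     ldiv = convolution F H A \<delta>l,
     rdiv = convolution F H A \<delta>r\<rparr>"


section \<open>Invertible series\<close>

text \<open>A series is the sequence of its coefficients.\<close>

definition series_mult :: "('f, 'a) module \<Rightarrow> (nat \<Rightarrow> 'a) \<Rightarrow> (nat \<Rightarrow> 'a) \<Rightarrow> nat \<Rightarrow> 'a" where
  "series_mult A a b n = (\<Oplus>\<^bsub>A\<^esub>m\<in>{0..n}. a m \<otimes>\<^bsub>A\<^esub> b (n - m))"

definition series_set :: "('f, 'a) module \<Rightarrow> (nat \<Rightarrow> 'a) set" where
  "series_set A = {a. a 0 = \<one>\<^bsub>A\<^esub> \<and> (\<forall>n. a n \<in> carrier A)}"

text \<open>The divisions are defined as the unique solutions of $a\cdot c=b$ and $c\cdot b=a$,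
  not by the explicit formulas.\<close>

definition Inv :: "('f, 'a) module \<Rightarrow> (nat \<Rightarrow> 'a) loop" where
  "Inv A = \<lparr>carrier = series_set A, mult = series_mult A,
     one = (\<lambda>n. if n = 0 then \<one>\<^bsub>A\<^esub> else \<zero>\<^bsub>A\<^esub>),
     ldiv = (\<lambda>a b. THE c. c \<in> series_set A \<and> series_mult A a c = b),
     rdiv = (\<lambda>a b. THE c. c \<in> series_set A \<and> series_mult A c b = a)\<rparr>"

definition Inv_map :: "('f, 'a) module \<Rightarrow> ('a \<Rightarrow> 'b) \<Rightarrow> (nat \<Rightarrow> 'a) \<Rightarrow> nat \<Rightarrow> 'b" where
  "Inv_map A f = (\<lambda>a\<in>carrier (Inv A). \<lambda>n. f (a n))"

definition compositions :: "nat \<Rightarrow> nat \<Rightarrow> nat list set" where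
  "compositions n l = {ns. length ns = l \<and> (\<forall>k\<in>set ns. 1 \<le> k) \<and> sum_list ns = n}"

text \<open>The right and left division expressions in two sequences \<open>a\<close>, \<open>b\<close>; \<open>foldl\<close>
  brackets to the left and \<open>foldr\<close> to the right.\<close>

definition rdiv_expr ::
  "('f, 'm) ring_scheme \<Rightarrow> ('f, 'a) module \<Rightarrow> (nat \<Rightarrow> 'a) \<Rightarrow> (nat \<Rightarrow> 'a) \<Rightarrow> nat \<Rightarrow> 'a" where
  "rdiv_expr F A a b n = (a n \<ominus>\<^bsub>A\<^esub> b n) \<oplus>\<^bsub>A\<^esub>
     (\<Oplus>\<^bsub>A\<^esub>l\<in>{1..n - 1}. ((\<ominus>\<^bsub>F\<^esub> \<one>\<^bsub>F\<^esub>) [^]\<^bsub>F\<^esub> l) \<odot>\<^bsub>A\<^esub>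
        (\<Oplus>\<^bsub>A\<^esub>ns\<in>compositions n (l + 1).
           foldl (\<lambda>u k. u \<otimes>\<^bsub>A\<^esub> b k) (a (hd ns) \<ominus>\<^bsub>A\<^esub> b (hd ns)) (tl ns)))"

definition ldiv_expr ::
  "('f, 'm) ring_scheme \<Rightarrow> ('f, 'a) module \<Rightarrow> (nat \<Rightarrow> 'a) \<Rightarrow> (nat \<Rightarrow> 'a) \<Rightarrow> nat \<Rightarrow> 'a" where
  "ldiv_expr F A a b n = (b n \<ominus>\<^bsub>A\<^esub> a n) \<oplus>\<^bsub>A\<^esub>
     (\<Oplus>\<^bsub>A\<^esub>l\<in>{1..n - 1}. ((\<ominus>\<^bsub>F\<^esub> \<one>\<^bsub>F\<^esub>) [^]\<^bsub>F\<^esub> l) \<odot>\<^bsub>A\<^esub>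
        (\<Oplus>\<^bsub>A\<^esub>ns\<in>compositions n (l + 1).
           foldr (\<lambda>k u. a k \<otimes>\<^bsub>A\<^esub> u) (butlast ns) (b (last ns) \<ominus>\<^bsub>A\<^esub> a (last ns))))"


section \<open>The coloop bialgebra of invertible series\<close>

definition series_alg :: "('f, 'm) ring_scheme \<Rightarrow> ('f, nat monom \<Rightarrow> 'f) module" where
  "series_alg F = free_alg F {n. 1 \<le> n}"

type_synonym 'f series_coprod = "('f, nat monom \<Rightarrow> 'f, nat monom \<Rightarrow> 'f) coprod"

abbreviation series_alg2 :: "('f, 'm) ring_scheme \<Rightarrow> ('f, 'f series_coprod) module" where
  "series_alg2 F \<equiv> coprod F (series_alg F) (series_alg F)"

text \<open>The generator $x_n$, with the convention $x_0=1$, and its images $x_n$, $y_n$ in the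
  two copies.\<close>

definition gen_x :: "('f, 'm) ring_scheme \<Rightarrow> nat \<Rightarrow> nat monom \<Rightarrow> 'f" where
  "gen_x F n = (if n = 0 then \<one>\<^bsub>series_alg F\<^esub> else free_gen F n)"

definition copy_x :: "('f, 'm) ring_scheme \<Rightarrow> nat \<Rightarrow> 'f series_coprod" where
  "copy_x F n = inj1 F (series_alg F) (series_alg F) (gen_x F n)"

definition copy_y :: "('f, 'm) ring_scheme \<Rightarrow> nat \<Rightarrow> 'f series_coprod" where
  "copy_y F n = inj2 F (series_alg F) (series_alg F) (gen_x F n)"

text \<open>The algebra homomorphism $x_n\mapsto a_n$.\<close>

definition series_hom ::
  "('f, 'm) ring_scheme \<Rightarrow> ('f, 'a) module \<Rightarrow> (nat \<Rightarrow> 'a) \<Rightarrow> (nat monom \<Rightarrow> 'f) \<Rightarrow> 'a" where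
  "series_hom F A a = free_lift F {n. 1 \<le> n} A a"

definition series_\<Delta> :: "('f, 'm) ring_scheme \<Rightarrow> (nat monom \<Rightarrow> 'f) \<Rightarrow> 'f series_coprod" where
  "series_\<Delta> F = series_hom F (series_alg2 F) (series_mult (series_alg2 F) (copy_x F) (copy_y F))"

definition series_\<delta>r :: "('f, 'm) ring_scheme \<Rightarrow> (nat monom \<Rightarrow> 'f) \<Rightarrow> 'f series_coprod" where
  "series_\<delta>r F = series_hom F (series_alg2 F) (rdiv_expr F (series_alg2 F) (copy_x F) (copy_y F))"

definition series_\<delta>l :: "('f, 'm) ring_scheme \<Rightarrow> (nat monom \<Rightarrow> 'f) \<Rightarrow> 'f series_coprod" where
  "series_\<delta>l F = series_hom F (series_alg2 F) (ldiv_expr F (series_alg2 F) (copy_x F) (copy_y F))"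

definition series_\<epsilon> :: "('f, 'm) ring_scheme \<Rightarrow> (nat monom \<Rightarrow> 'f) \<Rightarrow> 'f" where
  "series_\<epsilon> F = series_hom F (init_alg F) (\<lambda>n. \<zero>\<^bsub>F\<^esub>)"

abbreviation series_hom_loop ::
  "('f, 'm) ring_scheme \<Rightarrow> ('f, 'a) module \<Rightarrow> ((nat monom \<Rightarrow> 'f) \<Rightarrow> 'a) loop" where
  "series_hom_loop F A \<equiv>
     hom_loop F (series_alg F) (series_\<Delta> F) (series_\<delta>r F) (series_\<delta>l F) (series_\<epsilon> F) A"

end

theory Submission
  imports Defs
begin

text \<open>The coproduct is a quotient of a free algebra, so a homomorphism out of it is determined by,
  and can be prescribed through, its two restrictions; hence a homomorphism out of $H\amalg H$ is
  determined by the images of the $x_n$ and $y_n$, and one out of $H$ is the same as a series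
  $a$ with $a_0=1$. A homomorphism out of $H\amalg H$ carries $\Delta(x_n)$, $\delta_r(x_n)$,
  $\delta_l(x_n)$ to the coefficients of the product and of the division expressions of the two image
  series. Each coloop axiom, evaluated at $x_n$, thereby becomes a loop identity for the
  series $\sum x_n\lambda^n$, $\sum y_n\lambda^n$ over $H\amalg H$.

  For the loop identities, splitting off the last part of a composition shows that the right division
  expression $c_n$ satisfies $c_n=(a_n-b_n)-\sum_{0<m<n}c_mb_{n-m}$, which is the coefficient form of
  $c\cdot b=a$.\<close>

section \<open>Algebras and homomorphisms\<close>

text \<open>Because the leading coefficients are 1, the equation for the n-th coefficient of c
  \<cdot> b = a reads c_n plus terms in earlier coefficients, so it has exactly one solution, with
  nothing to invert and no use of associativity. Substituting the recursion into itself produces the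
  formula: each substitution multiplies on the right by one more coefficient of b and changes the
  sign. This is the origin of the compositions, of (-1)^l and of the rigid bracketing. Only half of
  the division laws is computed. The laws that start from a product, such as (a b)/b = a, follow by
  cancellation, and so do the two coloop axioms with \<Delta> applied inside a division; expanding
  them would mean rearranging sums of bracketed products. Uniqueness also identifies the divisions
  of \<open>Inv\<close>, which are definite descriptions. On the categorical side the obstacle is
  the explicit reassociation through a triple coproduct. It disappears once the outer maps of each
  division axiom are seen to form an endomorphism of H \<amalg> H that is known on both copies of
  H.\<close>

context nonassoc_algebra
begin

lemma algebra_axioms: "nonassoc_algebra F A" ..

text \<open>Absorption is not an axiom of the locale: the zero vector is the scalar zero times
  itself, and scalars move through products.\<close>

lemma zero_mult: "b \<in> carrier A \<Longrightarrow> \<zero>\<^bsub>A\<^esub> \<otimes>\<^bsub>A\<^esub> b = \<zero>\<^bsub>A\<^esub>"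
  using smult_mult_l[of \<zero> "\<zero>\<^bsub>A\<^esub>" b] mult_closed[of "\<zero>\<^bsub>A\<^esub>" b] by simp

lemma mult_zero: "b \<in> carrier A \<Longrightarrow> b \<otimes>\<^bsub>A\<^esub> \<zero>\<^bsub>A\<^esub> = \<zero>\<^bsub>A\<^esub>"
  using smult_mult_r[of \<zero> b "\<zero>\<^bsub>A\<^esub>"] mult_closed[of b "\<zero>\<^bsub>A\<^esub>"] by simp

lemma finsum_mult_l:
  "\<lbrakk>finite S; f \<in> S \<rightarrow> carrier A; b \<in> carrier A\<rbrakk>
    \<Longrightarrow> finsum A f S \<otimes>\<^bsub>A\<^esub> b = (\<Oplus>\<^bsub>A\<^esub>i\<in>S. f i \<otimes>\<^bsub>A\<^esub> b)"
proof (induct set: finite)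
  case empty then show ?case by (simp add: zero_mult)
next
  case (insert x S)
  then have "f x \<in> carrier A" "f \<in> S \<rightarrow> carrier A" by auto
  with insert show ?case
    by (simp add: mult_l_distr Pi_iff mult_closed)
qed

text \<open>Negation as a scalar multiple, so that linearity alone carries it through homomorphisms
  and into kernels.\<close>

lemma minus_eq_smult: "x \<in> carrier A \<Longrightarrow> \<ominus>\<^bsub>A\<^esub> x = (\<ominus> \<one>) \<odot>\<^bsub>A\<^esub> x"
  by (simp add: smult_l_minus)

lemma minus_self: "x \<in> carrier A \<Longrightarrow> x \<ominus>\<^bsub>A\<^esub> x = \<zero>\<^bsub>A\<^esub>"
  by (simp add: a_minus_def M.r_neg)

end

lemma nonassoc_algebraI:
  fixes F (structure) and A (structure)
  assumes "field F" "abelian_group A"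
    and "\<And>a x. \<lbrakk>a \<in> carrier F; x \<in> carrier A\<rbrakk> \<Longrightarrow> a \<odot>\<^bsub>A\<^esub> x \<in> carrier A"
    and "\<And>a b x. \<lbrakk>a \<in> carrier F; b \<in> carrier F; x \<in> carrier A\<rbrakk>
      \<Longrightarrow> (a \<oplus> b) \<odot>\<^bsub>A\<^esub> x = (a \<odot>\<^bsub>A\<^esub> x) \<oplus>\<^bsub>A\<^esub> (b \<odot>\<^bsub>A\<^esub> x)"
    and "\<And>a x y. \<lbrakk>a \<in> carrier F; x \<in> carrier A; y \<in> carrier A\<rbrakk>
      \<Longrightarrow> a \<odot>\<^bsub>A\<^esub> (x \<oplus>\<^bsub>A\<^esub> y) = (a \<odot>\<^bsub>A\<^esub> x) \<oplus>\<^bsub>A\<^esub> (a \<odot>\<^bsub>A\<^esub> y)"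
    and "\<And>a b x. \<lbrakk>a \<in> carrier F; b \<in> carrier F; x \<in> carrier A\<rbrakk>
      \<Longrightarrow> (a \<otimes> b) \<odot>\<^bsub>A\<^esub> x = a \<odot>\<^bsub>A\<^esub> (b \<odot>\<^bsub>A\<^esub> x)"
    and "\<And>x. x \<in> carrier A \<Longrightarrow> \<one> \<odot>\<^bsub>A\<^esub> x = x"
    and "\<And>a b. \<lbrakk>a \<in> carrier A; b \<in> carrier A\<rbrakk> \<Longrightarrow> a \<otimes>\<^bsub>A\<^esub> b \<in> carrier A"
    and "\<one>\<^bsub>A\<^esub> \<in> carrier A"
    and "\<And>a. a \<in> carrier A \<Longrightarrow> \<one>\<^bsub>A\<^esub> \<otimes>\<^bsub>A\<^esub> a = a"
    and "\<And>a. a \<in> carrier A \<Longrightarrow> a \<otimes>\<^bsub>A\<^esub> \<one>\<^bsub>A\<^esub> = a"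
    and "\<And>a b c. \<lbrakk>a \<in> carrier A; b \<in> carrier A; c \<in> carrier A\<rbrakk>
      \<Longrightarrow> (a \<oplus>\<^bsub>A\<^esub> b) \<otimes>\<^bsub>A\<^esub> c = a \<otimes>\<^bsub>A\<^esub> c \<oplus>\<^bsub>A\<^esub> b \<otimes>\<^bsub>A\<^esub> c"
    and "\<And>a b c. \<lbrakk>a \<in> carrier A; b \<in> carrier A; c \<in> carrier A\<rbrakk>
      \<Longrightarrow> a \<otimes>\<^bsub>A\<^esub> (b \<oplus>\<^bsub>A\<^esub> c) = a \<otimes>\<^bsub>A\<^esub> b \<oplus>\<^bsub>A\<^esub> a \<otimes>\<^bsub>A\<^esub> c"
    and "\<And>r a b. \<lbrakk>r \<in> carrier F; a \<in> carrier A; b \<in> carrier A\<rbrakk>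
      \<Longrightarrow> (r \<odot>\<^bsub>A\<^esub> a) \<otimes>\<^bsub>A\<^esub> b = r \<odot>\<^bsub>A\<^esub> (a \<otimes>\<^bsub>A\<^esub> b)"
    and "\<And>r a b. \<lbrakk>r \<in> carrier F; a \<in> carrier A; b \<in> carrier A\<rbrakk>
      \<Longrightarrow> a \<otimes>\<^bsub>A\<^esub> (r \<odot>\<^bsub>A\<^esub> b) = r \<odot>\<^bsub>A\<^esub> (a \<otimes>\<^bsub>A\<^esub> b)"
  shows "nonassoc_algebra F A"
proof -
  interpret field F by fact
  show ?thesis
    by (intro nonassoc_algebra.intro moduleI nonassoc_algebra_axioms.intro is_cring assms)
qed

lemma init_alg_algebra:
  assumes "field F"
  shows "nonassoc_algebra F (init_alg F)"
proof -
  interpret field F by fact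
  show ?thesis
    by (rule nonassoc_algebraI, fact, rule abelian_groupI)
      (use l_neg in \<open>auto simp: init_alg_def a_assoc m_assoc l_distr r_distr m_lcomm intro: a_comm\<close>)
qed

lemma alg_homI:
  assumes "\<And>x. x \<in> carrier A \<Longrightarrow> h x \<in> carrier B"
    and "\<And>x y. \<lbrakk>x \<in> carrier A; y \<in> carrier A\<rbrakk> \<Longrightarrow> h (x \<otimes>\<^bsub>A\<^esub> y) = h x \<otimes>\<^bsub>B\<^esub> h y"
    and "\<And>x y. \<lbrakk>x \<in> carrier A; y \<in> carrier A\<rbrakk> \<Longrightarrow> h (x \<oplus>\<^bsub>A\<^esub> y) = h x \<oplus>\<^bsub>B\<^esub> h y"
    and "h \<one>\<^bsub>A\<^esub> = \<one>\<^bsub>B\<^esub>"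
    and "\<And>r x. \<lbrakk>r \<in> carrier F; x \<in> carrier A\<rbrakk> \<Longrightarrow> h (r \<odot>\<^bsub>A\<^esub> x) = r \<odot>\<^bsub>B\<^esub> h x"
    and "h \<in> extensional (carrier A)"
  shows "h \<in> alg_hom F A B"
  using assms by (auto simp: alg_hom_def intro!: ring_hom_memI)

lemma alg_hom_closed: "\<lbrakk>h \<in> alg_hom F A B; x \<in> carrier A\<rbrakk> \<Longrightarrow> h x \<in> carrier B"
  and alg_hom_mult: "\<lbrakk>h \<in> alg_hom F A B; x \<in> carrier A; y \<in> carrier A\<rbrakk>
    \<Longrightarrow> h (x \<otimes>\<^bsub>A\<^esub> y) = h x \<otimes>\<^bsub>B\<^esub> h y"
  and alg_hom_add: "\<lbrakk>h \<in> alg_hom F A B; x \<in> carrier A; y \<in> carrier A\<rbrakk>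
    \<Longrightarrow> h (x \<oplus>\<^bsub>A\<^esub> y) = h x \<oplus>\<^bsub>B\<^esub> h y"
  and alg_hom_one: "h \<in> alg_hom F A B \<Longrightarrow> h \<one>\<^bsub>A\<^esub> = \<one>\<^bsub>B\<^esub>"
  and alg_hom_smult: "\<lbrakk>h \<in> alg_hom F A B; r \<in> carrier F; x \<in> carrier A\<rbrakk>
    \<Longrightarrow> h (r \<odot>\<^bsub>A\<^esub> x) = r \<odot>\<^bsub>B\<^esub> h x"
  and alg_hom_ext: "h \<in> alg_hom F A B \<Longrightarrow> h \<in> extensional (carrier A)"
  by (auto simp: alg_hom_def ring_hom_def)

lemma alg_id_apply [simp]: "a \<in> carrier A \<Longrightarrow> alg_id A a = a"
  by (simp add: alg_id_def)

lemma alg_id_hom: "nonassoc_algebra F A \<Longrightarrow> alg_id A \<in> alg_hom F A A"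
  unfolding alg_id_def
proof -
  assume "nonassoc_algebra F A"
  then interpret nonassoc_algebra F A .
  show "(\<lambda>a\<in>carrier A. a) \<in> alg_hom F A A"
    by (rule alg_homI) (auto simp: mult_closed one_closed)
qed

lemma alg_hom_compose:
  assumes "nonassoc_algebra F A" "f \<in> alg_hom F A B" "g \<in> alg_hom F B C"
  shows "compose (carrier A) g f \<in> alg_hom F A C"
proof -
  interpret nonassoc_algebra F A by fact
  note f = alg_hom_closed[OF assms(2)] alg_hom_mult[OF assms(2)] alg_hom_add[OF assms(2)]
    alg_hom_one[OF assms(2)] alg_hom_smult[OF assms(2)]
  note g = alg_hom_closed[OF assms(3)] alg_hom_mult[OF assms(3)] alg_hom_add[OF assms(3)]
    alg_hom_one[OF assms(3)] alg_hom_smult[OF assms(3)]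
  show ?thesis
    by (rule alg_homI) (simp_all add: compose_def mult_closed one_closed f g)
qed

locale alg_pair = A: nonassoc_algebra F A + B: nonassoc_algebra F B
  for F :: "('f, 'm) ring_scheme" (structure)
    and A :: "('f, 'a) module" (structure) and B :: "('f, 'b) module" (structure)
begin

lemma hom_zero: "h \<in> alg_hom F A B \<Longrightarrow> h \<zero>\<^bsub>A\<^esub> = \<zero>\<^bsub>B\<^esub>"
  using alg_hom_smult[of h F A B \<zero> "\<zero>\<^bsub>A\<^esub>"] alg_hom_closed[of h F A B "\<zero>\<^bsub>A\<^esub>"] by simp

lemma hom_minus:
  "\<lbrakk>h \<in> alg_hom F A B; x \<in> carrier A; y \<in> carrier A\<rbrakk> \<Longrightarrow> h (x \<ominus>\<^bsub>A\<^esub> y) = h x \<ominus>\<^bsub>B\<^esub> h y"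
  by (simp add: a_minus_def A.minus_eq_smult B.minus_eq_smult alg_hom_add alg_hom_smult alg_hom_closed)

lemma hom_finsum:
  "\<lbrakk>h \<in> alg_hom F A B; f \<in> S \<rightarrow> carrier A\<rbrakk> \<Longrightarrow> h (finsum A f S) = (\<Oplus>\<^bsub>B\<^esub>i\<in>S. h (f i))"
proof (induct S rule: infinite_finite_induct)
  \<comment> \<open>Over an infinite index set both sums are zero by convention, so the claim holds
    without a finiteness hypothesis.\<close>
  case (infinite S)
  then show ?case by (simp add: hom_zero A.finsum_infinite B.finsum_infinite)
next
  case empty
  then show ?case by (simp add: hom_zero)
next
  case (insert x S)
  then have "f x \<in> carrier A" "f \<in> S \<rightarrow> carrier A" by auto
  with insert show ?case
    by (simp add: alg_hom_add alg_hom_closed Pi_iff)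
qed

end

section \<open>Free algebras\<close>

lemma monom_mult_None [simp]: "monom_mult u None = u"
  by (cases u) auto

text \<open>The monomials form a free unital magma, so only (None, w), (w, None) and, for a product
  word, the pair of its two factors occur. Finiteness matters because \<open>finsum\<close> over an
  infinite set would be zero.\<close>

lemma finite_factorisations: "finite {(u, v). monom_mult u v = w}"
proof (cases w)
  case None
  have "{(u, v). monom_mult u v = w} \<subseteq> {(None, None)}"
    unfolding None by (auto elim: monom_mult.elims)
  then show ?thesis by (rule finite_subset) simp
next
  case (Some t)
  have "{(u, v). monom_mult u v = w} \<subseteq>
    {(None, w), (w, None)} \<union> (\<Union>s\<in>{s. \<exists>s'. t = Prod s s'}. \<Union>s'\<in>{s'. t = Prod s s'}. {(Some s, Some s')})"
    unfolding Some by (auto elim!: monom_mult.elims)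
  then show ?thesis by (rule finite_subset) (cases t; simp)
qed

lemma monoms_mult: "\<lbrakk>u \<in> monoms X; v \<in> monoms X\<rbrakk> \<Longrightarrow> monom_mult u v \<in> monoms X"
  by (auto simp: monoms_def)

lemma None_in_monoms [simp]: "None \<in> monoms X"
  by (simp add: monoms_def)

text \<open>A scalar multiple of one monomial, the scalar zero included. These span the free algebra
  additively, so additive statements need checking on them only.\<close>

definition single :: "('f, 'm) ring_scheme \<Rightarrow> 'x monom \<Rightarrow> 'f \<Rightarrow> 'x monom \<Rightarrow> 'f" where
  "single F w c = (\<lambda>v. if v = w then c else \<zero>\<^bsub>F\<^esub>)"

lemma free_gen_eq_single: "free_gen F x = single F (Some (Gen x)) \<one>\<^bsub>F\<^esub>"
  by (simp add: free_gen_def single_def)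

lemma free_one_eq_single: "\<one>\<^bsub>free_alg F X\<^esub> = single F None \<one>\<^bsub>F\<^esub>"
  by (simp add: free_alg_def single_def)

lemma free_alg_carrier:
  "p \<in> carrier (free_alg F X) \<longleftrightarrow>
    (\<forall>w. p w \<in> carrier F) \<and> finite {w. p w \<noteq> \<zero>\<^bsub>F\<^esub>} \<and> {w. p w \<noteq> \<zero>\<^bsub>F\<^esub>} \<subseteq> monoms X"
  by (auto simp: free_alg_def)

lemma free_alg_add: "(p \<oplus>\<^bsub>free_alg F X\<^esub> q) w = p w \<oplus>\<^bsub>F\<^esub> q w"
  and free_alg_smult: "(r \<odot>\<^bsub>free_alg F X\<^esub> p) w = r \<otimes>\<^bsub>F\<^esub> p w"
  and free_alg_zero: "\<zero>\<^bsub>free_alg F X\<^esub> w = \<zero>\<^bsub>F\<^esub>"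
  and free_alg_mult: "(p \<otimes>\<^bsub>free_alg F X\<^esub> q) w =
    finsum F (\<lambda>(u, v). p u \<otimes>\<^bsub>F\<^esub> q v) {(u, v). monom_mult u v = w}"
  by (simp_all add: free_alg_def)

section \<open>Arithmetic of the free algebra\<close>

context field
begin

lemma free_alg_abelian_group: "abelian_group (free_alg R X)"
proof (rule abelian_groupI, goal_cases)
  case (1 p q)
  have "{w. (p \<oplus>\<^bsub>free_alg R X\<^esub> q) w \<noteq> \<zero>} \<subseteq> {w. p w \<noteq> \<zero>} \<union> {w. q w \<noteq> \<zero>}"
    by (auto simp: free_alg_add)
  with 1 show ?case
    by (auto simp: free_alg_carrier free_alg_add intro: finite_subset)
next
  case 2
  then show ?case by (simp add: free_alg_carrier free_alg_zero)
next
  case (3 p q r)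
  then show ?case by (auto simp: fun_eq_iff free_alg_carrier free_alg_add a_assoc)
next
  case (4 p q)
  then show ?case by (auto simp: fun_eq_iff free_alg_carrier free_alg_add a_comm)
next
  case (5 p)
  then show ?case by (auto simp: fun_eq_iff free_alg_carrier free_alg_add free_alg_zero)
next
  case (6 p)
  have "(\<lambda>w. \<ominus> p w) \<oplus>\<^bsub>free_alg R X\<^esub> p = \<zero>\<^bsub>free_alg R X\<^esub>"
    using 6 by (auto simp: fun_eq_iff free_alg_carrier free_alg_add free_alg_zero l_neg)
  moreover have "{w. \<ominus> p w \<noteq> \<zero>} = {w. p w \<noteq> \<zero>}"
    using 6 by (auto simp: free_alg_carrier)
  then have "(\<lambda>w. \<ominus> p w) \<in> carrier (free_alg R X)"
    using 6 by (simp add: free_alg_carrier)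
  ultimately show ?case by blast
qed

lemma free_alg_mult_closed:
  assumes p: "p \<in> carrier (free_alg R X)" and q: "q \<in> carrier (free_alg R X)"
  shows "p \<otimes>\<^bsub>free_alg R X\<^esub> q \<in> carrier (free_alg R X)"
proof -
  \<comment> \<open>Products of a monomial in the support of p with one in the support of q. A
    coefficient outside this set is a sum of zeros, and the set gives both finiteness and
    containment in \<open>monoms X\<close>.\<close>
  let ?S = "(\<lambda>(u, v). monom_mult u v) ` ({w. p w \<noteq> \<zero>} \<times> {w. q w \<noteq> \<zero>})"
  have cl: "p u \<in> carrier R" "q u \<in> carrier R" for u
    using p q by (auto simp: free_alg_carrier)
  have "(p \<otimes>\<^bsub>free_alg R X\<^esub> q) w = \<zero>" if "w \<notin> ?S" for w
  proof -
    have "p u \<otimes> q v = \<zero>" if "monom_mult u v = w" for u v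
      using that \<open>w \<notin> ?S\<close> cl by (cases "p u = \<zero>"; cases "q v = \<zero>") auto
    then show ?thesis
      unfolding free_alg_mult by (intro add.finprod_one_eqI) auto
  qed
  then have "{w. (p \<otimes>\<^bsub>free_alg R X\<^esub> q) w \<noteq> \<zero>} \<subseteq> ?S" by blast
  moreover have "finite ?S" "?S \<subseteq> monoms X"
    using p q by (auto simp: free_alg_carrier intro!: monoms_mult)
  moreover have "(p \<otimes>\<^bsub>free_alg R X\<^esub> q) w \<in> carrier R" for w
    unfolding free_alg_mult by (rule finsum_closed) (auto simp: cl)
  ultimately show ?thesis
    unfolding free_alg_carrier by (meson finite_subset order_trans)
qed

lemma single_carrier [simp]:
  "\<lbrakk>w \<in> monoms X; c \<in> carrier R\<rbrakk> \<Longrightarrow> single R w c \<in> carrier (free_alg R X)"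
proof -
  assume "w \<in> monoms X" "c \<in> carrier R"
  moreover have "{v. single R w c v \<noteq> \<zero>} \<subseteq> {w}" by (auto simp: single_def)
  ultimately show ?thesis
    by (auto simp: free_alg_carrier single_def)
qed

lemma single_mult:
  fixes u v :: "'x monom"
  assumes "c \<in> carrier R" "d \<in> carrier R"
  shows "single R u c \<otimes>\<^bsub>free_alg R X\<^esub> single R v d = single R (monom_mult u v) (c \<otimes> d)"
proof
  fix w :: "'x monom"
  let ?W = "{(u, v). monom_mult u v = w}"
  let ?g = "\<lambda>x. if x = (u, v) then c \<otimes> d else \<zero>"
  \<comment> \<open>Among the factorisations of w only (u, v) can contribute, so the sum has at most
    one nonzero term.\<close>
  have "(single R u c \<otimes>\<^bsub>free_alg R X\<^esub> single R v d) w = finsum R ?g ?W"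
    unfolding free_alg_mult using assms
    by (intro finsum_cong') (auto simp: single_def split: if_splits)
  also have "\<dots> = single R (monom_mult u v) (c \<otimes> d) w"
  proof (cases "monom_mult u v = w")
    case True
    then show ?thesis
      using finsum_singleton[of "(u, v)" ?W "\<lambda>_. c \<otimes> d"] assms finite_factorisations[of w]
      by (simp add: single_def eq_commute)
  next
    case False
    then have "finsum R ?g ?W = \<zero>" by (intro add.finprod_one_eqI) auto
    with False show ?thesis by (simp add: single_def)
  qed
  finally show "(single R u c \<otimes>\<^bsub>free_alg R X\<^esub> single R v d) w = single R (monom_mult u v) (c \<otimes> d) w" .
qed

text \<open>Of all factorisations of w, only (None, w) has its left factor in the support of the
  unit.\<close>

lemma free_alg_one_mult:
  assumes p: "p \<in> carrier (free_alg R X)"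
  shows "\<one>\<^bsub>free_alg R X\<^esub> \<otimes>\<^bsub>free_alg R X\<^esub> p = p"
proof
  fix w
  have cl: "p u \<in> carrier R" for u using p by (auto simp: free_alg_carrier)
  have "(\<one>\<^bsub>free_alg R X\<^esub> \<otimes>\<^bsub>free_alg R X\<^esub> p) w =
      (\<Oplus>x\<in>{(u, v). monom_mult u v = w}. if (None, w) = x then p w else \<zero>)"
    unfolding free_alg_mult free_one_eq_single using cl
    by (intro finsum_cong') (auto simp: single_def split: if_splits)
  also have "\<dots> = p w"
    using finsum_singleton[of "(None, w)" "{(u, v). monom_mult u v = w}" "\<lambda>_. p w"] cl
      finite_factorisations[of w] by (simp add: eq_commute)
  finally show "(\<one>\<^bsub>free_alg R X\<^esub> \<otimes>\<^bsub>free_alg R X\<^esub> p) w = p w" .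
qed

lemma free_alg_mult_one:
  assumes p: "p \<in> carrier (free_alg R X)"
  shows "p \<otimes>\<^bsub>free_alg R X\<^esub> \<one>\<^bsub>free_alg R X\<^esub> = p"
proof
  fix w
  have cl: "p u \<in> carrier R" for u using p by (auto simp: free_alg_carrier)
  have "(p \<otimes>\<^bsub>free_alg R X\<^esub> \<one>\<^bsub>free_alg R X\<^esub>) w =
      (\<Oplus>x\<in>{(u, v). monom_mult u v = w}. if (w, None) = x then p w else \<zero>)"
    unfolding free_alg_mult free_one_eq_single using cl
    by (intro finsum_cong') (auto simp: single_def split: if_splits)
  also have "\<dots> = p w"
    using finsum_singleton[of "(w, None)" "{(u, v). monom_mult u v = w}" "\<lambda>_. p w"] cl
      finite_factorisations[of w] by (simp add: eq_commute)
  finally show "(p \<otimes>\<^bsub>free_alg R X\<^esub> \<one>\<^bsub>free_alg R X\<^esub>) w = p w" .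
qed

lemma free_alg_smult_closed:
  assumes "r \<in> carrier R" "p \<in> carrier (free_alg R X)"
  shows "r \<odot>\<^bsub>free_alg R X\<^esub> p \<in> carrier (free_alg R X)"
proof -
  have "{w. (r \<odot>\<^bsub>free_alg R X\<^esub> p) w \<noteq> \<zero>} \<subseteq> {w. p w \<noteq> \<zero>}"
    using assms by (auto simp: free_alg_smult)
  with assms show ?thesis
    by (auto simp: free_alg_carrier free_alg_smult intro: finite_subset)
qed

lemma free_alg_algebra: "nonassoc_algebra R (free_alg R X)"
proof (rule nonassoc_algebraI, goal_cases)
  case 1 show ?case by (rule field_axioms)
next
  case 2 show ?case by (rule free_alg_abelian_group)
next
  case (3 a x) then show ?case by (rule free_alg_smult_closed)
next
  case (4 a b x) then show ?case
    by (auto simp: fun_eq_iff free_alg_carrier free_alg_add free_alg_smult l_distr)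
next
  case (5 a x y) then show ?case
    by (auto simp: fun_eq_iff free_alg_carrier free_alg_add free_alg_smult r_distr)
next
  case (6 a b x) then show ?case
    by (auto simp: fun_eq_iff free_alg_carrier free_alg_smult m_assoc)
next
  case (7 x) then show ?case
    by (auto simp: fun_eq_iff free_alg_carrier free_alg_smult)
next
  case (8 a b) then show ?case by (rule free_alg_mult_closed)
next
  case 9 show ?case by (simp add: free_one_eq_single)
next
  case (10 a) then show ?case by (rule free_alg_one_mult)
next
  case (11 a) then show ?case by (rule free_alg_mult_one)
next
  case (12 a b c)
  then have cl: "a u \<in> carrier R" "b u \<in> carrier R" "c u \<in> carrier R" for u
    by (auto simp: free_alg_carrier)
  show ?case
    unfolding fun_eq_iff free_alg_mult free_alg_add split_def
    by (intro allI, subst finsum_addf[symmetric])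
      (auto intro!: finsum_cong' simp: cl l_distr)
next
  case (13 a b c)
  then have cl: "a u \<in> carrier R" "b u \<in> carrier R" "c u \<in> carrier R" for u
    by (auto simp: free_alg_carrier)
  show ?case
    unfolding fun_eq_iff free_alg_mult free_alg_add split_def
    by (intro allI, subst finsum_addf[symmetric])
      (auto intro!: finsum_cong' simp: cl r_distr)
next
  case (14 r a b)
  then have cl: "a u \<in> carrier R" "b u \<in> carrier R" for u
    by (auto simp: free_alg_carrier)
  \<comment> \<open>A scalar can be taken out of the coefficient sum because a monomial has finitely
    many factorisations.\<close>
  show ?case
    unfolding fun_eq_iff free_alg_mult free_alg_smult using 14(1)
    by (intro allI, subst finsum_rdistr)
      (auto intro!: finsum_cong' simp: cl m_assoc finite_factorisations
        finite_factorisations[unfolded split_def])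
next
  case (15 r a b)
  then have cl: "a u \<in> carrier R" "b u \<in> carrier R" for u
    by (auto simp: free_alg_carrier)
  show ?case
    unfolding fun_eq_iff free_alg_mult free_alg_smult using 15(1)
    by (intro allI, subst finsum_rdistr)
      (auto intro!: finsum_cong' simp: cl m_lcomm finite_factorisations
        finite_factorisations[unfolded split_def])
qed

lemma free_alg_induct [consumes 1, case_names zero add single]:
  assumes p: "p \<in> carrier (free_alg R X)"
    and zero: "P \<zero>\<^bsub>free_alg R X\<^esub>"
    and add: "\<And>p q. \<lbrakk>p \<in> carrier (free_alg R X); q \<in> carrier (free_alg R X); P p; P q\<rbrakk>
      \<Longrightarrow> P (p \<oplus>\<^bsub>free_alg R X\<^esub> q)"
    and single: "\<And>w c. \<lbrakk>w \<in> monoms X; c \<in> carrier R\<rbrakk> \<Longrightarrow> P (single R w c)"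
  shows "P p"
proof -
  have "finite {w. p w \<noteq> \<zero>}" using p by (simp add: free_alg_carrier)
  \<comment> \<open>The induction runs over a finite set containing the support, with p arbitrary,
    since the remainder after removing one monomial is a different element.\<close>
  then obtain S where "finite S" "{w. p w \<noteq> \<zero>} \<subseteq> S" "S \<subseteq> monoms X"
    using p by (auto simp: free_alg_carrier)
  then show ?thesis using p
  proof (induct S arbitrary: p rule: finite_induct)
    case empty
    then have "p = \<zero>\<^bsub>free_alg R X\<^esub>" by (auto simp: fun_eq_iff free_alg_zero)
    with zero show ?case by simp
  next
    case (insert w S)
    define q where "q = p(w := \<zero>)"
    have sub: "{v. q v \<noteq> \<zero>} \<subseteq> S" "{v. q v \<noteq> \<zero>} \<subseteq> {v. p v \<noteq> \<zero>}"
      using insert by (auto simp: q_def)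
    then have q: "q \<in> carrier (free_alg R X)"
      using insert.prems finite_subset[OF sub(2)] by (auto simp: free_alg_carrier q_def)
    moreover have pw: "p w \<in> carrier R" "w \<in> monoms X"
      using insert.prems by (auto simp: free_alg_carrier)
    moreover have "p = q \<oplus>\<^bsub>free_alg R X\<^esub> single R w (p w)"
      using insert.prems by (auto simp: fun_eq_iff free_alg_add q_def single_def free_alg_carrier)
    ultimately show ?case
      using add[OF q single_carrier[OF pw(2,1)] insert.hyps(3)[OF sub(1) _ q] single[OF pw(2,1)]] insert.prems(2)
      by simp
  qed
qed

end

lemma free_gen_closed [simp]: "\<lbrakk>field F; x \<in> X\<rbrakk> \<Longrightarrow> free_gen F x \<in> carrier (free_alg F X)"
  by (simp add: free_gen_eq_single field.single_carrier monoms_def field.is_ring cring.axioms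
      ring.ring_simprules(6) field.axioms domain.axioms)

section \<open>The universal property of the free algebra\<close>

context nonassoc_algebra
begin

lemma eval_word_closed: "\<lbrakk>f \<in> X \<rightarrow> carrier A; set_word t \<subseteq> X\<rbrakk> \<Longrightarrow> eval_word A f t \<in> carrier A"
  by (induct t) (auto simp: mult_closed)

lemma eval_monom_closed: "\<lbrakk>f \<in> X \<rightarrow> carrier A; w \<in> monoms X\<rbrakk> \<Longrightarrow> eval_monom A f w \<in> carrier A"
  using eval_word_closed by (auto simp: eval_monom_def monoms_def one_closed)

lemma eval_monom_mult:
  assumes "f \<in> X \<rightarrow> carrier A" "u \<in> monoms X" "v \<in> monoms X"
  shows "eval_monom A f (monom_mult u v) = eval_monom A f u \<otimes>\<^bsub>A\<^esub> eval_monom A f v"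
  using eval_monom_closed[OF assms(1,2)] eval_monom_closed[OF assms(1,3)]
  by (cases u; cases v) (auto simp: eval_monom_def mult_l_one mult_r_one)

text \<open>Supports change under addition and scaling. Allowing any finite set of monomials above
  the support lets the lifts of different elements be compared over one index set.\<close>

lemma free_lift_eq_finsum:
  assumes "f \<in> X \<rightarrow> carrier A" "p \<in> carrier (free_alg F X)"
    and "finite S" "{w. p w \<noteq> \<zero>} \<subseteq> S" "S \<subseteq> monoms X"
  shows "free_lift F X A f p = (\<Oplus>\<^bsub>A\<^esub>w\<in>S. p w \<odot>\<^bsub>A\<^esub> eval_monom A f w)"
proof -
  have "finsum A (\<lambda>w. p w \<odot>\<^bsub>A\<^esub> eval_monom A f w) {w. p w \<noteq> \<zero>} =
      finsum A (\<lambda>w. p w \<odot>\<^bsub>A\<^esub> eval_monom A f w) S"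
  proof (rule M.add.finprod_mono_neutral_cong_left)
    show "(\<lambda>w. p w \<odot>\<^bsub>A\<^esub> eval_monom A f w) \<in> S \<rightarrow> carrier A"
      using assms eval_monom_closed[OF assms(1)] by (auto simp: free_alg_carrier subset_iff)
    show "p w \<odot>\<^bsub>A\<^esub> eval_monom A f w = \<zero>\<^bsub>A\<^esub>" if "w \<in> S - {w. p w \<noteq> \<zero>}" for w
      using that assms(5) eval_monom_closed[OF assms(1)] by (auto simp: subset_iff)
  qed (use assms in auto)
  with assms(2) show ?thesis by (simp add: free_lift_def)
qed

lemma free_lift_closed:
  assumes "f \<in> X \<rightarrow> carrier A" "p \<in> carrier (free_alg F X)"
  shows "free_lift F X A f p \<in> carrier A"
  using assms by (auto simp: free_lift_def free_alg_carrier eval_monom_closed intro!: M.finsum_closed)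

lemma free_lift_add:
  assumes f: "f \<in> X \<rightarrow> carrier A"
    and p: "p \<in> carrier (free_alg F X)" and q: "q \<in> carrier (free_alg F X)"
  shows "free_lift F X A f (p \<oplus>\<^bsub>free_alg F X\<^esub> q) = free_lift F X A f p \<oplus>\<^bsub>A\<^esub> free_lift F X A f q"
proof -
  interpret free: nonassoc_algebra F "free_alg F X" by (rule free_alg_algebra)
  let ?S = "{w. p w \<noteq> \<zero>} \<union> {w. q w \<noteq> \<zero>}"
  have S: "finite ?S" "?S \<subseteq> monoms X"
    using p q by (auto simp: free_alg_carrier)
  have cl: "p w \<in> carrier F" "q w \<in> carrier F" for w
    using p q by (auto simp: free_alg_carrier)
  have ev: "eval_monom A f w \<in> carrier A" if "w \<in> ?S" for w
    using that S eval_monom_closed[OF f] by blast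
  have "free_lift F X A f (p \<oplus>\<^bsub>free_alg F X\<^esub> q) =
      (\<Oplus>\<^bsub>A\<^esub>w\<in>?S. (p \<oplus>\<^bsub>free_alg F X\<^esub> q) w \<odot>\<^bsub>A\<^esub> eval_monom A f w)"
    by (rule free_lift_eq_finsum[OF f free.a_closed[OF p q] S(1) _ S(2)]) (auto simp: free_alg_add)
  also have "\<dots> = (\<Oplus>\<^bsub>A\<^esub>w\<in>?S. p w \<odot>\<^bsub>A\<^esub> eval_monom A f w \<oplus>\<^bsub>A\<^esub> q w \<odot>\<^bsub>A\<^esub> eval_monom A f w)"
    using ev cl by (intro M.finsum_cong') (auto simp: free_alg_add smult_l_distr)
  also have "\<dots> = (\<Oplus>\<^bsub>A\<^esub>w\<in>?S. p w \<odot>\<^bsub>A\<^esub> eval_monom A f w) \<oplus>\<^bsub>A\<^esub> (\<Oplus>\<^bsub>A\<^esub>w\<in>?S. q w \<odot>\<^bsub>A\<^esub> eval_monom A f w)"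
    using ev cl by (intro M.finsum_addf) auto
  also have "\<dots> = free_lift F X A f p \<oplus>\<^bsub>A\<^esub> free_lift F X A f q"
    using free_lift_eq_finsum[OF f p S(1) _ S(2)] free_lift_eq_finsum[OF f q S(1) _ S(2)] by auto
  finally show ?thesis .
qed

lemma free_lift_single:
  assumes "f \<in> X \<rightarrow> carrier A" "w \<in> monoms X" "c \<in> carrier F"
  shows "free_lift F X A f (single F w c) = c \<odot>\<^bsub>A\<^esub> eval_monom A f w"
proof -
  have "free_lift F X A f (single F w c) = (\<Oplus>\<^bsub>A\<^esub>v\<in>{w}. single F w c v \<odot>\<^bsub>A\<^esub> eval_monom A f v)"
    by (rule free_lift_eq_finsum) (use assms in \<open>auto simp: single_def[abs_def] single_carrier[unfolded single_def]\<close>)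
  then show ?thesis
    using assms by (simp add: eval_monom_closed single_def)
qed

lemma free_lift_smult:
  assumes f: "f \<in> X \<rightarrow> carrier A" and r: "r \<in> carrier F" and p: "p \<in> carrier (free_alg F X)"
  shows "free_lift F X A f (r \<odot>\<^bsub>free_alg F X\<^esub> p) = r \<odot>\<^bsub>A\<^esub> free_lift F X A f p"
proof -
  have S: "finite {w. p w \<noteq> \<zero>}" "{w. p w \<noteq> \<zero>} \<subseteq> monoms X" and cl: "\<And>w. p w \<in> carrier F"
    using p by (auto simp: free_alg_carrier)
  have ev: "eval_monom A f w \<in> carrier A" if "p w \<noteq> \<zero>" for w
    using that S eval_monom_closed[OF f] by blast
  have "free_lift F X A f (r \<odot>\<^bsub>free_alg F X\<^esub> p) =
      (\<Oplus>\<^bsub>A\<^esub>w\<in>{w. p w \<noteq> \<zero>}. (r \<odot>\<^bsub>free_alg F X\<^esub> p) w \<odot>\<^bsub>A\<^esub> eval_monom A f w)"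
    using r by (intro free_lift_eq_finsum[OF f free_alg_smult_closed[OF r p] S(1) _ S(2)])
      (auto simp: free_alg_smult)
  also have "\<dots> = (\<Oplus>\<^bsub>A\<^esub>w\<in>{w. p w \<noteq> \<zero>}. r \<odot>\<^bsub>A\<^esub> (p w \<odot>\<^bsub>A\<^esub> eval_monom A f w))"
    using ev cl r by (intro M.finsum_cong') (auto simp: free_alg_smult smult_assoc1)
  also have "\<dots> = r \<odot>\<^bsub>A\<^esub> (\<Oplus>\<^bsub>A\<^esub>w\<in>{w. p w \<noteq> \<zero>}. p w \<odot>\<^bsub>A\<^esub> eval_monom A f w)"
    using ev cl r S by (intro finsum_smult_ldistr[symmetric]) auto
  finally show ?thesis using p by (simp add: free_lift_def)
qed

text \<open>Both sides are additive in each argument, so it suffices to compare them on scalar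
  multiples of monomials.\<close>

lemma free_lift_mult:
  assumes f: "f \<in> X \<rightarrow> carrier A"
    and p: "p \<in> carrier (free_alg F X)" and q: "q \<in> carrier (free_alg F X)"
  shows "free_lift F X A f (p \<otimes>\<^bsub>free_alg F X\<^esub> q) = free_lift F X A f p \<otimes>\<^bsub>A\<^esub> free_lift F X A f q"
proof -
  interpret free: nonassoc_algebra F "free_alg F X" by (rule free_alg_algebra)
  have zero: "free_lift F X A f \<zero>\<^bsub>free_alg F X\<^esub> = \<zero>\<^bsub>A\<^esub>"
    by (simp add: free_lift_def free_alg_zero)
  note lift = free_lift_closed[OF f] free_lift_add[OF f]
  have single_single: "free_lift F X A f (single F u c \<otimes>\<^bsub>free_alg F X\<^esub> single F v d) =
      free_lift F X A f (single F u c) \<otimes>\<^bsub>A\<^esub> free_lift F X A f (single F v d)"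
    if "u \<in> monoms X" "v \<in> monoms X" "c \<in> carrier F" "d \<in> carrier F" for u v c d
    using that eval_monom_closed[OF f]
    by (simp add: single_mult free_lift_single[OF f] monoms_mult eval_monom_mult[OF f]
        smult_mult_l smult_mult_r smult_assoc1[symmetric] mult_closed m_comm)
  have single_any: "free_lift F X A f (single F u c \<otimes>\<^bsub>free_alg F X\<^esub> q) =
      free_lift F X A f (single F u c) \<otimes>\<^bsub>A\<^esub> free_lift F X A f q"
    if "u \<in> monoms X" "c \<in> carrier F" for u c
    using q
  proof (induct q rule: free_alg_induct)
    case zero
    with that show ?case
      by (simp add: \<open>free_lift F X A f \<zero>\<^bsub>free_alg F X\<^esub> = \<zero>\<^bsub>A\<^esub>\<close> free.mult_zero mult_zero lift)
  next
    case (add p q)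
    with that show ?case
      by (simp add: free.mult_r_distr free.mult_closed lift mult_r_distr)
  next
    case (single w c)
    with that single_single show ?case by simp
  qed
  show ?thesis using p
  proof (induct p rule: free_alg_induct)
    case zero
    with q show ?case
      by (simp add: \<open>free_lift F X A f \<zero>\<^bsub>free_alg F X\<^esub> = \<zero>\<^bsub>A\<^esub>\<close> free.zero_mult zero_mult lift)
  next
    case (add p p')
    with q show ?case
      by (simp add: free.mult_l_distr free.mult_closed lift mult_l_distr)
  next
    case (single w c)
    with single_any show ?case by simp
  qed
qed

lemma free_lift_hom:
  assumes f: "f \<in> X \<rightarrow> carrier A"
  shows "free_lift F X A f \<in> alg_hom F (free_alg F X) A"
proof (rule alg_homI)
  show "free_lift F X A f \<one>\<^bsub>free_alg F X\<^esub> = \<one>\<^bsub>A\<^esub>"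
    by (simp add: free_one_eq_single free_lift_single[OF f]) (simp add: eval_monom_def one_closed)
  show "free_lift F X A f \<in> extensional (carrier (free_alg F X))"
    by (simp add: free_lift_def)
qed (simp_all add: assms free_lift_closed free_lift_add free_lift_mult free_lift_smult)

lemma free_lift_gen:
  assumes "f \<in> X \<rightarrow> carrier A" "x \<in> X"
  shows "free_lift F X A f (free_gen F x) = f x"
proof -
  have "f x \<in> carrier A" "Some (Gen x) \<in> monoms X" using assms by (auto simp: monoms_def)
  with assms(1) show ?thesis
    by (simp add: free_gen_eq_single free_lift_single) (simp add: eval_monom_def)
qed

text \<open>Agreement spreads from the generators to all bracketed words by multiplicativity, to the
  empty monomial by preservation of the unit, and from there to every element by linearity.\<close>

lemma free_alg_hom_eqI:
  assumes h: "h \<in> alg_hom F (free_alg F X) A" and k: "k \<in> alg_hom F (free_alg F X) A"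
    and eq: "\<And>x. x \<in> X \<Longrightarrow> h (free_gen F x) = k (free_gen F x)"
  shows "h = k"
proof (rule extensionalityI[OF alg_hom_ext[OF h] alg_hom_ext[OF k]])
  interpret free: nonassoc_algebra F "free_alg F X" by (rule free_alg_algebra)
  interpret alg_pair F "free_alg F X" A by unfold_locales
  have word: "h (single F (Some t) \<one>) = k (single F (Some t) \<one>)" if "set_word t \<subseteq> X" for t
    using that
  proof (induct t)
    case (Gen x)
    then show ?case using eq by (simp add: free_gen_eq_single)
  next
    case (Prod s t)
    then have "Some s \<in> monoms X" "Some t \<in> monoms X" by (auto simp: monoms_def)
    moreover have "single F (Some (Prod s t)) \<one> =
        single F (Some s) \<one> \<otimes>\<^bsub>free_alg F X\<^esub> single F (Some t) \<one>"
      by (simp add: single_mult)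
    ultimately show ?case
      using Prod by (simp add: alg_hom_mult[OF h] alg_hom_mult[OF k])
  qed
  fix p assume "p \<in> carrier (free_alg F X)"
  then show "h p = k p"
  proof (induct p rule: free_alg_induct)
    case zero
    then show ?case by (simp add: hom_zero h k)
  next
    case (add p q)
    then show ?case by (simp add: alg_hom_add[OF h] alg_hom_add[OF k])
  next
    case (single w c)
    then have "single F w c = c \<odot>\<^bsub>free_alg F X\<^esub> single F w \<one>"
      by (auto simp: fun_eq_iff single_def free_alg_smult)
    moreover have "h (single F w \<one>) = k (single F w \<one>)"
      using single(1) word alg_hom_one[OF h] alg_hom_one[OF k]
      by (auto simp: monoms_def free_one_eq_single)
    ultimately show ?case
      using single by (simp add: alg_hom_smult[OF h] alg_hom_smult[OF k])
  qed
qed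

end

section \<open>Quotients and coproducts\<close>

lemma alg_idealD:
  assumes "alg_ideal F A J"
  shows alg_ideal_submodule: "submodule J F A"
    and alg_ideal_mult_l: "\<And>a j. \<lbrakk>a \<in> carrier A; j \<in> J\<rbrakk> \<Longrightarrow> a \<otimes>\<^bsub>A\<^esub> j \<in> J"
    and alg_ideal_mult_r: "\<And>a j. \<lbrakk>a \<in> carrier A; j \<in> J\<rbrakk> \<Longrightarrow> j \<otimes>\<^bsub>A\<^esub> a \<in> J"
  using assms by (auto simp: alg_ideal_def)

context nonassoc_algebra
begin

lemma gen_ideal_least: "\<lbrakk>alg_ideal F A J; S \<subseteq> J\<rbrakk> \<Longrightarrow> gen_ideal F A S \<subseteq> J"
  by (auto simp: gen_ideal_def)

lemma gen_ideal_superset: "S \<subseteq> gen_ideal F A S"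
  by (auto simp: gen_ideal_def)

lemma alg_ideal_carrier: "alg_ideal F A (carrier A)"
  by (simp add: alg_ideal_def carrier_is_submodule mult_closed)

lemma alg_ideal_gen_ideal:
  assumes "S \<subseteq> carrier A"
  shows "alg_ideal F A (gen_ideal F A S)"
proof -
  define I where "I = {J. alg_ideal F A J \<and> S \<subseteq> J}"
  \<comment> \<open>The family of ideals above S is inhabited by the whole algebra, which keeps the
    intersection inside the carrier; an empty family would give the universal set.\<close>
  have carrier: "carrier A \<in> I" using alg_ideal_carrier assms by (simp add: I_def)
  have sub: "J \<subseteq> carrier A" "\<zero>\<^bsub>A\<^esub> \<in> J" "\<And>a. a \<in> J \<Longrightarrow> \<ominus>\<^bsub>A\<^esub> a \<in> J"
    "\<And>a b. \<lbrakk>a \<in> J; b \<in> J\<rbrakk> \<Longrightarrow> a \<oplus>\<^bsub>A\<^esub> b \<in> J"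
    "\<And>a x. \<lbrakk>a \<in> carrier F; x \<in> J\<rbrakk> \<Longrightarrow> a \<odot>\<^bsub>A\<^esub> x \<in> J" if "J \<in> I" for J
    using that submoduleE[of J] subgroup.one_closed[of J "add_monoid A"]
    by (auto simp: I_def alg_ideal_def submodule_def)
  have "submodule (\<Inter>I) F A"
  proof (rule submoduleI)
    show "\<Inter>I \<subseteq> carrier A" using carrier by (rule Inter_lower)
  qed (auto simp: sub)
  then show ?thesis
    by (auto simp: alg_ideal_def gen_ideal_def I_def)
qed

end

locale alg_with_ideal = nonassoc_algebra F A
  for F :: "('f, 'm) ring_scheme" (structure) and A :: "('f, 'a) module" (structure) +
  fixes J :: "'a set"
  assumes ideal: "alg_ideal F A J"
begin

lemma abelian_subgroup: "abelian_subgroup J A"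
  using alg_ideal_submodule[OF ideal] abelian_group_axioms
  by (intro abelian_subgroupI3 additive_subgroup.intro) (auto simp: submodule_def)

sublocale J: abelian_subgroup J A by (rule abelian_subgroup)

abbreviation coset :: "'a \<Rightarrow> 'a set" where
  "coset a \<equiv> J +>\<^bsub>A\<^esub> a"

text \<open>The form in which the defining relations of a coproduct are used: each relation is a
  difference lying in the ideal.\<close>

lemma coset_eqI:
  assumes "x \<in> carrier A" "y \<in> carrier A" "x \<ominus>\<^bsub>A\<^esub> y \<in> J"
  shows "coset x = coset y"
proof -
  have "x \<in> coset y" using assms J.a_rcos_module[of y x] by (simp add: a_minus_def)
  then show ?thesis using J.a_repr_independence' assms by metis
qed

lemma coset_memE:
  assumes "x \<in> coset a"
  obtains j where "j \<in> J" "x = j \<oplus>\<^bsub>A\<^esub> a"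
  using assms by (auto simp: a_r_coset_def')

lemma coset_addl: "\<lbrakk>j \<in> J; a \<in> carrier A\<rbrakk> \<Longrightarrow> coset (j \<oplus>\<^bsub>A\<^esub> a) = coset a"
  by (rule coset_eqI) (auto simp: a_minus_def M.a_assoc M.r_neg J.a_Hcarr)

lemma coset_self: "a \<in> carrier A \<Longrightarrow> a \<in> coset a"
  by (rule J.a_rcos_self)

lemma quot_carrier: "carrier (quot_alg A J) = coset ` carrier A"
  by (auto simp: quot_alg_def A_RCOSETS_def')

lemma quot_one: "\<one>\<^bsub>quot_alg A J\<^esub> = coset \<one>\<^bsub>A\<^esub>"
  by (simp add: quot_alg_def)

lemma quot_zero: "\<zero>\<^bsub>quot_alg A J\<^esub> = coset \<zero>\<^bsub>A\<^esub>"
  using M.a_coset_add_zero[of J] J.a_subset by (simp add: quot_alg_def)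

lemma quot_add:
  "\<lbrakk>a \<in> carrier A; b \<in> carrier A\<rbrakk> \<Longrightarrow> coset a \<oplus>\<^bsub>quot_alg A J\<^esub> coset b = coset (a \<oplus>\<^bsub>A\<^esub> b)"
  by (simp add: quot_alg_def J.a_rcos_sum)

text \<open>\<open>rcoset_mult\<close> is a union of cosets over all pairs of representatives. For x
  = j + a and y = k + b one has x y = j y + (a k + a b), where j y and a k lie in the two-sided
  ideal, so all these cosets coincide.\<close>

lemma quot_mult:
  assumes a: "a \<in> carrier A" and b: "b \<in> carrier A"
  shows "coset a \<otimes>\<^bsub>quot_alg A J\<^esub> coset b = coset (a \<otimes>\<^bsub>A\<^esub> b)"
proof -
  have "coset (x \<otimes>\<^bsub>A\<^esub> y) = coset (a \<otimes>\<^bsub>A\<^esub> b)" if x: "x \<in> coset a" and y: "y \<in> coset b" for x y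
  proof -
    obtain j where j: "j \<in> J" "x = j \<oplus>\<^bsub>A\<^esub> a" using x by (rule coset_memE)
    obtain k where k: "k \<in> J" "y = k \<oplus>\<^bsub>A\<^esub> b" using y by (rule coset_memE)
    have y': "y \<in> carrier A" using k b by (simp add: J.a_Hcarr)
    have "x \<otimes>\<^bsub>A\<^esub> y = j \<otimes>\<^bsub>A\<^esub> y \<oplus>\<^bsub>A\<^esub> (a \<otimes>\<^bsub>A\<^esub> k \<oplus>\<^bsub>A\<^esub> a \<otimes>\<^bsub>A\<^esub> b)"
      using mult_l_distr[of j a y] mult_r_distr[of a k b] j k a b y' by (simp add: J.a_Hcarr)
    moreover have "j \<otimes>\<^bsub>A\<^esub> y \<in> J" "a \<otimes>\<^bsub>A\<^esub> k \<in> J"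
      using alg_ideal_mult_l[OF ideal] alg_ideal_mult_r[OF ideal] j k a y' by auto
    ultimately show ?thesis
      using a b by (simp add: coset_addl mult_closed J.a_Hcarr)
  qed
  then have "rcoset_mult A J (coset a) (coset b) = coset (a \<otimes>\<^bsub>A\<^esub> b)"
    unfolding rcoset_mult_def using coset_self a b by blast
  then show ?thesis by (simp add: quot_alg_def)
qed

lemma quot_smult:
  assumes r: "r \<in> carrier F" and a: "a \<in> carrier A"
  shows "r \<odot>\<^bsub>quot_alg A J\<^esub> coset a = coset (r \<odot>\<^bsub>A\<^esub> a)"
proof -
  have "coset (r \<odot>\<^bsub>A\<^esub> x) = coset (r \<odot>\<^bsub>A\<^esub> a)" if x: "x \<in> coset a" for x
  proof -
    obtain j where j: "j \<in> J" "x = j \<oplus>\<^bsub>A\<^esub> a" using x by (rule coset_memE)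
    then have "r \<odot>\<^bsub>A\<^esub> j \<in> J"
      using r alg_ideal_submodule[OF ideal] by (simp add: submodule.smult_closed)
    then show ?thesis
      using j r a by (simp add: smult_r_distr J.a_Hcarr coset_addl)
  qed
  then have "(\<Union>x\<in>coset a. coset (r \<odot>\<^bsub>A\<^esub> x)) = coset (r \<odot>\<^bsub>A\<^esub> a)"
    using coset_self a by blast
  then show ?thesis by (simp add: quot_alg_def)
qed

lemma quot_carrierE:
  assumes "X \<in> carrier (quot_alg A J)"
  obtains a where "a \<in> carrier A" "X = coset a"
  using assms by (auto simp: quot_carrier)

lemma quot_closed: "a \<in> carrier A \<Longrightarrow> coset a \<in> carrier (quot_alg A J)"
  by (simp add: quot_carrier)

lemmas quot_simps = quot_closed quot_one quot_zero quot_add quot_mult quot_smult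

lemma quot_alg_algebra: "nonassoc_algebra F (quot_alg A J)"
proof -
  have group: "abelian_group (quot_alg A J)"
  proof (rule abelian_groupI, goal_cases)
    case (6 X)
    then obtain a where "a \<in> carrier A" "X = coset a" by (rule quot_carrierE)
    then show ?case
      by (intro bexI[of _ "coset (\<ominus>\<^bsub>A\<^esub> a)"]) (simp_all add: quot_simps M.l_neg)
  qed ((elim quot_carrierE)?, simp add: quot_simps M.a_ac)+
  show ?thesis
    by (rule nonassoc_algebraI[OF field_axioms group])
      ((elim quot_carrierE)?, simp add: quot_simps mult_closed one_closed mult_l_one mult_r_one
        mult_l_distr mult_r_distr smult_mult_l smult_mult_r smult_l_distr smult_r_distr
        smult_assoc1)+
qed

lemma coset_hom: "(\<lambda>a\<in>carrier A. coset a) \<in> alg_hom F A (quot_alg A J)"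
  by (rule alg_homI) (simp_all add: quot_simps mult_closed one_closed)

text \<open>The induced map is written in the form in which \<^const>\<open>copair\<close> is defined.\<close>

lemma quot_lift:
  assumes C: "nonassoc_algebra F C" and h: "h \<in> alg_hom F A C"
    and ker: "\<And>j. j \<in> J \<Longrightarrow> h j = \<zero>\<^bsub>C\<^esub>"
  defines "k \<equiv> \<lambda>X\<in>carrier (quot_alg A J). the_elem (h ` X)"
  shows quot_lift_coset: "\<And>a. a \<in> carrier A \<Longrightarrow> k (coset a) = h a"
    and quot_lift_hom: "k \<in> alg_hom F (quot_alg A J) C"
proof -
  interpret C: nonassoc_algebra F C by fact
  show coset: "k (coset a) = h a" if a: "a \<in> carrier A" for a
  proof -
    have "h x = h a" if "x \<in> coset a" for x
    proof -
      obtain j where "j \<in> J" "x = j \<oplus>\<^bsub>A\<^esub> a" using \<open>x \<in> coset a\<close> by (rule coset_memE)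
      then show ?thesis
        using a by (simp add: alg_hom_add[OF h] ker J.a_Hcarr alg_hom_closed[OF h])
    qed
    then have "h ` coset a = {h a}" using coset_self[OF a] by blast
    with a show ?thesis by (simp add: k_def quot_carrier)
  qed
  show "k \<in> alg_hom F (quot_alg A J) C"
  proof (rule alg_homI)
    show "k \<in> extensional (carrier (quot_alg A J))" by (simp add: k_def)
  qed ((elim quot_carrierE)?, simp add: quot_simps coset mult_closed one_closed alg_hom_closed[OF h]
        alg_hom_mult[OF h] alg_hom_add[OF h] alg_hom_one[OF h] alg_hom_smult[OF h])+
qed

lemma quot_hom_eqI:
  assumes h: "h \<in> alg_hom F (quot_alg A J) C" and k: "k \<in> alg_hom F (quot_alg A J) C"
    and eq: "\<And>a. a \<in> carrier A \<Longrightarrow> h (coset a) = k (coset a)"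
  shows "h = k"
  by (rule extensionalityI[OF alg_hom_ext[OF h] alg_hom_ext[OF k]]) (auto simp: quot_carrier eq)

end

section \<open>The universal property of the coproduct\<close>

context alg_pair
begin

text \<open>Together with \<open>gen_ideal_least\<close> this shows that a homomorphism killing the
  relations kills the whole ideal they generate.\<close>

lemma alg_ideal_kernel:
  assumes h: "h \<in> alg_hom F A B"
  shows "alg_ideal F A {a \<in> carrier A. h a = \<zero>\<^bsub>B\<^esub>}"
proof -
  have "submodule {a \<in> carrier A. h a = \<zero>\<^bsub>B\<^esub>} F A"
    by (rule A.submoduleI)
      (auto simp: hom_zero h alg_hom_add[OF h] alg_hom_smult[OF h] A.minus_eq_smult)
  then show ?thesis
    by (auto simp: alg_ideal_def alg_hom_mult[OF h] A.mult_closed A.zero_mult A.mult_zero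
        B.zero_mult B.mult_zero alg_hom_closed[OF h])
qed

lemma hom_rels_carrier:
  assumes h: "h \<in> carrier A \<rightarrow> carrier B"
  shows "hom_rels F A B h \<subseteq> carrier B"
proof -
  have "h a \<in> carrier B" if "a \<in> carrier A" for a using that h by blast
  then show ?thesis
    by (auto simp: hom_rels_def A.mult_closed A.one_closed B.mult_closed B.one_closed)
qed

text \<open>The map h is only a function; each difference measuring its failure to be a homomorphism
  is one of the relations and so vanishes modulo J. Applied to the generators \<open>Inl a\<close>
  and \<open>Inr b\<close> it makes the two inclusions homomorphisms.\<close>

lemma hom_rels_quot_hom:
  assumes h: "h \<in> carrier A \<rightarrow> carrier B" and J: "alg_ideal F B J" and rels: "hom_rels F A B h \<subseteq> J"
  shows "(\<lambda>a\<in>carrier A. J +>\<^bsub>B\<^esub> h a) \<in> alg_hom F A (quot_alg B J)"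
proof -
  interpret J: alg_with_ideal F B J
    by (intro alg_with_ideal.intro alg_with_ideal_axioms.intro J B.algebra_axioms)
  have cl: "h a \<in> carrier B" if "a \<in> carrier A" for a using that h by blast
  have rel: "h (a \<oplus>\<^bsub>A\<^esub> b) \<ominus>\<^bsub>B\<^esub> (h a \<oplus>\<^bsub>B\<^esub> h b) \<in> J"
    "h (a \<otimes>\<^bsub>A\<^esub> b) \<ominus>\<^bsub>B\<^esub> (h a \<otimes>\<^bsub>B\<^esub> h b) \<in> J"
    if "a \<in> carrier A" "b \<in> carrier A" for a b
    by (rule subsetD[OF rels], use that in \<open>auto simp: hom_rels_def\<close>)+
  have rel_smult: "h (r \<odot>\<^bsub>A\<^esub> a) \<ominus>\<^bsub>B\<^esub> (r \<odot>\<^bsub>B\<^esub> h a) \<in> J"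
    if "a \<in> carrier A" "r \<in> carrier F" for a r
    by (rule subsetD[OF rels], use that in \<open>auto simp: hom_rels_def\<close>)
  have one: "h \<one>\<^bsub>A\<^esub> \<ominus>\<^bsub>B\<^esub> \<one>\<^bsub>B\<^esub> \<in> J"
    by (rule subsetD[OF rels]) (auto simp: hom_rels_def)
  note closed = cl A.mult_closed A.one_closed B.mult_closed B.one_closed
  have "J.coset (h (a \<oplus>\<^bsub>A\<^esub> b)) = J.coset (h a \<oplus>\<^bsub>B\<^esub> h b)"
    "J.coset (h (a \<otimes>\<^bsub>A\<^esub> b)) = J.coset (h a \<otimes>\<^bsub>B\<^esub> h b)"
    if "a \<in> carrier A" "b \<in> carrier A" for a b
    by (rule J.coset_eqI, use that rel in \<open>simp_all add: closed\<close>)+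
  moreover have "J.coset (h (r \<odot>\<^bsub>A\<^esub> a)) = J.coset (r \<odot>\<^bsub>B\<^esub> h a)"
    if "a \<in> carrier A" "r \<in> carrier F" for a r
    by (rule J.coset_eqI, use that rel_smult in \<open>simp_all add: closed\<close>)
  moreover have "J.coset (h \<one>\<^bsub>A\<^esub>) = J.coset \<one>\<^bsub>B\<^esub>"
    by (rule J.coset_eqI) (simp_all add: one closed)
  ultimately show ?thesis
    by (intro alg_homI) (simp_all add: J.quot_simps closed)
qed

text \<open>Since l composed with h is the homomorphism f, each relation is sent to the
  corresponding failure of f, which is zero. This lets a lift pass to the quotient.\<close>

lemma hom_rels_vanish:
  assumes h: "h \<in> carrier A \<rightarrow> carrier B" and C: "nonassoc_algebra F C" and l: "l \<in> alg_hom F B C"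
    and f: "f \<in> alg_hom F A C" and lh: "\<And>a. a \<in> carrier A \<Longrightarrow> l (h a) = f a"
    and x: "x \<in> hom_rels F A B h"
  shows "l x = \<zero>\<^bsub>C\<^esub>"
proof -
  interpret C: nonassoc_algebra F C by fact
  interpret BC: alg_pair F B C by unfold_locales
  have cl: "h a \<in> carrier B" if "a \<in> carrier A" for a using that h by blast
  note l_simps = BC.hom_minus[OF l] alg_hom_add[OF l] alg_hom_mult[OF l] alg_hom_one[OF l]
    alg_hom_smult[OF l] alg_hom_closed[OF l] C.minus_self
  note closed = cl A.mult_closed A.one_closed B.mult_closed B.one_closed C.mult_closed C.one_closed
  from x consider
      (add) a b where "a \<in> carrier A" "b \<in> carrier A" "x = h (a \<oplus>\<^bsub>A\<^esub> b) \<ominus>\<^bsub>B\<^esub> (h a \<oplus>\<^bsub>B\<^esub> h b)"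
    | (mult) a b where "a \<in> carrier A" "b \<in> carrier A" "x = h (a \<otimes>\<^bsub>A\<^esub> b) \<ominus>\<^bsub>B\<^esub> (h a \<otimes>\<^bsub>B\<^esub> h b)"
    | (smult) r a where "r \<in> carrier F" "a \<in> carrier A" "x = h (r \<odot>\<^bsub>A\<^esub> a) \<ominus>\<^bsub>B\<^esub> (r \<odot>\<^bsub>B\<^esub> h a)"
    | (one) "x = h \<one>\<^bsub>A\<^esub> \<ominus>\<^bsub>B\<^esub> \<one>\<^bsub>B\<^esub>"
    by (auto simp: hom_rels_def)
  then show ?thesis
  proof cases
    case add
    have "l x = f (a \<oplus>\<^bsub>A\<^esub> b) \<ominus>\<^bsub>C\<^esub> (f a \<oplus>\<^bsub>C\<^esub> f b)"
      using add by (simp add: l_simps lh closed)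
    with add show ?thesis by (simp add: alg_hom_add[OF f] alg_hom_closed[OF f] C.minus_self)
  next
    case mult
    have "l x = f (a \<otimes>\<^bsub>A\<^esub> b) \<ominus>\<^bsub>C\<^esub> (f a \<otimes>\<^bsub>C\<^esub> f b)"
      using mult by (simp add: l_simps lh closed)
    with mult show ?thesis
      by (simp add: alg_hom_mult[OF f] alg_hom_closed[OF f] C.minus_self C.mult_closed)
  next
    case smult
    have "l x = f (r \<odot>\<^bsub>A\<^esub> a) \<ominus>\<^bsub>C\<^esub> (r \<odot>\<^bsub>C\<^esub> f a)"
      using smult by (simp add: l_simps lh closed)
    with smult show ?thesis by (simp add: alg_hom_smult[OF f] alg_hom_closed[OF f] C.minus_self)
  next
    case one
    have "l x = f \<one>\<^bsub>A\<^esub> \<ominus>\<^bsub>C\<^esub> \<one>\<^bsub>C\<^esub>"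
      using one by (simp add: l_simps lh closed)
    then show ?thesis by (simp add: alg_hom_one[OF f] C.minus_self C.one_closed)
  qed
qed

end

context alg_pair
begin

lemma coprod_with_ideal: "alg_with_ideal F (free_sum F A B) (coprod_ideal F A B)"
  and hom_rels_inl: "hom_rels F A (free_sum F A B) (\<lambda>a. free_gen F (Inl a)) \<subseteq> coprod_ideal F A B"
  and hom_rels_inr: "hom_rels F B (free_sum F A B) (\<lambda>b. free_gen F (Inr b)) \<subseteq> coprod_ideal F A B"
proof -
  interpret free: nonassoc_algebra F "free_sum F A B" by (rule A.free_alg_algebra)
  interpret Af: alg_pair F A "free_sum F A B" by unfold_locales
  interpret Bf: alg_pair F B "free_sum F A B" by unfold_locales
  have "hom_rels F A (free_sum F A B) (\<lambda>a. free_gen F (Inl a)) \<subseteq> carrier (free_sum F A B)"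
    by (rule Af.hom_rels_carrier) (auto simp: A.field_axioms InlI InrI)
  moreover have "hom_rels F B (free_sum F A B) (\<lambda>b. free_gen F (Inr b)) \<subseteq> carrier (free_sum F A B)"
    by (rule Bf.hom_rels_carrier) (auto simp: A.field_axioms InlI InrI)
  ultimately show "alg_with_ideal F (free_sum F A B) (coprod_ideal F A B)"
    unfolding coprod_ideal_def
    by (intro alg_with_ideal.intro alg_with_ideal_axioms.intro free.alg_ideal_gen_ideal
        free.algebra_axioms) simp
  show "hom_rels F A (free_sum F A B) (\<lambda>a. free_gen F (Inl a)) \<subseteq> coprod_ideal F A B"
    "hom_rels F B (free_sum F A B) (\<lambda>b. free_gen F (Inr b)) \<subseteq> coprod_ideal F A B"
    using free.gen_ideal_superset unfolding coprod_ideal_def by blast+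
qed

lemma coprod_algebra: "nonassoc_algebra F (coprod F A B)"
  unfolding coprod_def by (rule alg_with_ideal.quot_alg_algebra[OF coprod_with_ideal])

lemma inj1_hom: "inj1 F A B \<in> alg_hom F A (coprod F A B)"
proof -
  interpret alg_with_ideal F "free_sum F A B" "coprod_ideal F A B" by (rule coprod_with_ideal)
  interpret Af: alg_pair F A "free_sum F A B" by unfold_locales
  show ?thesis
    unfolding coprod_def inj1_def
    by (rule Af.hom_rels_quot_hom[OF _ ideal hom_rels_inl]) (auto simp: A.field_axioms InlI InrI)
qed

lemma inj2_hom: "inj2 F A B \<in> alg_hom F B (coprod F A B)"
proof -
  interpret alg_with_ideal F "free_sum F A B" "coprod_ideal F A B" by (rule coprod_with_ideal)
  interpret Bf: alg_pair F B "free_sum F A B" by unfold_locales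
  show ?thesis
    unfolding coprod_def inj2_def
    by (rule Bf.hom_rels_quot_hom[OF _ ideal hom_rels_inr]) (auto simp: A.field_axioms InlI InrI)
qed

text \<open>Existence in the universal property: \<open>case_sum f g\<close> extends to the free
  algebra on the disjoint union of the carriers, and this lift descends because f and g already
  satisfy the relations.\<close>

lemma
  assumes C: "nonassoc_algebra F C" and f: "f \<in> alg_hom F A C" and g: "g \<in> alg_hom F B C"
  shows copair_hom: "copair F A B C f g \<in> alg_hom F (coprod F A B) C"
    and copair_inj1: "a \<in> carrier A \<Longrightarrow> copair F A B C f g (inj1 F A B a) = f a"
    and copair_inj2: "b \<in> carrier B \<Longrightarrow> copair F A B C f g (inj2 F A B b) = g b"
proof -
  interpret alg_with_ideal F "free_sum F A B" "coprod_ideal F A B" by (rule coprod_with_ideal)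
  interpret C: nonassoc_algebra F C by fact
  interpret Af: alg_pair F A "free_sum F A B" by unfold_locales
  interpret Bf: alg_pair F B "free_sum F A B" by unfold_locales
  interpret fC: alg_pair F "free_sum F A B" C by unfold_locales
  let ?l = "free_lift F (Sum_Type.Plus (carrier A) (carrier B)) C (case_sum f g)"
  have fg: "case_sum f g \<in> Sum_Type.Plus (carrier A) (carrier B) \<rightarrow> carrier C"
    by (auto simp: alg_hom_closed[OF f] alg_hom_closed[OF g])
  note l = C.free_lift_hom[OF fg]
  have l_inl: "?l (free_gen F (Inl a)) = f a" if "a \<in> carrier A" for a
    using that by (simp add: C.free_lift_gen[OF fg] InlI InrI)
  have l_inr: "?l (free_gen F (Inr b)) = g b" if "b \<in> carrier B" for b
    using that by (simp add: C.free_lift_gen[OF fg] InlI InrI)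
  have "?l x = \<zero>\<^bsub>C\<^esub>" if "x \<in> hom_rels F A (free_sum F A B) (\<lambda>a. free_gen F (Inl a))" for x
    by (rule Af.hom_rels_vanish[OF _ C l f l_inl that]) (auto simp: A.field_axioms InlI InrI)
  moreover have "?l x = \<zero>\<^bsub>C\<^esub>" if "x \<in> hom_rels F B (free_sum F A B) (\<lambda>b. free_gen F (Inr b))" for x
    by (rule Bf.hom_rels_vanish[OF _ C l g l_inr that]) (auto simp: A.field_axioms InlI InrI)
  moreover have "hom_rels F A (free_sum F A B) (\<lambda>a. free_gen F (Inl a)) \<subseteq> carrier (free_sum F A B)"
    by (rule Af.hom_rels_carrier) (auto simp: A.field_axioms InlI InrI)
  moreover have "hom_rels F B (free_sum F A B) (\<lambda>b. free_gen F (Inr b)) \<subseteq> carrier (free_sum F A B)"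
    by (rule Bf.hom_rels_carrier) (auto simp: A.field_axioms InlI InrI)
  \<comment> \<open>The kernel of the lift is an ideal containing all relations, hence contains the
    smallest such ideal.\<close>
  ultimately have "coprod_ideal F A B \<subseteq> {x \<in> carrier (free_sum F A B). ?l x = \<zero>\<^bsub>C\<^esub>}"
    unfolding coprod_ideal_def by (intro gen_ideal_least fC.alg_ideal_kernel l) auto
  then have ker: "?l x = \<zero>\<^bsub>C\<^esub>" if "x \<in> coprod_ideal F A B" for x
    using that by blast
  show "copair F A B C f g \<in> alg_hom F (coprod F A B) C"
    unfolding copair_def coprod_def by (rule quot_lift_hom[OF C l ker])
  note coset = quot_lift_coset[OF C l ker, folded coprod_def, folded copair_def]
  show "copair F A B C f g (inj1 F A B a) = f a" if "a \<in> carrier A"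
    using that coset[of "free_gen F (Inl a)"] by (simp add: inj1_def l_inl A.field_axioms InlI InrI)
  show "copair F A B C f g (inj2 F A B b) = g b" if "b \<in> carrier B"
    using that coset[of "free_gen F (Inr b)"] by (simp add: inj2_def l_inr A.field_axioms InlI InrI)
qed

text \<open>Uniqueness in the universal property: composed with the projection, both maps are
  homomorphisms on a free algebra whose generators project to the images of the two
  inclusions.\<close>

lemma coprod_hom_eqI:
  assumes C: "nonassoc_algebra F C"
    and h: "h \<in> alg_hom F (coprod F A B) C" and k: "k \<in> alg_hom F (coprod F A B) C"
    and eq1: "\<And>a. a \<in> carrier A \<Longrightarrow> h (inj1 F A B a) = k (inj1 F A B a)"
    and eq2: "\<And>b. b \<in> carrier B \<Longrightarrow> h (inj2 F A B b) = k (inj2 F A B b)"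
  shows "h = k"
proof -
  interpret alg_with_ideal F "free_sum F A B" "coprod_ideal F A B" by (rule coprod_with_ideal)
  interpret C: nonassoc_algebra F C by fact
  let ?\<pi> = "\<lambda>p\<in>carrier (free_sum F A B). coset p"
  note \<pi> = coset_hom[folded coprod_def]
  have "compose (carrier (free_sum F A B)) h ?\<pi> = compose (carrier (free_sum F A B)) k ?\<pi>"
  proof (rule C.free_alg_hom_eqI[OF alg_hom_compose[OF algebra_axioms \<pi> h]
        alg_hom_compose[OF algebra_axioms \<pi> k]])
    fix x assume x: "x \<in> Sum_Type.Plus (carrier A) (carrier B)"
    then have "h (coset (free_gen F x)) = k (coset (free_gen F x))"
      using eq1 eq2 by (auto simp: inj1_def inj2_def)
    with x show "compose (carrier (free_sum F A B)) h ?\<pi> (free_gen F x) =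
        compose (carrier (free_sum F A B)) k ?\<pi> (free_gen F x)"
      by (simp add: compose_eq A.field_axioms InlI InrI)
  qed
  then have "h (coset p) = k (coset p)" if "p \<in> carrier (free_sum F A B)" for p
    using that compose_eq[OF that, of h ?\<pi>] compose_eq[OF that, of k ?\<pi>] by (metis restrict_apply')
  then show ?thesis
    using h k unfolding coprod_def by (intro quot_hom_eqI) auto
qed

end

text \<open>With the locale hypothesis unfolded into two premises, nested coproducts can be treated
  by \<open>OF\<close>, without an interpretation for each pair of algebras.\<close>

lemmas coprod_algebra = alg_pair.coprod_algebra[OF alg_pair.intro]
  and inj1_hom = alg_pair.inj1_hom[OF alg_pair.intro]
  and inj2_hom = alg_pair.inj2_hom[OF alg_pair.intro]
  and copair_hom = alg_pair.copair_hom[OF alg_pair.intro]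
  and copair_inj1 = alg_pair.copair_inj1[OF alg_pair.intro]
  and copair_inj2 = alg_pair.copair_inj2[OF alg_pair.intro]
  and coprod_hom_eqI = alg_pair.coprod_hom_eqI[OF alg_pair.intro]

section \<open>Maps between coproducts\<close>

lemma
  assumes algs: "nonassoc_algebra F A" "nonassoc_algebra F B" "nonassoc_algebra F C" "nonassoc_algebra F D"
    and f: "f \<in> alg_hom F A C" and g: "g \<in> alg_hom F B D"
  shows coprod_map_hom: "coprod_map F A B C D f g \<in> alg_hom F (coprod F A B) (coprod F C D)"
    and coprod_map_inj1: "a \<in> carrier A \<Longrightarrow>
      coprod_map F A B C D f g (inj1 F A B a) = inj1 F C D (f a)"
    and coprod_map_inj2: "b \<in> carrier B \<Longrightarrow>
      coprod_map F A B C D f g (inj2 F A B b) = inj2 F C D (g b)"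
proof -
  note prems = coprod_algebra[OF algs(3,4)]
    alg_hom_compose[OF algs(1) f inj1_hom[OF algs(3,4)]]
    alg_hom_compose[OF algs(2) g inj2_hom[OF algs(3,4)]]
  show "coprod_map F A B C D f g \<in> alg_hom F (coprod F A B) (coprod F C D)"
    "a \<in> carrier A \<Longrightarrow> coprod_map F A B C D f g (inj1 F A B a) = inj1 F C D (f a)"
    "b \<in> carrier B \<Longrightarrow> coprod_map F A B C D f g (inj2 F A B b) = inj2 F C D (g b)"
    using copair_hom[OF algs(1,2) prems] copair_inj1[OF algs(1,2) prems]
      copair_inj2[OF algs(1,2) prems]
    by (simp_all add: coprod_map_def compose_eq)
qed

lemma
  assumes A: "nonassoc_algebra F A"
  shows fold_map_hom: "fold_map F A \<in> alg_hom F (coprod F A A) A"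
    and fold_map_inj1: "a \<in> carrier A \<Longrightarrow> fold_map F A (inj1 F A A a) = a"
    and fold_map_inj2: "a \<in> carrier A \<Longrightarrow> fold_map F A (inj2 F A A a) = a"
  using copair_hom[OF A A A alg_id_hom[OF A] alg_id_hom[OF A]]
    copair_inj1[OF A A A alg_id_hom[OF A] alg_id_hom[OF A]]
    copair_inj2[OF A A A alg_id_hom[OF A] alg_id_hom[OF A]]
  by (simp_all add: fold_map_def)

lemma
  assumes algs: "nonassoc_algebra F A" "nonassoc_algebra F B" "nonassoc_algebra F C"
  shows assoc_right_hom: "assoc_right F A B C \<in>
      alg_hom F (coprod F (coprod F A B) C) (coprod F A (coprod F B C))"
    and assoc_right_inj1_inj1: "a \<in> carrier A \<Longrightarrow>
      assoc_right F A B C (inj1 F (coprod F A B) C (inj1 F A B a)) = inj1 F A (coprod F B C) a"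
    and assoc_right_inj1_inj2: "b \<in> carrier B \<Longrightarrow>
      assoc_right F A B C (inj1 F (coprod F A B) C (inj2 F A B b)) =
        inj2 F A (coprod F B C) (inj1 F B C b)"
    and assoc_right_inj2: "c \<in> carrier C \<Longrightarrow>
      assoc_right F A B C (inj2 F (coprod F A B) C c) = inj2 F A (coprod F B C) (inj2 F B C c)"
proof -
  note AB = coprod_algebra[OF algs(1,2)] and BC = coprod_algebra[OF algs(2,3)]
  note ABC = coprod_algebra[OF algs(1) BC]
  note inner = ABC inj1_hom[OF algs(1) BC]
    alg_hom_compose[OF algs(2) inj1_hom[OF algs(2,3)] inj2_hom[OF algs(1) BC]]
  note outer = ABC copair_hom[OF algs(1,2) inner]
    alg_hom_compose[OF algs(3) inj2_hom[OF algs(2,3)] inj2_hom[OF algs(1) BC]]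
  note eqs = copair_inj1[OF AB algs(3) outer] copair_inj2[OF AB algs(3) outer]
    copair_inj1[OF algs(1,2) inner] copair_inj2[OF algs(1,2) inner]
    alg_hom_closed[OF inj1_hom[OF algs(1,2)]] alg_hom_closed[OF inj2_hom[OF algs(1,2)]] compose_eq
  show "assoc_right F A B C \<in> alg_hom F (coprod F (coprod F A B) C) (coprod F A (coprod F B C))"
    unfolding assoc_right_def Let_def by (rule copair_hom[OF AB algs(3) outer])
  show "a \<in> carrier A \<Longrightarrow>
      assoc_right F A B C (inj1 F (coprod F A B) C (inj1 F A B a)) = inj1 F A (coprod F B C) a"
    "b \<in> carrier B \<Longrightarrow> assoc_right F A B C (inj1 F (coprod F A B) C (inj2 F A B b)) =
        inj2 F A (coprod F B C) (inj1 F B C b)"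
    "c \<in> carrier C \<Longrightarrow>
      assoc_right F A B C (inj2 F (coprod F A B) C c) = inj2 F A (coprod F B C) (inj2 F B C c)"
    unfolding assoc_right_def Let_def by (simp_all add: eqs)
qed

lemma
  assumes algs: "nonassoc_algebra F A" "nonassoc_algebra F B" "nonassoc_algebra F C"
  shows assoc_left_hom: "assoc_left F A B C \<in>
      alg_hom F (coprod F A (coprod F B C)) (coprod F (coprod F A B) C)"
    and assoc_left_inj1: "a \<in> carrier A \<Longrightarrow>
      assoc_left F A B C (inj1 F A (coprod F B C) a) = inj1 F (coprod F A B) C (inj1 F A B a)"
    and assoc_left_inj2_inj1: "b \<in> carrier B \<Longrightarrow>
      assoc_left F A B C (inj2 F A (coprod F B C) (inj1 F B C b)) =
        inj1 F (coprod F A B) C (inj2 F A B b)"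
    and assoc_left_inj2_inj2: "c \<in> carrier C \<Longrightarrow>
      assoc_left F A B C (inj2 F A (coprod F B C) (inj2 F B C c)) = inj2 F (coprod F A B) C c"
proof -
  note AB = coprod_algebra[OF algs(1,2)] and BC = coprod_algebra[OF algs(2,3)]
  note ABC = coprod_algebra[OF AB algs(3)]
  note inner = ABC alg_hom_compose[OF algs(2) inj2_hom[OF algs(1,2)] inj1_hom[OF AB algs(3)]]
    inj2_hom[OF AB algs(3)]
  note outer = ABC alg_hom_compose[OF algs(1) inj1_hom[OF algs(1,2)] inj1_hom[OF AB algs(3)]]
    copair_hom[OF algs(2,3) inner]
  note eqs = copair_inj1[OF algs(1) BC outer] copair_inj2[OF algs(1) BC outer]
    copair_inj1[OF algs(2,3) inner] copair_inj2[OF algs(2,3) inner]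
    alg_hom_closed[OF inj1_hom[OF algs(2,3)]] alg_hom_closed[OF inj2_hom[OF algs(2,3)]] compose_eq
  show "assoc_left F A B C \<in> alg_hom F (coprod F A (coprod F B C)) (coprod F (coprod F A B) C)"
    unfolding assoc_left_def Let_def by (rule copair_hom[OF algs(1) BC outer])
  show "a \<in> carrier A \<Longrightarrow>
      assoc_left F A B C (inj1 F A (coprod F B C) a) = inj1 F (coprod F A B) C (inj1 F A B a)"
    "b \<in> carrier B \<Longrightarrow> assoc_left F A B C (inj2 F A (coprod F B C) (inj1 F B C b)) =
        inj1 F (coprod F A B) C (inj2 F A B b)"
    "c \<in> carrier C \<Longrightarrow>
      assoc_left F A B C (inj2 F A (coprod F B C) (inj2 F B C c)) = inj2 F (coprod F A B) C c"
    unfolding assoc_left_def Let_def by (simp_all add: eqs)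
qed

text \<open>The composites $(\mathrm{id}\amalg\mu)(\delta\amalg\mathrm{id})$ and
  $(\mu\amalg\mathrm{id})(\mathrm{id}\amalg\delta)$ of the coloop axioms: endomorphisms of $H\amalg H$
  that fix one copy of $H$ and act as $\delta$ on the other.\<close>

definition right_act ::
  "('f, 'm) ring_scheme \<Rightarrow> ('f, 'h) module \<Rightarrow> ('h \<Rightarrow> ('f, 'h, 'h) coprod)
    \<Rightarrow> ('f, 'h, 'h) coprod \<Rightarrow> ('f, 'h, 'h) coprod" where
  "right_act F H \<delta> = compose (carrier (coprod F H H))
     (coprod_map F H (coprod F H H) H H (alg_id H) (fold_map F H))
     (compose (carrier (coprod F H H)) (assoc_right F H H H)
        (coprod_map F H H (coprod F H H) H \<delta> (alg_id H)))"

definition left_act ::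
  "('f, 'm) ring_scheme \<Rightarrow> ('f, 'h) module \<Rightarrow> ('h \<Rightarrow> ('f, 'h, 'h) coprod)
    \<Rightarrow> ('f, 'h, 'h) coprod \<Rightarrow> ('f, 'h, 'h) coprod" where
  "left_act F H \<delta> = compose (carrier (coprod F H H))
     (coprod_map F (coprod F H H) H H H (fold_map F H) (alg_id H))
     (compose (carrier (coprod F H H)) (assoc_left F H H H)
        (coprod_map F H H H (coprod F H H) (alg_id H) \<delta>))"

lemma
  assumes H: "nonassoc_algebra F H" and \<delta>: "\<delta> \<in> alg_hom F H (coprod F H H)"
  shows right_act_hom: "right_act F H \<delta> \<in> alg_hom F (coprod F H H) (coprod F H H)"
    and right_act_inj1: "h \<in> carrier H \<Longrightarrow> right_act F H \<delta> (inj1 F H H h) = \<delta> h"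
    and right_act_inj2: "h \<in> carrier H \<Longrightarrow> right_act F H \<delta> (inj2 F H H h) = inj2 F H H h"
proof -
  note HH = coprod_algebra[OF H H]
  note id = alg_id_hom[OF H]
  note m1 = coprod_map_hom[OF H H HH H \<delta> id]
    and m2 = assoc_right_hom[OF H H H]
    and m3 = coprod_map_hom[OF H HH H H id fold_map_hom[OF H]]
  note H_simps = alg_hom_closed[OF inj1_hom[OF H H]] alg_hom_closed[OF inj2_hom[OF H H]] alg_id_apply
    compose_eq coprod_map_inj1[OF H H HH H \<delta> id] coprod_map_inj2[OF H H HH H \<delta> id]
    coprod_map_inj1[OF H HH H H id fold_map_hom[OF H]] coprod_map_inj2[OF H HH H H id fold_map_hom[OF H]]
    assoc_right_inj1_inj1[OF H H H] assoc_right_inj1_inj2[OF H H H] assoc_right_inj2[OF H H H]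
    fold_map_inj1[OF H] fold_map_inj2[OF H] alg_hom_closed[OF \<delta>]
  show "right_act F H \<delta> \<in> alg_hom F (coprod F H H) (coprod F H H)"
    unfolding right_act_def by (rule alg_hom_compose[OF HH alg_hom_compose[OF HH m1 m2] m3])
  show "right_act F H \<delta> (inj2 F H H h) = inj2 F H H h" if "h \<in> carrier H"
    using that unfolding right_act_def by (simp add: H_simps)
  \<comment> \<open>Everything that happens after \<delta> on the first summand. Showing that it is
    the identity gives \<delta> h for arbitrary \<delta> h, with no need to expand that
    element.\<close>
  let ?c = "compose (carrier (coprod F H H)) (coprod_map F H (coprod F H H) H H (alg_id H) (fold_map F H))
     (compose (carrier (coprod F H H)) (assoc_right F H H H) (inj1 F (coprod F H H) H))"
  \<comment> \<open>The first copy stays first. The second copy is moved into the first summand of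
    the inner coproduct and folded back to the second copy.\<close>
  have "?c = alg_id (coprod F H H)"
  proof (rule coprod_hom_eqI[OF H H HH _ alg_id_hom[OF HH]])
    show "?c \<in> alg_hom F (coprod F H H) (coprod F H H)"
      by (rule alg_hom_compose[OF HH alg_hom_compose[OF HH inj1_hom[OF HH H] m2] m3])
  qed (simp_all add: H_simps)
  then have c: "?c x = x" if "x \<in> carrier (coprod F H H)" for x
    using that by (metis alg_id_apply)
  show "right_act F H \<delta> (inj1 F H H h) = \<delta> h" if "h \<in> carrier H"
    using that c[of "\<delta> h"] unfolding right_act_def by (simp add: H_simps)
qed

lemma
  assumes H: "nonassoc_algebra F H" and \<delta>: "\<delta> \<in> alg_hom F H (coprod F H H)"
  shows left_act_hom: "left_act F H \<delta> \<in> alg_hom F (coprod F H H) (coprod F H H)"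
    and left_act_inj1: "h \<in> carrier H \<Longrightarrow> left_act F H \<delta> (inj1 F H H h) = inj1 F H H h"
    and left_act_inj2: "h \<in> carrier H \<Longrightarrow> left_act F H \<delta> (inj2 F H H h) = \<delta> h"
proof -
  note HH = coprod_algebra[OF H H]
  note id = alg_id_hom[OF H]
  note m1 = coprod_map_hom[OF H H H HH id \<delta>]
    and m2 = assoc_left_hom[OF H H H]
    and m3 = coprod_map_hom[OF HH H H H fold_map_hom[OF H] id]
  note H_simps = alg_hom_closed[OF inj1_hom[OF H H]] alg_hom_closed[OF inj2_hom[OF H H]] alg_id_apply
    compose_eq coprod_map_inj1[OF H H H HH id \<delta>] coprod_map_inj2[OF H H H HH id \<delta>]
    coprod_map_inj1[OF HH H H H fold_map_hom[OF H] id] coprod_map_inj2[OF HH H H H fold_map_hom[OF H] id]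
    assoc_left_inj1[OF H H H] assoc_left_inj2_inj1[OF H H H] assoc_left_inj2_inj2[OF H H H]
    fold_map_inj1[OF H] fold_map_inj2[OF H] alg_hom_closed[OF \<delta>]
  show "left_act F H \<delta> \<in> alg_hom F (coprod F H H) (coprod F H H)"
    unfolding left_act_def by (rule alg_hom_compose[OF HH alg_hom_compose[OF HH m1 m2] m3])
  show "left_act F H \<delta> (inj1 F H H h) = inj1 F H H h" if "h \<in> carrier H"
    using that unfolding left_act_def by (simp add: H_simps)
  \<comment> \<open>Mirror image: here the first copy enters the second summand of the inner
    coproduct, from which folding returns it.\<close>
  let ?c = "compose (carrier (coprod F H H)) (coprod_map F (coprod F H H) H H H (fold_map F H) (alg_id H))
     (compose (carrier (coprod F H H)) (assoc_left F H H H) (inj2 F H (coprod F H H)))"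
  have "?c = alg_id (coprod F H H)"
  proof (rule coprod_hom_eqI[OF H H HH _ alg_id_hom[OF HH]])
    show "?c \<in> alg_hom F (coprod F H H) (coprod F H H)"
      by (rule alg_hom_compose[OF HH alg_hom_compose[OF HH inj2_hom[OF H HH] m2] m3])
  qed (simp_all add: H_simps)
  then have c: "?c x = x" if "x \<in> carrier (coprod F H H)" for x
    using that by (metis alg_id_apply)
  show "left_act F H \<delta> (inj2 F H H h) = \<delta> h" if "h \<in> carrier H"
    using that c[of "\<delta> h"] unfolding left_act_def by (simp add: H_simps)
qed

section \<open>The loop of invertible series\<close>

lemma compositions_1: "1 \<le> n \<Longrightarrow> compositions n (Suc 0) = {[n]}"
  by (auto simp: compositions_def length_Suc_conv)

lemma finite_compositions: "finite (compositions n l)"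
proof (rule finite_subset)
  show "compositions n l \<subseteq> {ns. set ns \<subseteq> {..n} \<and> length ns = l}"
    by (auto simp: compositions_def intro: member_le_sum_list)
qed (simp add: finite_lists_length_eq)

lemma length_le_sum_list: "(\<forall>k\<in>set ns. 1 \<le> (k::nat)) \<Longrightarrow> length ns \<le> sum_list ns"
  by (induct ns) auto

text \<open>All parts are at least 1. This makes the sums over the number of parts
  stabilise.\<close>

lemma compositions_eq_empty: "n < l \<Longrightarrow> compositions n l = {}"
  using length_le_sum_list by (fastforce simp: compositions_def)

text \<open>Here m is the sum of all parts but the last. It is at least 1 because l parts remain,
  and less than n because the last part n - m is positive.\<close>

lemma compositions_snoc:
  assumes "1 \<le> l"
  shows "compositions n (Suc l) = (\<Union>m\<in>{1..<n}. (\<lambda>ms. ms @ [n - m]) ` compositions m l)"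
proof (intro equalityI subsetI)
  fix ns assume ns: "ns \<in> compositions n (Suc l)"
  then obtain ms k where eq: "ns = ms @ [k]"
    by (cases ns rule: rev_cases) (auto simp: compositions_def)
  with ns assms length_le_sum_list[of ms]
  have "ms \<in> compositions (sum_list ms) l" "sum_list ms \<in> {1..<n}" "k = n - sum_list ms"
    by (auto simp: compositions_def)
  with eq show "ns \<in> (\<Union>m\<in>{1..<n}. (\<lambda>ms. ms @ [n - m]) ` compositions m l)" by blast
next
  fix ns assume "ns \<in> (\<Union>m\<in>{1..<n}. (\<lambda>ms. ms @ [n - m]) ` compositions m l)"
  then show "ns \<in> compositions n (Suc l)" by (auto simp: compositions_def)
qed

text \<open>Reversal exchanges left-nested and right-nested products, and it permutes the index set
  of the sums.\<close>

lemma compositions_rev: "rev ` compositions n l = compositions n l"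
proof -
  have "rev ` compositions n l \<subseteq> compositions n l" by (auto simp: compositions_def)
  moreover have "compositions n l \<subseteq> rev ` compositions n l"
  proof
    fix ns assume "ns \<in> compositions n l"
    then have "rev ns \<in> compositions n l" by (auto simp: compositions_def)
    then show "ns \<in> rev ` compositions n l" by (metis imageI rev_rev_ident)
  qed
  ultimately show ?thesis by blast
qed

text \<open>The unsigned inner sum of the division formula. The index l counts multiplications, not
  parts, so that l = 0 gives the leading difference which the formula writes separately.\<close>

definition rdiv_term ::
  "('f, 'a) module \<Rightarrow> (nat \<Rightarrow> 'a) \<Rightarrow> (nat \<Rightarrow> 'a) \<Rightarrow> nat \<Rightarrow> nat \<Rightarrow> 'a" where
  "rdiv_term A a b l n = (\<Oplus>\<^bsub>A\<^esub>ns\<in>compositions n (l + 1).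
     foldl (\<lambda>u k. u \<otimes>\<^bsub>A\<^esub> b k) (a (hd ns) \<ominus>\<^bsub>A\<^esub> b (hd ns)) (tl ns))"

text \<open>At n = 0 the bare expression would be a_0 - b_0, which is zero for invertible series, so
  the leading coefficient is set to 1 by hand.\<close>

definition rdiv_series ::
  "('f, 'm) ring_scheme \<Rightarrow> ('f, 'a) module \<Rightarrow> (nat \<Rightarrow> 'a) \<Rightarrow> (nat \<Rightarrow> 'a) \<Rightarrow> nat \<Rightarrow> 'a" where
  "rdiv_series F A a b n = (if n = 0 then \<one>\<^bsub>A\<^esub> else rdiv_expr F A a b n)"

definition ldiv_series ::
  "('f, 'm) ring_scheme \<Rightarrow> ('f, 'a) module \<Rightarrow> (nat \<Rightarrow> 'a) \<Rightarrow> (nat \<Rightarrow> 'a) \<Rightarrow> nat \<Rightarrow> 'a" where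
  "ldiv_series F A a b n = (if n = 0 then \<one>\<^bsub>A\<^esub> else ldiv_expr F A a b n)"

section \<open>The recursion for right division\<close>

context nonassoc_algebra
begin

lemma foldl_mult_closed:
  "\<lbrakk>u \<in> carrier A; \<And>k. b k \<in> carrier A\<rbrakk> \<Longrightarrow> foldl (\<lambda>u k. u \<otimes>\<^bsub>A\<^esub> b k) u ns \<in> carrier A"
  by (induct ns arbitrary: u) (auto simp: mult_closed)

lemma foldr_mult_closed:
  "\<lbrakk>u \<in> carrier A; \<And>k. b k \<in> carrier A\<rbrakk> \<Longrightarrow> foldr (\<lambda>k u. b k \<otimes>\<^bsub>A\<^esub> u) ns u \<in> carrier A"
  by (induct ns) (auto simp: mult_closed)

lemma rdiv_term_closed:
  "\<lbrakk>\<And>k. a k \<in> carrier A; \<And>k. b k \<in> carrier A\<rbrakk> \<Longrightarrow> rdiv_term A a b l n \<in> carrier A"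
  by (auto simp: rdiv_term_def foldl_mult_closed intro!: M.finsum_closed)

lemma rdiv_expr_closed:
  assumes "\<And>k. a k \<in> carrier A" "\<And>k. b k \<in> carrier A"
  shows "rdiv_expr F A a b n \<in> carrier A"
  using assms
  by (auto simp: rdiv_expr_def foldl_mult_closed intro!: M.finsum_closed M.a_closed smult_closed)

lemma ldiv_expr_closed:
  assumes "\<And>k. a k \<in> carrier A" "\<And>k. b k \<in> carrier A"
  shows "ldiv_expr F A a b n \<in> carrier A"
  using assms
  by (auto simp: ldiv_expr_def foldr_mult_closed intro!: M.finsum_closed M.a_closed smult_closed)

lemma series_mult_closed:
  "\<lbrakk>\<And>k. a k \<in> carrier A; \<And>k. b k \<in> carrier A\<rbrakk> \<Longrightarrow> series_mult A a b n \<in> carrier A"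
  by (auto simp: series_mult_def mult_closed intro!: M.finsum_closed)

lemma rdiv_term_0:
  assumes "1 \<le> n" "\<And>k. a k \<in> carrier A" "\<And>k. b k \<in> carrier A"
  shows "rdiv_term A a b 0 n = a n \<ominus>\<^bsub>A\<^esub> b n"
  using assms by (simp add: rdiv_term_def compositions_1)

lemma rdiv_term_eq_zero: "n \<le> l \<Longrightarrow> rdiv_term A a b l n = \<zero>\<^bsub>A\<^esub>"
  by (simp add: rdiv_term_def compositions_eq_empty)

text \<open>With all brackets to the left, the last part of a composition contributes the outermost
  right factor. It leaves the sum by distributivity alone, so associativity does not enter.\<close>

lemma rdiv_term_Suc:
  assumes a: "\<And>k. a k \<in> carrier A" and b: "\<And>k. b k \<in> carrier A"
  shows "rdiv_term A a b (Suc l) n = (\<Oplus>\<^bsub>A\<^esub>m\<in>{1..<n}. rdiv_term A a b l m \<otimes>\<^bsub>A\<^esub> b (n - m))"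
proof -
  let ?t = "\<lambda>ns. foldl (\<lambda>u k. u \<otimes>\<^bsub>A\<^esub> b k) (a (hd ns) \<ominus>\<^bsub>A\<^esub> b (hd ns)) (tl ns)"
  let ?snoc = "\<lambda>m ms. ms @ [n - m]"
  have t: "?t ns \<in> carrier A" for ns by (simp add: foldl_mult_closed a b)
  have "rdiv_term A a b (Suc l) n =
      finsum A ?t (\<Union>m\<in>{1..<n}. ?snoc m ` compositions m (Suc l))"
    by (simp add: rdiv_term_def compositions_snoc[of "Suc l" n])
  also have "\<dots> = (\<Oplus>\<^bsub>A\<^esub>m\<in>{1..<n}. finsum A ?t (?snoc m ` compositions m (Suc l)))"
  proof (rule M.add.finprod_UN_disjoint)
    \<comment> \<open>Equal extended lists would have equal initial segments, whose sums are i and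
      j.\<close>
    show "pairwise (\<lambda>i j. disjnt (?snoc i ` compositions i (Suc l)) (?snoc j ` compositions j (Suc l))) {1..<n}"
      by (auto simp: disjnt_def pairwise_def compositions_def)
  qed (auto simp: finite_compositions t)
  also have "\<dots> = (\<Oplus>\<^bsub>A\<^esub>m\<in>{1..<n}. rdiv_term A a b l m \<otimes>\<^bsub>A\<^esub> b (n - m))"
  proof (rule M.finsum_cong')
    fix m
    have "finsum A ?t (?snoc m ` compositions m (Suc l)) =
        (\<Oplus>\<^bsub>A\<^esub>ms\<in>compositions m (Suc l). ?t (?snoc m ms))"
      by (rule M.finsum_reindex) (auto simp: t inj_on_def)
    also have "\<dots> = (\<Oplus>\<^bsub>A\<^esub>ms\<in>compositions m (Suc l). ?t ms \<otimes>\<^bsub>A\<^esub> b (n - m))"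
    proof (rule M.finsum_cong')
      \<comment> \<open>The list \<open>ms\<close> has \<open>Suc l\<close> parts, so it is
        nonempty: its head is unchanged and the appended part is multiplied last.\<close>
      show "?t (?snoc m ms) = ?t ms \<otimes>\<^bsub>A\<^esub> b (n - m)" if "ms \<in> compositions m (Suc l)" for ms
        using that by (cases ms) (auto simp: compositions_def)
    qed (auto simp: t b mult_closed)
    also have "\<dots> = rdiv_term A a b l m \<otimes>\<^bsub>A\<^esub> b (n - m)"
      by (simp add: rdiv_term_def finsum_mult_l finite_compositions t b)
    finally show "finsum A ?t (?snoc m ` compositions m (Suc l)) =
        rdiv_term A a b l m \<otimes>\<^bsub>A\<^esub> b (n - m)" .
  qed (auto simp: rdiv_term_closed a b mult_closed)
  finally show ?thesis .
qed

abbreviation sign :: "nat \<Rightarrow> 'f" where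
  "sign l \<equiv> (\<ominus> \<one>) [^] l"

lemma sign_Suc_smult: "x \<in> carrier A \<Longrightarrow> sign (Suc l) \<odot>\<^bsub>A\<^esub> x = \<ominus>\<^bsub>A\<^esub> (sign l \<odot>\<^bsub>A\<^esub> x)"
  by (simp add: smult_assoc1 smult_l_minus smult_r_minus)

text \<open>Truncating the sum over the number of parts turns the recursion for the division expression
  into an induction on the truncation level.\<close>

definition rdiv_partial :: "(nat \<Rightarrow> 'a) \<Rightarrow> (nat \<Rightarrow> 'a) \<Rightarrow> nat \<Rightarrow> nat \<Rightarrow> 'a" where
  "rdiv_partial a b N n = (\<Oplus>\<^bsub>A\<^esub>l\<in>{..<N}. sign l \<odot>\<^bsub>A\<^esub> rdiv_term A a b l n)"

text \<open>Every truncation level N \<ge> n is exact, since terms with l \<ge> n have no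
  compositions to sum over. The level may thus be chosen independently of the coefficient.\<close>

lemma rdiv_expr_eq_partial:
  assumes n: "1 \<le> n" "n \<le> N" and a: "\<And>k. a k \<in> carrier A" and b: "\<And>k. b k \<in> carrier A"
  shows "rdiv_expr F A a b n = rdiv_partial a b N n"
proof -
  note t = rdiv_term_closed[of a b, OF a b]
  have "rdiv_partial a b N n = (\<Oplus>\<^bsub>A\<^esub>l\<in>insert 0 {1..n - 1}. sign l \<odot>\<^bsub>A\<^esub> rdiv_term A a b l n)"
    unfolding rdiv_partial_def
  proof (rule M.add.finprod_mono_neutral_cong_right)
    show "insert 0 {1..n - 1} \<subseteq> {..<N}" using n by auto
    show "sign l \<odot>\<^bsub>A\<^esub> rdiv_term A a b l n = \<zero>\<^bsub>A\<^esub>" if "l \<in> {..<N} - insert 0 {1..n - 1}" for l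
      using that n by (subst rdiv_term_eq_zero) auto
  qed (auto simp: t)
  also have "\<dots> = rdiv_term A a b 0 n \<oplus>\<^bsub>A\<^esub>
      (\<Oplus>\<^bsub>A\<^esub>l\<in>{1..n - 1}. sign l \<odot>\<^bsub>A\<^esub> rdiv_term A a b l n)"
    by (subst M.finsum_insert) (auto simp: t)
  finally show ?thesis
    using n a b by (simp add: rdiv_term_0) (simp add: rdiv_expr_def rdiv_term_def)
qed

text \<open>Right multiplication by a coefficient of b adds one part, so the inner sum on the right
  sits one level lower than the left-hand side.\<close>

lemma rdiv_partial_Suc:
  assumes n: "1 \<le> n" and a: "\<And>k. a k \<in> carrier A" and b: "\<And>k. b k \<in> carrier A"
  shows "rdiv_partial a b (Suc N) n =
    (a n \<ominus>\<^bsub>A\<^esub> b n) \<ominus>\<^bsub>A\<^esub> (\<Oplus>\<^bsub>A\<^esub>m\<in>{1..<n}. rdiv_partial a b N m \<otimes>\<^bsub>A\<^esub> b (n - m))"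
proof -
  note t = rdiv_term_closed[of a b, OF a b]
  have p: "rdiv_partial a b N m \<in> carrier A" for N m
    by (auto simp: rdiv_partial_def t intro!: M.finsum_closed)
  have step: "rdiv_partial a b (Suc N) m = sign N \<odot>\<^bsub>A\<^esub> rdiv_term A a b N m \<oplus>\<^bsub>A\<^esub> rdiv_partial a b N m" for N m
    by (simp add: rdiv_partial_def lessThan_Suc t)
  show ?thesis
  proof (induct N)
    \<comment> \<open>Level 0 is the empty sum, so only the leading difference survives.\<close>
    case 0
    have "(\<Oplus>\<^bsub>A\<^esub>m\<in>{1..<n}. rdiv_partial a b 0 m \<otimes>\<^bsub>A\<^esub> b (n - m)) = \<zero>\<^bsub>A\<^esub>"
      by (rule M.add.finprod_one_eqI) (simp add: rdiv_partial_def zero_mult b)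
    then show ?case
      using n a b by (simp add: step rdiv_term_0) (simp add: rdiv_partial_def a_minus_def)
  next
    case (Suc N)
    let ?S = "\<Oplus>\<^bsub>A\<^esub>m\<in>{1..<n}. (sign N \<odot>\<^bsub>A\<^esub> rdiv_term A a b N m) \<otimes>\<^bsub>A\<^esub> b (n - m)"
    let ?P = "\<Oplus>\<^bsub>A\<^esub>m\<in>{1..<n}. rdiv_partial a b N m \<otimes>\<^bsub>A\<^esub> b (n - m)"
    have cl: "?S \<in> carrier A" "?P \<in> carrier A" "a n \<in> carrier A" "b n \<in> carrier A"
      using a b by (auto simp: t p mult_closed intro!: M.finsum_closed)
    \<comment> \<open>With its last part split off, the new summand of index N + 1 is minus the sum
      of the terms of index N multiplied by b. This is exactly what the inner sum gains when its
      level rises by one.\<close>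
    have "sign (Suc N) \<odot>\<^bsub>A\<^esub> rdiv_term A a b (Suc N) n = \<ominus>\<^bsub>A\<^esub> (sign N \<odot>\<^bsub>A\<^esub> rdiv_term A a b (Suc N) n)"
      by (rule sign_Suc_smult[OF t])
    also have "sign N \<odot>\<^bsub>A\<^esub> rdiv_term A a b (Suc N) n = ?S"
      by (simp add: rdiv_term_Suc a b finsum_smult_ldistr t mult_closed smult_mult_l)
    finally have neg: "sign (Suc N) \<odot>\<^bsub>A\<^esub> rdiv_term A a b (Suc N) n = \<ominus>\<^bsub>A\<^esub> ?S" .
    have "(\<Oplus>\<^bsub>A\<^esub>m\<in>{1..<n}. rdiv_partial a b (Suc N) m \<otimes>\<^bsub>A\<^esub> b (n - m)) =
        (\<Oplus>\<^bsub>A\<^esub>m\<in>{1..<n}. (sign N \<odot>\<^bsub>A\<^esub> rdiv_term A a b N m) \<otimes>\<^bsub>A\<^esub> b (n - m) \<oplus>\<^bsub>A\<^esub>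
          rdiv_partial a b N m \<otimes>\<^bsub>A\<^esub> b (n - m))"
      using b by (intro M.finsum_cong') (auto simp: step mult_l_distr t p mult_closed)
    also have "\<dots> = ?S \<oplus>\<^bsub>A\<^esub> ?P"
      using b by (intro M.finsum_addf) (auto simp: t p mult_closed)
    finally have sum: "(\<Oplus>\<^bsub>A\<^esub>m\<in>{1..<n}. rdiv_partial a b (Suc N) m \<otimes>\<^bsub>A\<^esub> b (n - m)) = ?S \<oplus>\<^bsub>A\<^esub> ?P" .
    have "rdiv_partial a b (Suc (Suc N)) n = \<ominus>\<^bsub>A\<^esub> ?S \<oplus>\<^bsub>A\<^esub> ((a n \<ominus>\<^bsub>A\<^esub> b n) \<ominus>\<^bsub>A\<^esub> ?P)"
      by (simp only: step[of "Suc N"] neg Suc)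
    also have "\<dots> = (a n \<ominus>\<^bsub>A\<^esub> b n) \<ominus>\<^bsub>A\<^esub> (?S \<oplus>\<^bsub>A\<^esub> ?P)"
      using cl by (simp add: a_minus_def M.minus_add M.a_ac)
    finally show ?case by (simp only: sum)
  qed
qed

lemma rdiv_expr_rec:
  assumes n: "1 \<le> n" and a: "\<And>k. a k \<in> carrier A" and b: "\<And>k. b k \<in> carrier A"
  shows "rdiv_expr F A a b n =
    (a n \<ominus>\<^bsub>A\<^esub> b n) \<ominus>\<^bsub>A\<^esub> (\<Oplus>\<^bsub>A\<^esub>m\<in>{1..<n}. rdiv_expr F A a b m \<otimes>\<^bsub>A\<^esub> b (n - m))"
proof -
  \<comment> \<open>N = n - 1 makes both truncations exact at once: m \<le> N for every m < n, and n
    \<le> \<open>Suc N\<close>.\<close>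
  obtain N where N: "n = Suc N" using n by (cases n) auto
  have "(\<Oplus>\<^bsub>A\<^esub>m\<in>{1..<n}. rdiv_partial a b N m \<otimes>\<^bsub>A\<^esub> b (n - m)) =
      (\<Oplus>\<^bsub>A\<^esub>m\<in>{1..<n}. rdiv_expr F A a b m \<otimes>\<^bsub>A\<^esub> b (n - m))"
    using a b by (intro M.finsum_cong')
      (auto simp: N rdiv_expr_eq_partial[symmetric] rdiv_expr_closed mult_closed)
  then show ?thesis
    using rdiv_expr_eq_partial[of n n a b] rdiv_partial_Suc[of n a b N] assms by (simp add: N)
qed

text \<open>The extreme indices n and 0 are distinct for n \<ge> 1, and there one factor is 1. What
  remains involves only coefficients of index strictly between, which makes division a triangular
  problem.\<close>

lemma series_mult_Suc:
  assumes n: "1 \<le> n" and a: "a \<in> series_set A" and b: "b \<in> series_set A"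
  shows "series_mult A a b n =
    a n \<oplus>\<^bsub>A\<^esub> (b n \<oplus>\<^bsub>A\<^esub> (\<Oplus>\<^bsub>A\<^esub>m\<in>{1..<n}. a m \<otimes>\<^bsub>A\<^esub> b (n - m)))"
proof -
  have cl: "a k \<in> carrier A" "b k \<in> carrier A" "a 0 = \<one>\<^bsub>A\<^esub>" "b 0 = \<one>\<^bsub>A\<^esub>" for k
    using a b by (auto simp: series_set_def)
  have "{0..n} = insert n (insert 0 {1..<n})" using n by auto
  with n show ?thesis
    by (simp add: series_mult_def cl mult_closed mult_l_one mult_r_one del: M.finsum_zero)
qed

lemma rdiv_series_in_series_set:
  "\<lbrakk>a \<in> series_set A; b \<in> series_set A\<rbrakk> \<Longrightarrow> rdiv_series F A a b \<in> series_set A"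
  by (auto simp: series_set_def rdiv_series_def one_closed rdiv_expr_closed)

lemma rdiv_series_mult:
  assumes a: "a \<in> series_set A" and b: "b \<in> series_set A"
  shows "series_mult A (rdiv_series F A a b) b = a"
proof
  fix n
  have cl: "a k \<in> carrier A" "b k \<in> carrier A" "a 0 = \<one>\<^bsub>A\<^esub>" "b 0 = \<one>\<^bsub>A\<^esub>" for k
    using a b by (auto simp: series_set_def)
  show "series_mult A (rdiv_series F A a b) b n = a n"
  proof (cases "n = 0")
    case True
    then show ?thesis
      by (simp add: series_mult_def rdiv_series_def cl one_closed mult_l_one)
  next
    case False
    let ?S = "\<Oplus>\<^bsub>A\<^esub>m\<in>{1..<n}. rdiv_expr F A a b m \<otimes>\<^bsub>A\<^esub> b (n - m)"
    have S: "?S \<in> carrier A"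
      by (auto simp: cl rdiv_expr_closed mult_closed intro!: M.finsum_closed)
    have "(\<Oplus>\<^bsub>A\<^esub>m\<in>{1..<n}. rdiv_series F A a b m \<otimes>\<^bsub>A\<^esub> b (n - m)) = ?S"
      by (rule M.finsum_cong') (auto simp: rdiv_series_def cl rdiv_expr_closed mult_closed)
    then have "series_mult A (rdiv_series F A a b) b n =
        rdiv_expr F A a b n \<oplus>\<^bsub>A\<^esub> (b n \<oplus>\<^bsub>A\<^esub> ?S)"
      using False by (simp add: series_mult_Suc rdiv_series_in_series_set a b) (simp add: rdiv_series_def)
    also have "rdiv_expr F A a b n = (a n \<ominus>\<^bsub>A\<^esub> b n) \<ominus>\<^bsub>A\<^esub> ?S"
      using False by (intro rdiv_expr_rec) (auto simp: cl)
    also have "\<dots> = a n \<oplus>\<^bsub>A\<^esub> \<ominus>\<^bsub>A\<^esub> (b n \<oplus>\<^bsub>A\<^esub> ?S)"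
      using S by (simp add: a_minus_def M.minus_add M.a_assoc cl)
    also have "\<dots> \<oplus>\<^bsub>A\<^esub> (b n \<oplus>\<^bsub>A\<^esub> ?S) = a n"
      using S by (simp add: M.a_assoc M.l_neg cl)
    finally show ?thesis .
  qed
qed

text \<open>By strong induction the earlier coefficients agree, so the mixed sums agree and c_n =
  d_n follows by additive cancellation. This uniqueness serves the definite description in
  \<open>Inv\<close> and the law (a b)/b = a.\<close>

lemma series_mult_right_cancel:
  assumes c: "c \<in> series_set A" and d: "d \<in> series_set A" and b: "b \<in> series_set A"
    and eq: "series_mult A c b = series_mult A d b"
  shows "c = d"
proof
  fix n
  have cl: "c k \<in> carrier A" "d k \<in> carrier A" "b k \<in> carrier A" "c 0 = \<one>\<^bsub>A\<^esub>" "d 0 = \<one>\<^bsub>A\<^esub>" for k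
    using c d b by (auto simp: series_set_def)
  show "c n = d n"
  proof (induct n rule: less_induct)
    case (less n)
    show ?case
    proof (cases "n = 0")
      case True
      then show ?thesis by (simp add: cl)
    next
      case False
      let ?S = "b n \<oplus>\<^bsub>A\<^esub> (\<Oplus>\<^bsub>A\<^esub>m\<in>{1..<n}. d m \<otimes>\<^bsub>A\<^esub> b (n - m))"
      have "(\<Oplus>\<^bsub>A\<^esub>m\<in>{1..<n}. c m \<otimes>\<^bsub>A\<^esub> b (n - m)) = (\<Oplus>\<^bsub>A\<^esub>m\<in>{1..<n}. d m \<otimes>\<^bsub>A\<^esub> b (n - m))"
        using less by (intro M.finsum_cong') (auto simp: cl mult_closed)
      then have "c n \<oplus>\<^bsub>A\<^esub> ?S = d n \<oplus>\<^bsub>A\<^esub> ?S"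
        using False fun_cong[OF eq, of n] by (simp add: series_mult_Suc b c d)
      moreover have "?S \<in> carrier A"
        by (auto simp: cl mult_closed intro!: M.a_closed M.finsum_closed)
      ultimately show ?thesis by (simp add: cl)
    qed
  qed
qed

lemma Inv_rdiv:
  assumes a: "a \<in> series_set A" and b: "b \<in> series_set A"
  shows "rdiv (Inv A) a b = rdiv_series F A a b"
  using rdiv_series_in_series_set[OF a b] rdiv_series_mult[OF a b] series_mult_right_cancel[OF _ _ b]
  by (auto simp: Inv_def intro!: the_equality)

end

text \<open>The left division is the right division of the opposite algebra.\<close>

definition opposite :: "('f, 'a) module \<Rightarrow> ('f, 'a) module" where
  "opposite A = A\<lparr>mult := \<lambda>x y. y \<otimes>\<^bsub>A\<^esub> x\<rparr>"

lemma opposite_simps [simp]: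
  "carrier (opposite A) = carrier A" "x \<otimes>\<^bsub>opposite A\<^esub> y = y \<otimes>\<^bsub>A\<^esub> x" "\<one>\<^bsub>opposite A\<^esub> = \<one>\<^bsub>A\<^esub>"
  "\<zero>\<^bsub>opposite A\<^esub> = \<zero>\<^bsub>A\<^esub>" "x \<oplus>\<^bsub>opposite A\<^esub> y = x \<oplus>\<^bsub>A\<^esub> y" "r \<odot>\<^bsub>opposite A\<^esub> x = r \<odot>\<^bsub>A\<^esub> x"
  "finsum (opposite A) = finsum A" "x \<ominus>\<^bsub>opposite A\<^esub> y = x \<ominus>\<^bsub>A\<^esub> y" "series_set (opposite A) = series_set A"
  by (simp_all add: opposite_def finsum_def a_minus_def a_inv_def series_set_def fun_eq_iff)

section \<open>Left division and the loop laws\<close>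

context nonassoc_algebra
begin

lemma opposite_algebra: "nonassoc_algebra F (opposite A)"
proof -
  have "abelian_group (opposite A)"
  proof (rule abelian_groupI)
    fix x assume "x \<in> carrier (opposite A)"
    then show "\<exists>y\<in>carrier (opposite A). y \<oplus>\<^bsub>opposite A\<^esub> x = \<zero>\<^bsub>opposite A\<^esub>"
      by (intro bexI[of _ "\<ominus>\<^bsub>A\<^esub> x"]) (simp_all add: M.l_neg)
  qed (simp_all add: M.a_ac)
  then show ?thesis
    by (intro nonassoc_algebraI)
      (simp_all add: field_axioms mult_closed one_closed mult_l_one mult_r_one mult_l_distr
        mult_r_distr smult_mult_l smult_mult_r smult_l_distr smult_r_distr smult_assoc1)
qed

lemma series_mult_opposite:
  assumes "\<And>k. a k \<in> carrier A" "\<And>k. b k \<in> carrier A"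
  shows "series_mult (opposite A) a b = series_mult A b a"
proof
  fix n :: nat
  \<comment> \<open>The substitution of n - m for m exchanges the roles of the two factors.\<close>
  have img: "(\<lambda>m. n - m) ` {0..n} = {0..n}"
  proof
    show "{0..n} \<subseteq> (\<lambda>m. n - m) ` {0..n}"
    proof
      fix m assume "m \<in> {0..n}"
      then show "m \<in> (\<lambda>m. n - m) ` {0..n}" by (intro image_eqI[of _ _ "n - m"]) auto
    qed
  qed auto
  have "(\<Oplus>\<^bsub>A\<^esub>m\<in>{0..n}. b m \<otimes>\<^bsub>A\<^esub> a (n - m)) =
      (\<Oplus>\<^bsub>A\<^esub>m\<in>(\<lambda>m. n - m) ` {0..n}. b m \<otimes>\<^bsub>A\<^esub> a (n - m))"
    by (simp only: img)
  also have "\<dots> = (\<Oplus>\<^bsub>A\<^esub>m\<in>{0..n}. b (n - m) \<otimes>\<^bsub>A\<^esub> a (n - (n - m)))"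
    using assms by (intro M.finsum_reindex) (auto simp: inj_on_def mult_closed)
  also have "\<dots> = (\<Oplus>\<^bsub>A\<^esub>m\<in>{0..n}. b (n - m) \<otimes>\<^bsub>A\<^esub> a m)"
    using assms by (intro M.finsum_cong') (auto simp: mult_closed)
  finally show "series_mult (opposite A) a b n = series_mult A b a n"
    by (simp add: series_mult_def)
qed

text \<open>The arguments are swapped because a \<cdot> c = b reads as c times a equal to b in the
  opposite algebra. There the left-nested product becomes right-nested, with the parts in reverse
  order, and reversing compositions matches the two sums.\<close>

lemma rdiv_expr_opposite:
  assumes a: "\<And>k. a k \<in> carrier A" and b: "\<And>k. b k \<in> carrier A"
  shows "rdiv_expr F (opposite A) b a n = ldiv_expr F A a b n"
proof -
  let ?t = "\<lambda>ns. foldr (\<lambda>k u. a k \<otimes>\<^bsub>A\<^esub> u) (butlast ns) (b (last ns) \<ominus>\<^bsub>A\<^esub> a (last ns))"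
  have t: "?t ns \<in> carrier A" for ns by (simp add: foldr_mult_closed a b)
  have "(\<Oplus>\<^bsub>A\<^esub>ns\<in>compositions n l. foldl (\<lambda>u k. a k \<otimes>\<^bsub>A\<^esub> u) (b (hd ns) \<ominus>\<^bsub>A\<^esub> a (hd ns)) (tl ns)) =
      finsum A ?t (compositions n l)" if "1 \<le> l" for l
  proof -
    have "finsum A ?t (compositions n l) = finsum A ?t (rev ` compositions n l)"
      by (simp add: compositions_rev)
    also have "\<dots> = (\<Oplus>\<^bsub>A\<^esub>ns\<in>compositions n l. ?t (rev ns))"
      by (rule M.finsum_reindex) (auto simp: t)
    also have "\<dots> = (\<Oplus>\<^bsub>A\<^esub>ns\<in>compositions n l. foldl (\<lambda>u k. a k \<otimes>\<^bsub>A\<^esub> u) (b (hd ns) \<ominus>\<^bsub>A\<^esub> a (hd ns)) (tl ns))"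
    proof (rule M.finsum_cong'[OF refl])
      fix ns assume "ns \<in> compositions n l"
      \<comment> \<open>A composition into at least one part is nonempty, so its head exists and
        becomes the last part of the reversed list.\<close>
      with that obtain k ms where "ns = k # ms" by (cases ns) (auto simp: compositions_def)
      then show "?t (rev ns) = foldl (\<lambda>u k. a k \<otimes>\<^bsub>A\<^esub> u) (b (hd ns) \<ominus>\<^bsub>A\<^esub> a (hd ns)) (tl ns)"
        by (simp add: foldr_conv_foldl)
    next
      have "foldl (\<lambda>u k. a k \<otimes>\<^bsub>A\<^esub> u) u ns \<in> carrier A" if "u \<in> carrier A" for u ns
        using that by (induct ns arbitrary: u) (auto simp: a mult_closed)
      then show "(\<lambda>ns. foldl (\<lambda>u k. a k \<otimes>\<^bsub>A\<^esub> u) (b (hd ns) \<ominus>\<^bsub>A\<^esub> a (hd ns)) (tl ns))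
          \<in> compositions n l \<rightarrow> carrier A"
        by (auto simp: a b)
    qed
    finally show ?thesis by simp
  qed
  then show ?thesis by (simp add: rdiv_expr_def ldiv_expr_def)
qed

lemma rdiv_series_opposite:
  "\<lbrakk>a \<in> series_set A; b \<in> series_set A\<rbrakk> \<Longrightarrow> rdiv_series F (opposite A) b a = ldiv_series F A a b"
  by (auto simp: rdiv_series_def ldiv_series_def fun_eq_iff series_set_def rdiv_expr_opposite)

lemma series_mult_opposite':
  "\<lbrakk>a \<in> series_set A; b \<in> series_set A\<rbrakk> \<Longrightarrow> series_mult (opposite A) a b = series_mult A b a"
  by (auto simp: series_set_def series_mult_opposite)

lemma ldiv_series_in_series_set:
  "\<lbrakk>a \<in> series_set A; b \<in> series_set A\<rbrakk> \<Longrightarrow> ldiv_series F A a b \<in> series_set A"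
  by (auto simp: series_set_def ldiv_series_def one_closed ldiv_expr_closed)

lemma mult_ldiv_series:
  assumes a: "a \<in> series_set A" and b: "b \<in> series_set A"
  shows "series_mult A a (ldiv_series F A a b) = b"
proof -
  show ?thesis
    using nonassoc_algebra.rdiv_series_mult[OF opposite_algebra, of b a] assms ldiv_series_in_series_set[OF a b]
    by (simp add: rdiv_series_opposite series_mult_opposite')
qed

lemma series_mult_left_cancel:
  assumes c: "c \<in> series_set A" and d: "d \<in> series_set A" and b: "b \<in> series_set A"
    and eq: "series_mult A b c = series_mult A b d"
  shows "c = d"
  by (rule nonassoc_algebra.series_mult_right_cancel[OF opposite_algebra, of c d b])
    (simp_all add: assms series_mult_opposite')

lemma Inv_ldiv:
  assumes a: "a \<in> series_set A" and b: "b \<in> series_set A"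
  shows "ldiv (Inv A) a b = ldiv_series F A a b"
  using ldiv_series_in_series_set[OF a b] mult_ldiv_series[OF a b] series_mult_left_cancel[OF _ _ a]
  by (auto simp: Inv_def intro!: the_equality)

lemma series_mult_in_series_set:
  "\<lbrakk>a \<in> series_set A; b \<in> series_set A\<rbrakk> \<Longrightarrow> series_mult A a b \<in> series_set A"
  by (auto simp: series_set_def series_mult_closed)
    (simp add: series_mult_def one_closed mult_l_one)

lemma series_one_in_series_set: "\<one>\<^bsub>Inv A\<^esub> \<in> series_set A"
  by (auto simp: Inv_def series_set_def one_closed)

lemma Inv_simps: "carrier (Inv A) = series_set A" "x \<otimes>\<^bsub>Inv A\<^esub> y = series_mult A x y"
  by (simp_all add: Inv_def)

lemma series_one_mult:
  assumes "a \<in> series_set A"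
  shows "series_mult A \<one>\<^bsub>Inv A\<^esub> a = a"
proof
  fix n
  have cl: "a k \<in> carrier A" "a 0 = \<one>\<^bsub>A\<^esub>" for k using assms by (auto simp: series_set_def)
  have "(\<Oplus>\<^bsub>A\<^esub>m\<in>{1..<n}. \<one>\<^bsub>Inv A\<^esub> m \<otimes>\<^bsub>A\<^esub> a (n - m)) = \<zero>\<^bsub>A\<^esub>"
    by (rule M.add.finprod_one_eqI) (auto simp: Inv_def zero_mult cl)
  then show "series_mult A \<one>\<^bsub>Inv A\<^esub> a n = a n"
    using series_mult_Suc[OF _ series_one_in_series_set assms, of n]
    by (cases "n = 0") (auto simp: series_mult_def cl one_closed mult_l_one Inv_def)
qed

lemma series_mult_one:
  assumes "a \<in> series_set A"
  shows "series_mult A a \<one>\<^bsub>Inv A\<^esub> = a"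
proof -
  have "\<one>\<^bsub>Inv (opposite A)\<^esub> = \<one>\<^bsub>Inv A\<^esub>" by (auto simp: Inv_def)
  then show ?thesis
    using nonassoc_algebra.series_one_mult[OF opposite_algebra, of a] assms series_one_in_series_set
    by (simp add: series_mult_opposite')
qed

lemma Inv_loop: "loop (Inv A)"
proof (rule loop.intro, unfold Inv_simps)
  fix a b assume ab: "a \<in> series_set A" "b \<in> series_set A"
  note ba = ab(2,1)
  show "ldiv (Inv A) a b \<in> series_set A" "series_mult A a (ldiv (Inv A) a b) = b"
    using ab by (simp_all add: Inv_ldiv ldiv_series_in_series_set mult_ldiv_series)
  show "rdiv (Inv A) a b \<in> series_set A" "series_mult A (rdiv (Inv A) a b) b = a"
    using ab by (simp_all add: Inv_rdiv rdiv_series_in_series_set rdiv_series_mult)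
  have ab': "series_mult A a b \<in> series_set A" using ab by (rule series_mult_in_series_set)
  then show "series_mult A a b \<in> series_set A" .
  \<comment> \<open>The quotient of a b by a and the series b both solve a \<cdot> c = a \<cdot> b;
    cancellation identifies them.\<close>
  show "ldiv (Inv A) a (series_mult A a b) = b"
    using ab ab' series_mult_left_cancel[OF ldiv_series_in_series_set[OF ab(1) ab'] ab(2,1)]
    by (simp add: Inv_ldiv mult_ldiv_series)
  show "rdiv (Inv A) (series_mult A a b) b = a"
    using ab ab' series_mult_right_cancel[OF rdiv_series_in_series_set[OF ab' ab(2)] ab]
    by (simp add: Inv_rdiv rdiv_series_mult)
qed (simp_all add: series_one_in_series_set series_one_mult series_mult_one)

end

context alg_pair
begin

text \<open>Used in two roles: for a homomorphism between coefficient algebras it gives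
  functoriality of \<open>Inv\<close>, and for one out of H \<amalg> H it evaluates
  \<Delta>.\<close>

lemma hom_series_mult:
  assumes h: "h \<in> alg_hom F A B" and a: "\<And>k. a k \<in> carrier A" and b: "\<And>k. b k \<in> carrier A"
  shows "h (series_mult A a b n) = series_mult B (\<lambda>k. h (a k)) (\<lambda>k. h (b k)) n"
  by (simp add: series_mult_def hom_finsum[OF h] a b A.mult_closed alg_hom_mult[OF h])

lemma hom_rdiv_expr:
  assumes h: "h \<in> alg_hom F A B" and a: "\<And>k. a k \<in> carrier A" and b: "\<And>k. b k \<in> carrier A"
  shows "h (rdiv_expr F A a b n) = rdiv_expr F B (\<lambda>k. h (a k)) (\<lambda>k. h (b k)) n"
proof -
  have "h (foldl (\<lambda>u k. u \<otimes>\<^bsub>A\<^esub> b k) u ns) = foldl (\<lambda>u k. u \<otimes>\<^bsub>B\<^esub> h (b k)) (h u) ns"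
    if "u \<in> carrier A" for u ns
    using that by (induct ns arbitrary: u) (auto simp: b A.mult_closed alg_hom_mult[OF h])
  then show ?thesis
    by (simp add: rdiv_expr_def hom_finsum[OF h] alg_hom_add[OF h] alg_hom_smult[OF h]
        hom_minus[OF h] A.foldl_mult_closed a b)
qed

lemma hom_ldiv_expr:
  assumes h: "h \<in> alg_hom F A B" and a: "\<And>k. a k \<in> carrier A" and b: "\<And>k. b k \<in> carrier A"
  shows "h (ldiv_expr F A a b n) = ldiv_expr F B (\<lambda>k. h (a k)) (\<lambda>k. h (b k)) n"
proof -
  have "h (foldr (\<lambda>k u. a k \<otimes>\<^bsub>A\<^esub> u) ns u) = foldr (\<lambda>k u. h (a k) \<otimes>\<^bsub>B\<^esub> u) ns (h u)"
    if "u \<in> carrier A" for u ns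
    using that by (induct ns) (auto simp: a A.foldr_mult_closed alg_hom_mult[OF h])
  then show ?thesis
    by (simp add: ldiv_expr_def hom_finsum[OF h] alg_hom_add[OF h] alg_hom_smult[OF h]
        hom_minus[OF h] A.foldr_mult_closed a b)
qed

end

section \<open>The coloop bialgebra\<close>

text \<open>Folding after \<alpha> \<amalg> \<beta> is the copairing of \<alpha> and \<beta>, which
  restricts to them along the inclusions. So the convolution of \<alpha> and \<beta> evaluates a
  co-operation at the pair of series they represent.\<close>

lemma
  assumes H: "nonassoc_algebra F H" and A: "nonassoc_algebra F A"
    and \<alpha>: "\<alpha> \<in> alg_hom F H A" and \<beta>: "\<beta> \<in> alg_hom F H A"
  defines "k \<equiv> compose (carrier (coprod F H H)) (fold_map F A) (coprod_map F H H A A \<alpha> \<beta>)"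
  shows fold_coprod_map_hom: "k \<in> alg_hom F (coprod F H H) A"
    and fold_coprod_map_inj1: "\<And>h. h \<in> carrier H \<Longrightarrow> k (inj1 F H H h) = \<alpha> h"
    and fold_coprod_map_inj2: "\<And>h. h \<in> carrier H \<Longrightarrow> k (inj2 F H H h) = \<beta> h"
  using alg_hom_compose[OF coprod_algebra[OF H H] coprod_map_hom[OF H H A A \<alpha> \<beta>] fold_map_hom[OF A]]
  by (simp_all add: k_def compose_eq coprod_map_inj1[OF H H A A \<alpha> \<beta>] coprod_map_inj2[OF H H A A \<alpha> \<beta>]
      fold_map_inj1[OF A] fold_map_inj2[OF A] alg_hom_closed[OF inj1_hom[OF H H]]
      alg_hom_closed[OF inj2_hom[OF H H]] alg_hom_closed[OF \<alpha>] alg_hom_closed[OF \<beta>])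

lemma convolution_hom:
  assumes "nonassoc_algebra F H" "nonassoc_algebra F A" "\<alpha> \<in> alg_hom F H A" "\<beta> \<in> alg_hom F H A"
    and "\<delta> \<in> alg_hom F H (coprod F H H)"
  shows "convolution F H A \<delta> \<alpha> \<beta> \<in> alg_hom F H A"
  unfolding convolution_def
  by (rule alg_hom_compose[OF assms(1) alg_hom_compose[OF assms(1,5)
        coprod_map_hom[OF assms(1,1,2,2,3,4)]] fold_map_hom[OF assms(2)]])

lemma init_map_hom:
  assumes "nonassoc_algebra F A"
  shows "init_map F A \<in> alg_hom F (init_alg F) A"
proof -
  interpret nonassoc_algebra F A by fact
  show ?thesis
    by (rule alg_homI)
      (auto simp: init_map_def init_alg_def one_closed mult_closed smult_l_distr smult_assoc1
        smult_mult_l mult_l_one)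
qed

section \<open>Series as homomorphisms\<close>

context field
begin

lemma series_alg_algebra: "nonassoc_algebra R (series_alg R)"
  unfolding series_alg_def by (rule free_alg_algebra)

lemma series_alg2_algebra: "nonassoc_algebra R (series_alg2 R)"
  by (rule coprod_algebra[OF series_alg_algebra series_alg_algebra])

lemma gen_x_closed: "gen_x R n \<in> carrier (series_alg R)"
  using nonassoc_algebra.one_closed[OF series_alg_algebra] field_axioms
  by (simp add: gen_x_def) (simp add: series_alg_def)

lemma gen_x_0: "gen_x R 0 = \<one>\<^bsub>series_alg R\<^esub>"
  by (simp add: gen_x_def)

lemma series_hom_hom:
  assumes "nonassoc_algebra R A" "\<And>n. 1 \<le> n \<Longrightarrow> a n \<in> carrier A"
  shows "series_hom R A a \<in> alg_hom R (series_alg R) A"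
  unfolding series_hom_def series_alg_def
  by (rule nonassoc_algebra.free_lift_hom) (use assms in auto)

lemma series_hom_gen:
  assumes "nonassoc_algebra R A" "\<And>n. 1 \<le> n \<Longrightarrow> a n \<in> carrier A" "1 \<le> n"
  shows "series_hom R A a (gen_x R n) = a n"
  using assms(3) nonassoc_algebra.free_lift_gen[OF assms(1), of a "{n. 1 \<le> n}" n] assms(2)
  by (simp add: series_hom_def gen_x_def)

lemma series_alg_hom_eqI:
  assumes A: "nonassoc_algebra R A"
    and h: "h \<in> alg_hom R (series_alg R) A" and k: "k \<in> alg_hom R (series_alg R) A"
    and eq: "\<And>n. 1 \<le> n \<Longrightarrow> h (gen_x R n) = k (gen_x R n)"
  shows "h = k"
  by (rule nonassoc_algebra.free_alg_hom_eqI[OF A h[unfolded series_alg_def] k[unfolded series_alg_def]])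
    (use eq in \<open>force simp: gen_x_def\<close>)

lemma hom_gen_x_in_series_set:
  "h \<in> alg_hom R (series_alg R) A \<Longrightarrow> (\<lambda>n. h (gen_x R n)) \<in> series_set A"
  by (simp add: series_set_def gen_x_0 alg_hom_one alg_hom_closed gen_x_closed)

text \<open>The value at x_0 is covered too: x_0 is the unit of H and a_0 is the unit of A.\<close>

lemma series_hom_series_set:
  assumes A: "nonassoc_algebra R A" and a: "a \<in> series_set A"
  shows series_set_hom: "series_hom R A a \<in> alg_hom R (series_alg R) A"
    and series_set_hom_gen: "series_hom R A a (gen_x R n) = a n"
proof -
  have cl: "a n \<in> carrier A" for n using a by (simp add: series_set_def)
  show hom: "series_hom R A a \<in> alg_hom R (series_alg R) A"
    by (rule series_hom_hom[OF A cl])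
  show "series_hom R A a (gen_x R n) = a n"
    using series_hom_gen[OF A cl, of n] alg_hom_one[OF hom] a
    by (cases "n = 0") (auto simp: gen_x_0 series_set_def)
qed

lemma copies_in_series_set:
  "copy_x R \<in> series_set (series_alg2 R)" "copy_y R \<in> series_set (series_alg2 R)"
  using hom_gen_x_in_series_set[OF inj1_hom[OF series_alg_algebra series_alg_algebra]]
    hom_gen_x_in_series_set[OF inj2_hom[OF series_alg_algebra series_alg_algebra]]
  by (simp_all add: copy_x_def[abs_def] copy_y_def[abs_def])

lemma copies_closed:
  "copy_x R n \<in> carrier (series_alg2 R)" "copy_y R n \<in> carrier (series_alg2 R)"
  using copies_in_series_set by (simp_all add: series_set_def)

lemma
  shows series_\<Delta>_hom: "series_\<Delta> R \<in> alg_hom R (series_alg R) (series_alg2 R)"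
    and series_\<delta>r_hom: "series_\<delta>r R \<in> alg_hom R (series_alg R) (series_alg2 R)"
    and series_\<delta>l_hom: "series_\<delta>l R \<in> alg_hom R (series_alg R) (series_alg2 R)"
    and series_\<epsilon>_hom: "series_\<epsilon> R \<in> alg_hom R (series_alg R) (init_alg R)"
  unfolding series_\<Delta>_def series_\<delta>r_def series_\<delta>l_def series_\<epsilon>_def
  by (rule series_hom_hom[OF series_alg2_algebra] series_hom_hom[OF init_alg_algebra[OF field_axioms]];
      simp add: nonassoc_algebra.series_mult_closed[OF series_alg2_algebra]
        nonassoc_algebra.rdiv_expr_closed[OF series_alg2_algebra]
        nonassoc_algebra.ldiv_expr_closed[OF series_alg2_algebra] copies_closed init_alg_def)+

text \<open>The link between co-operations and loop operations. On a positive index it is naturality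
  of the defining expressions; at index 0 it is preservation of the unit, which is why the
  conclusions use \<open>rdiv_series\<close> and \<open>ldiv_series\<close> in place of the bare
  expressions.\<close>

lemma
  assumes A: "nonassoc_algebra R A" and k: "k \<in> alg_hom R (series_alg2 R) A"
    and a: "\<And>n. k (copy_x R n) = a n" and b: "\<And>n. k (copy_y R n) = b n"
  shows hom_series_\<Delta>: "k (series_\<Delta> R (gen_x R n)) = series_mult A a b n"
    and hom_series_\<delta>r: "k (series_\<delta>r R (gen_x R n)) = rdiv_series R A a b n"
    and hom_series_\<delta>l: "k (series_\<delta>l R (gen_x R n)) = ldiv_series R A a b n"
proof -
  interpret pair: alg_pair R "series_alg2 R" A
    by (intro alg_pair.intro series_alg2_algebra A)
  have cl: "a n \<in> carrier A" "b n \<in> carrier A" for n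
    using alg_hom_closed[OF k copies_closed(1)[of n]] alg_hom_closed[OF k copies_closed(2)[of n]]
    by (simp_all add: a b)
  have one: "a 0 = \<one>\<^bsub>A\<^esub>" "b 0 = \<one>\<^bsub>A\<^esub>"
    using copies_in_series_set alg_hom_one[OF k] a[of 0] b[of 0] by (simp_all add: series_set_def)
  note gen = series_hom_gen[OF series_alg2_algebra]
  note closed = pair.A.series_mult_closed pair.A.rdiv_expr_closed pair.A.ldiv_expr_closed
    copies_closed
  show "k (series_\<Delta> R (gen_x R n)) = series_mult A a b n"
  proof (cases "n = 0")
    case True
    then show ?thesis
      by (simp add: gen_x_0 alg_hom_one[OF series_\<Delta>_hom] alg_hom_one[OF k] series_mult_def one
          pair.B.mult_l_one pair.B.one_closed)
  next
    case False
    then show ?thesis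
      by (simp add: series_\<Delta>_def gen closed pair.hom_series_mult[OF k] a b)
  qed
  show "k (series_\<delta>r R (gen_x R n)) = rdiv_series R A a b n"
  proof (cases "n = 0")
    case True
    then show ?thesis
      by (simp add: gen_x_0 alg_hom_one[OF series_\<delta>r_hom] alg_hom_one[OF k] rdiv_series_def)
  next
    case False
    then show ?thesis
      by (simp add: series_\<delta>r_def gen closed pair.hom_rdiv_expr[OF k] a b rdiv_series_def)
  qed
  show "k (series_\<delta>l R (gen_x R n)) = ldiv_series R A a b n"
  proof (cases "n = 0")
    case True
    then show ?thesis
      by (simp add: gen_x_0 alg_hom_one[OF series_\<delta>l_hom] alg_hom_one[OF k] ldiv_series_def)
  next
    case False
    then show ?thesis
      by (simp add: series_\<delta>l_def gen closed pair.hom_ldiv_expr[OF k] a b ldiv_series_def)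
  qed
qed

text \<open>The counit represents the constant series 1, so the counit axioms become the unit laws
  of the series loop.\<close>

lemma series_\<epsilon>_gen: "series_\<epsilon> R (gen_x R n) = \<one>\<^bsub>Inv (init_alg R)\<^esub> n"
  using series_hom_gen[OF init_alg_algebra[OF field_axioms], of "\<lambda>n. \<zero>" n] alg_hom_one[OF series_\<epsilon>_hom]
  by (cases "n = 0") (auto simp: series_\<epsilon>_def Inv_def init_alg_def gen_x_0)

lemma Inv_one_hom:
  assumes "nonassoc_algebra R A" "nonassoc_algebra R B" "h \<in> alg_hom R A B"
  shows "h (\<one>\<^bsub>Inv A\<^esub> n) = \<one>\<^bsub>Inv B\<^esub> n"
  using alg_hom_one[OF assms(3)] alg_pair.hom_zero[OF alg_pair.intro[OF assms(1,2)] assms(3)]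
  by (simp add: Inv_def)

lemma
  assumes A: "nonassoc_algebra R A" and a: "a \<in> series_set A" and b: "b \<in> series_set A"
  defines "k \<equiv> compose (carrier (series_alg2 R)) (fold_map R A)
    (coprod_map R (series_alg R) (series_alg R) A A (series_hom R A a) (series_hom R A b))"
  shows fold_series_\<Delta>: "k (series_\<Delta> R (gen_x R n)) = series_mult A a b n"
    and fold_series_\<delta>r: "k (series_\<delta>r R (gen_x R n)) = rdiv_series R A a b n"
    and fold_series_\<delta>l: "k (series_\<delta>l R (gen_x R n)) = ldiv_series R A a b n"
proof -
  note H = series_alg_algebra
  note homs = series_set_hom[OF A a] series_set_hom[OF A b]
  have "k \<in> alg_hom R (series_alg2 R) A"
    unfolding k_def by (rule fold_coprod_map_hom[OF H A homs])
  moreover have "k (copy_x R m) = a m" "k (copy_y R m) = b m" for m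
    unfolding k_def copy_x_def copy_y_def
    by (simp_all add: fold_coprod_map_inj1[OF H A homs] fold_coprod_map_inj2[OF H A homs] gen_x_closed
        series_set_hom_gen[OF A a] series_set_hom_gen[OF A b])
  ultimately show "k (series_\<Delta> R (gen_x R n)) = series_mult A a b n"
    "k (series_\<delta>r R (gen_x R n)) = rdiv_series R A a b n"
    "k (series_\<delta>l R (gen_x R n)) = ldiv_series R A a b n"
    by (simp_all add: hom_series_\<Delta>[OF A] hom_series_\<delta>r[OF A] hom_series_\<delta>l[OF A])
qed

lemma series_coloop:
  "coloop R (series_alg R) (series_\<Delta> R) (series_\<delta>r R) (series_\<delta>l R) (series_\<epsilon> R)"
proof -
  let ?H = "series_alg R" and ?HH = "series_alg2 R" and ?I = "init_alg R"
  note H = series_alg_algebra and HH = series_alg2_algebra and I = init_alg_algebra[OF field_axioms]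
  note IH = coprod_algebra[OF I H] and HI = coprod_algebra[OF H I]
  note \<Delta> = series_\<Delta>_hom and \<delta>r = series_\<delta>r_hom and \<delta>l = series_\<delta>l_hom and \<epsilon> = series_\<epsilon>_hom
  note id = alg_id_hom[OF H]
  interpret HH: nonassoc_algebra R ?HH by (rule HH)
  \<comment> \<open>Taking the identity of H \<amalg> H as the evaluating homomorphism: the
    co-operations themselves are the product and quotients of the series x and y.\<close>
  have \<Delta>_gen: "series_\<Delta> R (gen_x R n) = series_mult ?HH (copy_x R) (copy_y R) n"
    and \<delta>r_gen: "series_\<delta>r R (gen_x R n) = rdiv_series R ?HH (copy_x R) (copy_y R) n"
    and \<delta>l_gen: "series_\<delta>l R (gen_x R n) = ldiv_series R ?HH (copy_x R) (copy_y R) n" for n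
    using hom_series_\<Delta>[OF HH alg_id_hom[OF HH], of "copy_x R" "copy_y R" n]
      hom_series_\<delta>r[OF HH alg_id_hom[OF HH], of "copy_x R" "copy_y R" n]
      hom_series_\<delta>l[OF HH alg_id_hom[OF HH], of "copy_x R" "copy_y R" n]
    by (simp_all add: copies_closed alg_hom_closed[OF \<Delta>] alg_hom_closed[OF \<delta>r] alg_hom_closed[OF \<delta>l]
        gen_x_closed)
  note copies = copies_in_series_set
  have right_x: "right_act R ?H \<delta> (copy_x R n) = \<delta> (gen_x R n)"
    and right_y: "right_act R ?H \<delta> (copy_y R n) = copy_y R n"
    and left_x: "left_act R ?H \<delta> (copy_x R n) = copy_x R n"
    and left_y: "left_act R ?H \<delta> (copy_y R n) = \<delta> (gen_x R n)"
    if "\<delta> \<in> alg_hom R ?H ?HH" for \<delta> n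
    by (simp_all add: copy_x_def copy_y_def right_act_inj1[OF H that] right_act_inj2[OF H that]
        left_act_inj1[OF H that] left_act_inj2[OF H that] gen_x_closed)
  \<comment> \<open>As H is free, an axiom in these composites needs checking only on the
    x_n.\<close>
  have right: "compose (carrier ?H) (right_act R ?H \<delta>') \<delta> = inj1 R ?H ?H"
    if \<delta>: "\<delta> \<in> alg_hom R ?H ?HH" and \<delta>': "\<delta>' \<in> alg_hom R ?H ?HH"
      and eq: "\<And>n. right_act R ?H \<delta>' (\<delta> (gen_x R n)) = copy_x R n" for \<delta> \<delta>'
    by (rule series_alg_hom_eqI[OF HH alg_hom_compose[OF H \<delta> right_act_hom[OF H \<delta>']] inj1_hom[OF H H]])
      (simp add: compose_eq gen_x_closed eq, simp add: copy_x_def)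
  have left: "compose (carrier ?H) (left_act R ?H \<delta>') \<delta> = inj2 R ?H ?H"
    if \<delta>: "\<delta> \<in> alg_hom R ?H ?HH" and \<delta>': "\<delta>' \<in> alg_hom R ?H ?HH"
      and eq: "\<And>n. left_act R ?H \<delta>' (\<delta> (gen_x R n)) = copy_y R n" for \<delta> \<delta>'
    by (rule series_alg_hom_eqI[OF HH alg_hom_compose[OF H \<delta> left_act_hom[OF H \<delta>']] inj2_hom[OF H H]])
      (simp add: compose_eq gen_x_closed eq, simp add: copy_y_def)
  \<comment> \<open>The axiom restricts every composite to the carrier of H,
    \<open>right_act\<close> to that of H \<amalg> H. They agree since \<delta> takes values in the
    latter.\<close>
  have right_compose: "compose (carrier ?H)
      (coprod_map R ?H ?HH ?H ?H (alg_id ?H) (fold_map R ?H))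
      (compose (carrier ?H) (assoc_right R ?H ?H ?H)
        (compose (carrier ?H) (coprod_map R ?H ?H ?HH ?H \<delta>' (alg_id ?H)) \<delta>)) =
      compose (carrier ?H) (right_act R ?H \<delta>') \<delta>" if "\<delta> \<in> alg_hom R ?H ?HH" for \<delta> \<delta>'
    by (rule extensionalityI[of _ "carrier ?H"])
      (simp_all add: compose_eq right_act_def alg_hom_closed[OF that])
  have left_compose: "compose (carrier ?H)
      (coprod_map R ?HH ?H ?H ?H (fold_map R ?H) (alg_id ?H))
      (compose (carrier ?H) (assoc_left R ?H ?H ?H)
        (compose (carrier ?H) (coprod_map R ?H ?H ?H ?HH (alg_id ?H) \<delta>') \<delta>)) =
      compose (carrier ?H) (left_act R ?H \<delta>') \<delta>" if "\<delta> \<in> alg_hom R ?H ?HH" for \<delta> \<delta>'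
    by (rule extensionalityI[of _ "carrier ?H"])
      (simp_all add: compose_eq left_act_def alg_hom_closed[OF that])
  show ?thesis
  proof (intro coloop.intro coloop_axioms.intro H \<Delta> \<delta>r \<delta>l \<epsilon>)
    let ?k = "coprod_map R ?H ?H ?I ?H (series_\<epsilon> R) (alg_id ?H)"
    note k = coprod_map_hom[OF H H I H \<epsilon> id]
    have "?k (series_\<Delta> R (gen_x R n)) = inj2 R ?I ?H (gen_x R n)" for n
    proof -
      \<comment> \<open>The counit turns the series x into the series 1, so \<Delta> becomes the
        product of 1 with y.\<close>
      have "?k (copy_x R m) = \<one>\<^bsub>Inv (coprod R ?I ?H)\<^esub> m"
        "?k (copy_y R m) = inj2 R ?I ?H (gen_x R m)" for m
        by (simp_all add: copy_x_def copy_y_def coprod_map_inj1[OF H H I H \<epsilon> id]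
            coprod_map_inj2[OF H H I H \<epsilon> id] gen_x_closed series_\<epsilon>_gen
            Inv_one_hom[OF I IH inj1_hom[OF I H]])
      then show ?thesis
        using hom_gen_x_in_series_set[OF inj2_hom[OF I H]]
        by (simp add: hom_series_\<Delta>[OF IH k] nonassoc_algebra.series_one_mult[OF IH])
    qed
    then show "compose (carrier ?H) ?k (series_\<Delta> R) = inj2 R ?I ?H"
      by (intro series_alg_hom_eqI[OF IH alg_hom_compose[OF H \<Delta> k] inj2_hom[OF I H]])
        (simp add: compose_eq gen_x_closed)
  next
    let ?k = "coprod_map R ?H ?H ?H ?I (alg_id ?H) (series_\<epsilon> R)"
    note k = coprod_map_hom[OF H H H I id \<epsilon>]
    have "?k (series_\<Delta> R (gen_x R n)) = inj1 R ?H ?I (gen_x R n)" for n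
    proof -
      have "?k (copy_x R m) = inj1 R ?H ?I (gen_x R m)"
        "?k (copy_y R m) = \<one>\<^bsub>Inv (coprod R ?H ?I)\<^esub> m" for m
        by (simp_all add: copy_x_def copy_y_def coprod_map_inj1[OF H H H I id \<epsilon>]
            coprod_map_inj2[OF H H H I id \<epsilon>] gen_x_closed series_\<epsilon>_gen
            Inv_one_hom[OF I HI inj2_hom[OF H I]])
      then show ?thesis
        using hom_gen_x_in_series_set[OF inj1_hom[OF H I]]
        by (simp add: hom_series_\<Delta>[OF HI k] nonassoc_algebra.series_mult_one[OF HI])
    qed
    then show "compose (carrier ?H) ?k (series_\<Delta> R) = inj1 R ?H ?I"
      by (intro series_alg_hom_eqI[OF HI alg_hom_compose[OF H \<Delta> k] inj1_hom[OF H I]])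
        (simp add: compose_eq gen_x_closed)
  next
    \<comment> \<open>Here x is replaced by x/y and y is kept, so the claim is (x/y) y = x.\<close>
    have "right_act R ?H (series_\<delta>r R) (series_\<Delta> R (gen_x R n)) = copy_x R n" for n
      using hom_series_\<Delta>[OF HH right_act_hom[OF H \<delta>r] right_x[OF \<delta>r] right_y[OF \<delta>r], of n]
      by (simp add: \<delta>r_gen[abs_def] HH.rdiv_series_mult[OF copies])
    then show "compose (carrier ?H) (coprod_map R ?H ?HH ?H ?H (alg_id ?H) (fold_map R ?H))
        (compose (carrier ?H) (assoc_right R ?H ?H ?H)
          (compose (carrier ?H) (coprod_map R ?H ?H ?HH ?H (series_\<delta>r R) (alg_id ?H)) (series_\<Delta> R))) =
        inj1 R ?H ?H"
      unfolding right_compose[OF \<Delta>] by (rule right[OF \<Delta> \<delta>r])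
  next
    \<comment> \<open>Here x is replaced by x y, so the claim is (x y)/y = x. Both sides give x y
      when multiplied by y, and y cancels.\<close>
    have "right_act R ?H (series_\<Delta> R) (series_\<delta>r R (gen_x R n)) = copy_x R n" for n
      using hom_series_\<delta>r[OF HH right_act_hom[OF H \<Delta>] right_x[OF \<Delta>] right_y[OF \<Delta>], of n]
        HH.series_mult_right_cancel[OF HH.rdiv_series_in_series_set
          [OF HH.series_mult_in_series_set[OF copies] copies(2)] copies]
        HH.rdiv_series_mult[OF HH.series_mult_in_series_set[OF copies] copies(2)]
      by (simp add: \<Delta>_gen[abs_def])
    then show "compose (carrier ?H) (coprod_map R ?H ?HH ?H ?H (alg_id ?H) (fold_map R ?H))
        (compose (carrier ?H) (assoc_right R ?H ?H ?H)
          (compose (carrier ?H) (coprod_map R ?H ?H ?HH ?H (series_\<Delta> R) (alg_id ?H)) (series_\<delta>r R))) =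
        inj1 R ?H ?H"
      unfolding right_compose[OF \<delta>r] by (rule right[OF \<delta>r \<Delta>])
  next
    \<comment> \<open>Now y is replaced by the left quotient of y by x; multiplying it by x on the
      left restores y.\<close>
    have "left_act R ?H (series_\<delta>l R) (series_\<Delta> R (gen_x R n)) = copy_y R n" for n
      using hom_series_\<Delta>[OF HH left_act_hom[OF H \<delta>l] left_x[OF \<delta>l] left_y[OF \<delta>l], of n]
      by (simp add: \<delta>l_gen[abs_def] HH.mult_ldiv_series[OF copies])
    then show "compose (carrier ?H) (coprod_map R ?HH ?H ?H ?H (fold_map R ?H) (alg_id ?H))
        (compose (carrier ?H) (assoc_left R ?H ?H ?H)
          (compose (carrier ?H) (coprod_map R ?H ?H ?H ?HH (alg_id ?H) (series_\<delta>l R)) (series_\<Delta> R))) =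
        inj2 R ?H ?H"
      unfolding left_compose[OF \<Delta>] by (rule left[OF \<Delta> \<delta>l])
  next
    \<comment> \<open>Now y is replaced by x y, and the left quotient of x y by x is y because x
      cancels on the left.\<close>
    have "left_act R ?H (series_\<Delta> R) (series_\<delta>l R (gen_x R n)) = copy_y R n" for n
      using hom_series_\<delta>l[OF HH left_act_hom[OF H \<Delta>] left_x[OF \<Delta>] left_y[OF \<Delta>], of n]
        HH.series_mult_left_cancel[OF HH.ldiv_series_in_series_set
          [OF copies(1) HH.series_mult_in_series_set[OF copies]] copies(2,1)]
        HH.mult_ldiv_series[OF copies(1) HH.series_mult_in_series_set[OF copies]]
      by (simp add: \<Delta>_gen[abs_def])
    then show "compose (carrier ?H) (coprod_map R ?HH ?H ?H ?H (fold_map R ?H) (alg_id ?H))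
        (compose (carrier ?H) (assoc_left R ?H ?H ?H)
          (compose (carrier ?H) (coprod_map R ?H ?H ?H ?HH (alg_id ?H) (series_\<Delta> R)) (series_\<delta>l R))) =
        inj2 R ?H ?H"
      unfolding left_compose[OF \<delta>l] by (rule left[OF \<delta>l \<Delta>])
  qed
qed

section \<open>Representability and the division formulas\<close>

lemma series_hom_loop_iso:
  assumes A: "nonassoc_algebra R A"
  shows "series_hom R A \<in> loop_iso (Inv A) (series_hom_loop R A)"
proof -
  interpret A: nonassoc_algebra R A by fact
  note H = series_alg_algebra
  \<comment> \<open>One statement for all three operations: a co-operation whose values on the x_n
    give the coefficients of c induces, on homomorphisms, the operation with result c.\<close>
  have conv: "series_hom R A c = convolution R (series_alg R) A \<delta> (series_hom R A a) (series_hom R A b)"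
    if "a \<in> series_set A" "b \<in> series_set A" "c \<in> series_set A"
      and \<delta>: "\<delta> \<in> alg_hom R (series_alg R) (series_alg2 R)"
      and eq: "\<And>n. compose (carrier (series_alg2 R)) (fold_map R A)
        (coprod_map R (series_alg R) (series_alg R) A A (series_hom R A a) (series_hom R A b))
          (\<delta> (gen_x R n)) = c n" for a b c \<delta>
  proof (rule series_alg_hom_eqI[OF A series_set_hom[OF A that(3)]
        convolution_hom[OF H A series_set_hom[OF A that(1)] series_set_hom[OF A that(2)] \<delta>]])
    fix n
    show "series_hom R A c (gen_x R n) =
        convolution R (series_alg R) A \<delta> (series_hom R A a) (series_hom R A b) (gen_x R n)"
      using eq[of n] that(3)
      by (simp add: convolution_def compose_eq gen_x_closed alg_hom_closed[OF \<delta>] series_set_hom_gen[OF A])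
  qed
  have one: "series_hom R A \<one>\<^bsub>Inv A\<^esub> = compose (carrier (series_alg R)) (init_map R A) (series_\<epsilon> R)"
    by (rule series_alg_hom_eqI[OF A series_set_hom[OF A A.series_one_in_series_set]
          alg_hom_compose[OF H series_\<epsilon>_hom init_map_hom[OF A]]])
      (simp add: compose_eq gen_x_closed series_\<epsilon>_gen series_set_hom_gen[OF A A.series_one_in_series_set]
        Inv_one_hom[OF init_alg_algebra[OF field_axioms] A init_map_hom[OF A]])
  have bij: "bij_betw (series_hom R A) (series_set A) (alg_hom R (series_alg R) A)"
  \<comment> \<open>The inverse evaluates a homomorphism at the x_n; the convention x_0 = 1 supplies
    the leading coefficient.\<close>
  proof (rule bij_betw_byWitness[where f' = "\<lambda>h n. h (gen_x R n)"])
    show "\<forall>a\<in>series_set A. (\<lambda>n. series_hom R A a (gen_x R n)) = a"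
      by (simp add: series_set_hom_gen[OF A])
    show "\<forall>h\<in>alg_hom R (series_alg R) A. series_hom R A (\<lambda>n. h (gen_x R n)) = h"
    proof
      fix h assume h: "h \<in> alg_hom R (series_alg R) A"
      note a = hom_gen_x_in_series_set[OF h]
      show "series_hom R A (\<lambda>n. h (gen_x R n)) = h"
        by (rule series_alg_hom_eqI[OF A series_set_hom[OF A a] h]) (simp add: series_set_hom_gen[OF A a])
    qed
  qed (auto simp: series_set_hom[OF A] hom_gen_x_in_series_set)
  show ?thesis
    unfolding loop_iso_def iso_def hom_def
    using bij one
    by (auto simp: hom_loop_def A.Inv_simps A.Inv_ldiv A.Inv_rdiv series_set_hom[OF A]
        A.series_mult_in_series_set A.ldiv_series_in_series_set A.rdiv_series_in_series_set
        fold_series_\<Delta>[OF A] fold_series_\<delta>r[OF A] fold_series_\<delta>l[OF A]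
        intro!: conv series_\<Delta>_hom series_\<delta>r_hom series_\<delta>l_hom)
qed

lemma series_division_formulas:
  assumes A: "nonassoc_algebra R A" and a: "a \<in> carrier (Inv A)" and b: "b \<in> carrier (Inv A)"
    and n: "1 \<le> n"
  shows "rdiv (Inv A) a b n =
      fold_map R A (coprod_map R (series_alg R) (series_alg R) A A
        (series_hom R A a) (series_hom R A b) (series_\<delta>r R (gen_x R n))) \<and>
    rdiv (Inv A) a b n = rdiv_expr R A a b n \<and>
    ldiv (Inv A) a b n =
      fold_map R A (coprod_map R (series_alg R) (series_alg R) A A
        (series_hom R A a) (series_hom R A b) (series_\<delta>l R (gen_x R n))) \<and>
    ldiv (Inv A) a b n = ldiv_expr R A a b n"
proof -
  interpret A: nonassoc_algebra R A by fact
  have ab: "a \<in> series_set A" "b \<in> series_set A" using a b by (simp_all add: A.Inv_simps)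
  \<comment> \<open>The evaluation facts are phrased with \<open>compose\<close>, which can be
    unfolded only at elements of the carrier.\<close>
  have "series_\<delta>r R (gen_x R n) \<in> carrier (series_alg2 R)" "series_\<delta>l R (gen_x R n) \<in> carrier (series_alg2 R)"
    using alg_hom_closed[OF series_\<delta>r_hom gen_x_closed] alg_hom_closed[OF series_\<delta>l_hom gen_x_closed] by auto
  then show ?thesis
    using n fold_series_\<delta>r[OF A ab, of n] fold_series_\<delta>l[OF A ab, of n]
    by (simp add: A.Inv_rdiv ab A.Inv_ldiv compose_eq) (simp add: rdiv_series_def ldiv_series_def)
qed

end

section \<open>Functoriality and naturality\<close>

lemma Inv_map_apply: "a \<in> series_set A \<Longrightarrow> Inv_map A f a = (\<lambda>n. f (a n))"
  by (simp add: Inv_map_def Inv_def)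

lemma Inv_map_closed: "\<lbrakk>f \<in> alg_hom F A B; a \<in> series_set A\<rbrakk> \<Longrightarrow> Inv_map A f a \<in> series_set B"
  by (auto simp: Inv_map_apply) (auto simp: series_set_def alg_hom_one alg_hom_closed)

lemma Inv_map_hom:
  assumes A: "nonassoc_algebra F A" and B: "nonassoc_algebra F B" and f: "f \<in> alg_hom F A B"
  shows "Inv_map A f \<in> hom (Inv A) (Inv B)"
proof -
  have "Inv_map A f (series_mult A a b) = series_mult B (Inv_map A f a) (Inv_map A f b)"
    if ab: "a \<in> series_set A" "b \<in> series_set A" for a b
    using alg_pair.hom_series_mult[OF alg_pair.intro[OF A B] f, of a b] ab
      nonassoc_algebra.series_mult_in_series_set[OF A ab]
    by (auto simp: Inv_map_apply series_set_def)
  then show ?thesis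
    by (auto simp: hom_def nonassoc_algebra.Inv_simps[OF A] nonassoc_algebra.Inv_simps[OF B]
        Inv_map_closed[OF f])
qed

lemma Inv_map_id: "Inv_map A (alg_id A) = (\<lambda>a\<in>carrier (Inv A). a)"
  by (auto simp: Inv_map_def Inv_def series_set_def fun_eq_iff restrict_def)

lemma Inv_map_compose:
  assumes f: "f \<in> alg_hom F A B"
  shows "Inv_map A (compose (carrier A) g f) =
    compose (carrier (Inv A)) (Inv_map B g) (Inv_map A f)"
proof (rule extensionalityI[of _ "carrier (Inv A)"])
  fix a assume "a \<in> carrier (Inv A)"
  then have a: "a \<in> series_set A" by (simp add: Inv_def)
  then have "a n \<in> carrier A" for n by (simp add: series_set_def)
  with a show "Inv_map A (compose (carrier A) g f) a =
      compose (carrier (Inv A)) (Inv_map B g) (Inv_map A f) a"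
    using Inv_map_closed[OF f a]
    by (simp add: compose_def Inv_def Inv_map_apply)
qed (simp_all add: Inv_map_def compose_def)

text \<open>Both homomorphisms send x_n to f(a_n), and H is free on the x_n.\<close>

lemma series_hom_natural:
  assumes A: "nonassoc_algebra F A" and B: "nonassoc_algebra F B" and f: "f \<in> alg_hom F A B"
    and a: "a \<in> carrier (Inv A)"
  shows "series_hom F B (Inv_map A f a) = compose (carrier (series_alg F)) f (series_hom F A a)"
proof -
  interpret A: nonassoc_algebra F A by fact
  have a: "a \<in> series_set A" using a by (simp add: A.Inv_simps)
  note fa = Inv_map_closed[OF f a]
  show ?thesis
    by (rule A.series_alg_hom_eqI[OF B A.series_set_hom[OF B fa]
          alg_hom_compose[OF A.series_alg_algebra A.series_set_hom[OF A a] f]])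
      (simp add: A.series_set_hom_gen[OF B fa] A.series_set_hom_gen[OF A a] compose_eq A.gen_x_closed,
        simp add: Inv_map_apply a)
qed

text \<open>The precise sense in which a series is a homomorphism with a(x_n) = a_n. Only n \<ge> 1
  is prescribed, since the value at x_0 is forced.\<close>

lemma series_hom_unique:
  assumes A: "nonassoc_algebra F A" and a: "a \<in> carrier (Inv A)"
  shows "h \<in> alg_hom F (series_alg F) A \<and> (\<forall>n\<ge>1. h (gen_x F n) = a n) \<longleftrightarrow> h = series_hom F A a"
proof -
  interpret A: nonassoc_algebra F A by fact
  have a: "a \<in> series_set A" using a by (simp add: A.Inv_simps)
  note hom = A.series_set_hom[OF A a] and gen = A.series_set_hom_gen[OF A a]
  show ?thesis
    using hom gen A.series_alg_hom_eqI[OF A _ hom, of h] by auto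
qed

text \<open>Algebras over different carrier types cannot be collected under one quantifier, so the
  functor and naturality laws are spread over clauses with independent type variables, each of which
  may be instantiated freely.\<close>

theorem theorem4p2p3:
  fixes F :: "('f, 'm) ring_scheme"
  assumes "field F"
  shows
    "coloop F (series_alg F) (series_\<Delta> F) (series_\<delta>r F) (series_\<delta>l F) (series_\<epsilon> F) \<and>

     (\<forall>A :: ('f, 'a) module. nonassoc_algebra F A \<longrightarrow>
        loop (Inv A) \<and>
        Inv_map A (alg_id A) = (\<lambda>a\<in>carrier (Inv A). a)) \<and>
     (\<forall>(A :: ('f, 'a) module) (B :: ('f, 'b) module).
        nonassoc_algebra F A \<longrightarrow> nonassoc_algebra F B \<longrightarrow>
        (\<forall>f\<in>alg_hom F A B. Inv_map A f \<in> hom (Inv A) (Inv B))) \<and>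
     (\<forall>(A :: ('f, 'a) module) (B :: ('f, 'b) module) (C :: ('f, 'c) module).
        nonassoc_algebra F A \<longrightarrow> nonassoc_algebra F B \<longrightarrow> nonassoc_algebra F C \<longrightarrow>
        (\<forall>f\<in>alg_hom F A B. \<forall>g\<in>alg_hom F B C.
           Inv_map A (compose (carrier A) g f) =
             compose (carrier (Inv A)) (Inv_map B g) (Inv_map A f))) \<and>

     (\<forall>A :: ('f, 'a) module. nonassoc_algebra F A \<longrightarrow>
        series_hom F A \<in> loop_iso (Inv A) (series_hom_loop F A)) \<and>
     (\<forall>(A :: ('f, 'a) module) (B :: ('f, 'b) module).
        nonassoc_algebra F A \<longrightarrow> nonassoc_algebra F B \<longrightarrow>
        (\<forall>f\<in>alg_hom F A B. \<forall>a\<in>carrier (Inv A).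
           series_hom F B (Inv_map A f a) =
             compose (carrier (series_alg F)) f (series_hom F A a))) \<and>

     (\<forall>A :: ('f, 'a) module. nonassoc_algebra F A \<longrightarrow>
        (\<forall>a\<in>carrier (Inv A). \<forall>h.
           h \<in> alg_hom F (series_alg F) A \<and> (\<forall>n\<ge>1. h (gen_x F n) = a n)
             \<longleftrightarrow> h = series_hom F A a)) \<and>

     (\<forall>A :: ('f, 'a) module. nonassoc_algebra F A \<longrightarrow>
        (\<forall>a\<in>carrier (Inv A). \<forall>b\<in>carrier (Inv A). \<forall>n\<ge>1.
           rdiv (Inv A) a b n =
             fold_map F A (coprod_map F (series_alg F) (series_alg F) A A
               (series_hom F A a) (series_hom F A b) (series_\<delta>r F (gen_x F n))) \<and>
           rdiv (Inv A) a b n = rdiv_expr F A a b n \<and>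
           ldiv (Inv A) a b n =
             fold_map F A (coprod_map F (series_alg F) (series_alg F) A A
               (series_hom F A a) (series_hom F A b) (series_\<delta>l F (gen_x F n))) \<and>
           ldiv (Inv A) a b n = ldiv_expr F A a b n))"
proof -
  interpret field F by fact
  show ?thesis
    by (intro conjI series_coloop; intro allI impI ballI)
      (rule series_division_formulas | assumption |
       intro conjI nonassoc_algebra.Inv_loop Inv_map_id Inv_map_hom Inv_map_compose
        series_hom_loop_iso series_hom_natural series_hom_unique)+
qed

end
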